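(* Let $R$ be a Tate $\varphi$-dg algebra over a field $k$. Then the map $\mathcal D$ is a differential on $\mathcal A^\varphi_\bullet(R)$, providing $\mathcal A^\varphi_\bullet(R)$ (with the deconcatenation coproduct $\Delta$ and the quasi-shuffle product $m$) with a Hopf dg-algebra structure.
   Context: Tensor products are over $k$. A Tate $\varphi$-dg algebra $R=\bigoplus_{m,n\in\mathbb Z}R^n_m$ over $k$ is a dg-algebra with cohomological grading $n$ (denoted $|\cdot|$), equipped with an additional (multiplicative) $\varphi$-grading $m$, a differential $d:R^n_m\to R^{n+1}_{m-1}$ of cohomological degree $+1$ and $\varphi$-degree $-1$, and an invertible Tate line: a 1-dimensional $k$-subspace $k(1)\subset R^0_1$ contained in the center of $R$, with $d\,k(1)=0$, whose nonzero elements are invertible in $R$. Put $R_1=\bigoplus_nR^n_1$, $\overline{R_1}=R_1/k(1)$, $\mathcal A^\varphi_0(R)=k$, $\mathcal A^\varphi_n(R)=\overline{R_1}\otimes R_1^{\otimes(n-1)}$ for $n>0$, graded by $|x_1\otimes\cdots\otimes x_n|=\sum|x_i|$. The map $\mathcal D$: inductively $\mathcal D(\overline x_1\otimes x_2\otimes\cdots\otimes x_n)=\overline{dx_1\cdot x_2}\otimes x_3\otimes\cdots\otimes x_n+(-1)^{|x_1|}\overline x_1\otimes\mathcal D(x_2\otimes\cdots\otimes x_n)$ (in the inductive step the same formula without bars; zero on tensors of length $\le1$). It is well defined since $dx\cdot y\in R_1$ for $x,y\in R_1$. Coproduct: $\Delta(\overline x_1\otimes x_2\otimes\cdots\otimes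 x_n)=\sum_{j=0}^n(\overline x_1\otimes\cdots\otimes x_j)\bigotimes(\overline x_{j+1}\otimes\cdots\otimes x_n)$. Product: fix $0\ne t\in k(1)$; on $\mathrm T_\bullet(R_1)$ let $m'$ be the bilinear product with unit $1$ and, for $p,q\ge1$, $$\begin{aligned}m'(x_1\otimes\cdots\otimes x_p,y_1\otimes\cdots\otimes y_q)=\ &x_1\otimes m'(x_2\otimes\cdots\otimes x_p,y_1\otimes\cdots\otimes y_q)\\&+(-1)^{(|x_1|+\cdots+|x_p|)|y_1|}y_1\otimes m'(x_1\otimes\cdots\otimes x_p,y_2\otimes\cdots\otimes y_q)\\&-(-1)^{(|x_2|+\cdots+|x_p|)|y_1|}x_1y_1t^{-1}\otimes t\otimes m'(x_2\otimes\cdots\otimes x_p,y_2\otimes\cdots\otimes y_q).\end{aligned}$$ With $\mathrm{pr}:\mathrm T_\bullet(R_1)\to\mathcal A^\varphi_\bullet(R)$ the projection, $m(\mathrm{pr}X,\mathrm{pr}Y)=\mathrm{pr}\,m'(X,Y)$.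
   Formalization: The Hopf dg-algebra claim (Leibniz rule for D, antipode commuting with D) is asserted only for graded-commutative R, since Leibniz fails for noncommutative R; that D is a differential and coderivation and that m, Δ give a graded Hopf algebra is asserted for every R. *)

theory Defs
  imports "HOL-Algebra.Algebraic_Closure_Type" "HOL-Library.Poly_Mapping"
begin

section \<open>Quotients of free vector spaces\<close>

text \<open>
  The free \<open>k\<close>-vector space on a set \<open>B\<close> is the space of finitely supported functions
  with support in \<open>B\<close>. Quotients of free vector spaces and tensor products are
  HOL-Algebra modules over the field \<^term>\<open>ring_of_type_algebra\<close> of all elements of the type
  \<open>'k\<close>; their elements are cosets.
\<close>

definition fscale :: "'k::field \<Rightarrow> ('x \<Rightarrow>\<^sub>0 'k) \<Rightarrow> ('x \<Rightarrow>\<^sub>0 'k)"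
  where "fscale c = Poly_Mapping.map ((*) c)"

abbreviation gen :: "'x \<Rightarrow> ('x \<Rightarrow>\<^sub>0 'k::field)"
  where "gen x \<equiv> Poly_Mapping.single x 1"

definition fspan :: "('x \<Rightarrow>\<^sub>0 'k::field) set \<Rightarrow> ('x \<Rightarrow>\<^sub>0 'k) set"
  where "fspan = module.span fscale"

definition free_on :: "'x set \<Rightarrow> ('x \<Rightarrow>\<^sub>0 'k::field) set"
  where "free_on B = {f. Poly_Mapping.keys f \<subseteq> B}"

definition lin_ext :: "('x \<Rightarrow> ('y \<Rightarrow>\<^sub>0 'k)) \<Rightarrow> ('x \<Rightarrow>\<^sub>0 'k::field) \<Rightarrow> ('y \<Rightarrow>\<^sub>0 'k)"
  where "lin_ext F f = (\<Sum>x\<in>Poly_Mapping.keys f. fscale (Poly_Mapping.lookup f x) (F x))"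

definition qclass :: "('x \<Rightarrow>\<^sub>0 'k::field) set \<Rightarrow> ('x \<Rightarrow>\<^sub>0 'k) \<Rightarrow> ('x \<Rightarrow>\<^sub>0 'k) set"
  where "qclass N f = (\<lambda>n. f + n) ` N"

text \<open>
  Operations on cosets are unions of the cosets obtained from all representatives. Such a union
  is a single coset only if the operation does not depend on the representatives, so an
  ill-defined operation would violate closure.
\<close>

definition quotient_module ::
  "('x \<Rightarrow>\<^sub>0 'k::field) set \<Rightarrow> ('x \<Rightarrow>\<^sub>0 'k) set \<Rightarrow> ('k, ('x \<Rightarrow>\<^sub>0 'k) set) module"
  where "quotient_module V N =
    \<lparr>carrier = qclass N ` V, monoid.mult = undefined, one = undefined, ring.zero = qclass N 0,
     add = (\<lambda>P Q. \<Union>p\<in>P. \<Union>q\<in>Q. qclass N (p + q)),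
     module.smult = (\<lambda>c P. \<Union>p\<in>P. qclass N (fscale c p))\<rparr>"


section \<open>Tensor products\<close>

definition k_linear :: "('k, 'v) module \<Rightarrow> ('k, 'w) module \<Rightarrow> ('v \<Rightarrow> 'w) \<Rightarrow> bool"
  where "k_linear V W f \<longleftrightarrow>
    f \<in> carrier V \<rightarrow> carrier W \<and>
    (\<forall>x\<in>carrier V. \<forall>y\<in>carrier V. f (x \<oplus>\<^bsub>V\<^esub> y) = f x \<oplus>\<^bsub>W\<^esub> f y) \<and>
    (\<forall>c. \<forall>x\<in>carrier V. f (c \<odot>\<^bsub>V\<^esub> x) = c \<odot>\<^bsub>W\<^esub> f x)"

definition tensor_rel ::
  "('k::field, 'v) module \<Rightarrow> ('k, 'w) module \<Rightarrow> ('v \<times> 'w \<Rightarrow>\<^sub>0 'k) set"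
  where "tensor_rel V W = fspan (
    {gen (v \<oplus>\<^bsub>V\<^esub> v', w) - gen (v, w) - gen (v', w) | v v' w.
       v \<in> carrier V \<and> v' \<in> carrier V \<and> w \<in> carrier W} \<union>
    {gen (v, w \<oplus>\<^bsub>W\<^esub> w') - gen (v, w) - gen (v, w') | v w w'.
       v \<in> carrier V \<and> w \<in> carrier W \<and> w' \<in> carrier W} \<union>
    {gen (c \<odot>\<^bsub>V\<^esub> v, w) - fscale c (gen (v, w)) | c v w. v \<in> carrier V \<and> w \<in> carrier W} \<union>
    {gen (v, c \<odot>\<^bsub>W\<^esub> w) - fscale c (gen (v, w)) | c v w. v \<in> carrier V \<and> w \<in> carrier W})"

definition tensor ::
  "('k::field, 'v) module \<Rightarrow> ('k, 'w) module \<Rightarrow> ('k, ('v \<times> 'w \<Rightarrow>\<^sub>0 'k) set) module"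
  where "tensor V W = quotient_module (free_on (carrier V \<times> carrier W)) (tensor_rel V W)"

definition pure_tensor ::
  "('k::field, 'v) module \<Rightarrow> ('k, 'w) module \<Rightarrow> 'v \<Rightarrow> 'w \<Rightarrow> ('v \<times> 'w \<Rightarrow>\<^sub>0 'k) set"
  where "pure_tensor V W v w = qclass (tensor_rel V W) (gen (v, w))"

text \<open>The linear map to \<open>U\<close> on a tensor product which is induced by a bilinear map \<open>\<beta>\<close>.\<close>

definition tensor_lift ::
  "('k::field, 'u) module \<Rightarrow> ('v \<Rightarrow> 'w \<Rightarrow> 'u) \<Rightarrow> ('v \<times> 'w \<Rightarrow>\<^sub>0 'k) set \<Rightarrow> 'u"
  where "tensor_lift U \<beta> \<xi> = the_elem
    ((\<lambda>f. \<Oplus>\<^bsub>U\<^esub>p\<in>Poly_Mapping.keys f. Poly_Mapping.lookup f p \<odot>\<^bsub>U\<^esub> \<beta> (fst p) (snd p)) ` \<xi>)"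

definition tensor_map ::
  "('k::field, 'v) module \<Rightarrow> ('k, 'w) module \<Rightarrow> ('a \<Rightarrow> 'v) \<Rightarrow> ('b \<Rightarrow> 'w) \<Rightarrow>
   ('a \<times> 'b \<Rightarrow>\<^sub>0 'k) set \<Rightarrow> ('v \<times> 'w \<Rightarrow>\<^sub>0 'k) set"
  where "tensor_map V W f g = tensor_lift (tensor V W) (\<lambda>a b. pure_tensor V W (f a) (g b))"

text \<open>The isomorphism \<open>(U \<otimes> V) \<otimes> W \<rightarrow> U \<otimes> (V \<otimes> W)\<close>.\<close>

definition tensor_assoc ::
  "('k::field, 'u) module \<Rightarrow> ('k, 'v) module \<Rightarrow> ('k, 'w) module \<Rightarrow>
   (('u \<times> 'v \<Rightarrow>\<^sub>0 'k) set \<times> 'w \<Rightarrow>\<^sub>0 'k) set \<Rightarrow> ('u \<times> ('v \<times> 'w \<Rightarrow>\<^sub>0 'k) set \<Rightarrow>\<^sub>0 'k) set"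
  where "tensor_assoc U V W =
    (let T = tensor U (tensor V W) in
     tensor_lift T (\<lambda>\<xi> w. tensor_lift T
       (\<lambda>u v. pure_tensor U (tensor V W) u (pure_tensor V W v w)) \<xi>))"


section \<open>Hopf dg-algebras\<close>

definition decomposes :: "('k::field, 'v) module \<Rightarrow> (int \<Rightarrow> 'v set) \<Rightarrow> 'v \<Rightarrow> (int \<Rightarrow> 'v) \<Rightarrow> bool"
  where "decomposes V gr v c \<longleftrightarrow>
    (\<forall>n. c n \<in> gr n) \<and> finite {n. c n \<noteq> \<zero>\<^bsub>V\<^esub>} \<and> v = (\<Oplus>\<^bsub>V\<^esub>n\<in>{n. c n \<noteq> \<zero>\<^bsub>V\<^esub>}. c n)"

definition component :: "('k::field, 'v) module \<Rightarrow> (int \<Rightarrow> 'v set) \<Rightarrow> 'v \<Rightarrow> int \<Rightarrow> 'v"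
  where "component V gr v = (THE c. decomposes V gr v c)"

definition comp_supp :: "('k::field, 'v) module \<Rightarrow> (int \<Rightarrow> 'v set) \<Rightarrow> 'v \<Rightarrow> int set"
  where "comp_supp V gr v = {n. component V gr v n \<noteq> \<zero>\<^bsub>V\<^esub>}"

locale graded_space =
  module "ring_of_type_algebra :: 'k ring" V
  for V :: "('k::field, 'v) module" +
  fixes gr :: "int \<Rightarrow> 'v set"
  assumes gr_submodule: "submodule (gr n) (ring_of_type_algebra :: 'k ring) V"
    and gr_direct_sum: "v \<in> carrier V \<Longrightarrow> \<exists>!c. decomposes V gr v c"

definition tensor_grading ::
  "('k::field, 'v) module \<Rightarrow> (int \<Rightarrow> 'v set) \<Rightarrow> int \<Rightarrow> ('v \<times> 'v \<Rightarrow>\<^sub>0 'k) set set"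
  where "tensor_grading V gr n = qclass (tensor_rel V V) ` free_on (\<Union>i. gr i \<times> gr (n - i))"

text \<open>
  Koszul sign rule for \<open>A \<otimes> A\<close>, extended from homogeneous to arbitrary elements:
  \<open>(a \<otimes> b) (c \<otimes> e) = (-1)\<^bsup>|b| |c|\<^esup> a c \<otimes> b e\<close> and
  \<open>D (a \<otimes> b) = D a \<otimes> b + (-1)\<^bsup>|a|\<^esup> a \<otimes> D b\<close>.
\<close>

definition tensor_mult ::
  "('k::field, 'a) module \<Rightarrow> (int \<Rightarrow> 'a set) \<Rightarrow>
   ('a \<times> 'a \<Rightarrow>\<^sub>0 'k) set \<Rightarrow> ('a \<times> 'a \<Rightarrow>\<^sub>0 'k) set \<Rightarrow> ('a \<times> 'a \<Rightarrow>\<^sub>0 'k) set"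
  where "tensor_mult A gr \<xi> \<eta> =
    (let T = tensor A A in
     tensor_lift T (\<lambda>a b. tensor_lift T (\<lambda>c e.
       \<Oplus>\<^bsub>T\<^esub>i\<in>comp_supp A gr b. \<Oplus>\<^bsub>T\<^esub>j\<in>comp_supp A gr c.
         ((-1) powi (i * j)) \<odot>\<^bsub>T\<^esub>
           pure_tensor A A (a \<otimes>\<^bsub>A\<^esub> component A gr c j) (component A gr b i \<otimes>\<^bsub>A\<^esub> e)) \<eta>) \<xi>)"

definition tensor_algebra ::
  "('k::field, 'a) module \<Rightarrow> (int \<Rightarrow> 'a set) \<Rightarrow> ('k, ('a \<times> 'a \<Rightarrow>\<^sub>0 'k) set) module"
  where "tensor_algebra A gr = (tensor A A)
    \<lparr>monoid.mult := tensor_mult A gr, one := pure_tensor A A \<one>\<^bsub>A\<^esub> \<one>\<^bsub>A\<^esub>\<rparr>"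

definition tensor_diff ::
  "('k::field, 'a) module \<Rightarrow> (int \<Rightarrow> 'a set) \<Rightarrow> ('a \<Rightarrow> 'a) \<Rightarrow>
   ('a \<times> 'a \<Rightarrow>\<^sub>0 'k) set \<Rightarrow> ('a \<times> 'a \<Rightarrow>\<^sub>0 'k) set"
  where "tensor_diff A gr D =
    (let T = tensor A A in
     tensor_lift T (\<lambda>a b.
       pure_tensor A A (D a) b \<oplus>\<^bsub>T\<^esub>
       (\<Oplus>\<^bsub>T\<^esub>i\<in>comp_supp A gr a.
          ((-1) powi i) \<odot>\<^bsub>T\<^esub> pure_tensor A A (component A gr a i) (D b))))"

definition is_antipode ::
  "('k::field, 'a) module \<Rightarrow> (int \<Rightarrow> 'a set) \<Rightarrow> ('a \<Rightarrow> ('a \<times> 'a \<Rightarrow>\<^sub>0 'k) set) \<Rightarrow> ('a \<Rightarrow> 'k) \<Rightarrow>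
   ('a \<Rightarrow> 'a) \<Rightarrow> bool"
  where "is_antipode A gr \<Delta> \<epsilon> S \<longleftrightarrow>
    k_linear A A S \<and> (\<forall>n. S ` gr n \<subseteq> gr n) \<and>
    (\<forall>a\<in>carrier A.
       tensor_lift A (\<lambda>b c. S b \<otimes>\<^bsub>A\<^esub> c) (\<Delta> a) = \<epsilon> a \<odot>\<^bsub>A\<^esub> \<one>\<^bsub>A\<^esub> \<and>
       tensor_lift A (\<lambda>b c. b \<otimes>\<^bsub>A\<^esub> S c) (\<Delta> a) = \<epsilon> a \<odot>\<^bsub>A\<^esub> \<one>\<^bsub>A\<^esub>)"

locale graded_hopf_algebra = graded_space A gr + ring A
  for A :: "('k::field, 'a) module" and gr :: "int \<Rightarrow> 'a set" +
  fixes \<Delta> :: "'a \<Rightarrow> ('a \<times> 'a \<Rightarrow>\<^sub>0 'k) set"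
    and \<epsilon> :: "'a \<Rightarrow> 'k"
  assumes smult_mult_left: "\<lbrakk>a \<in> carrier A; b \<in> carrier A\<rbrakk> \<Longrightarrow>
        (c \<odot>\<^bsub>A\<^esub> a) \<otimes>\<^bsub>A\<^esub> b = c \<odot>\<^bsub>A\<^esub> (a \<otimes>\<^bsub>A\<^esub> b)"
    and smult_mult_right: "\<lbrakk>a \<in> carrier A; b \<in> carrier A\<rbrakk> \<Longrightarrow>
        a \<otimes>\<^bsub>A\<^esub> (c \<odot>\<^bsub>A\<^esub> b) = c \<odot>\<^bsub>A\<^esub> (a \<otimes>\<^bsub>A\<^esub> b)"
    and one_degree: "\<one>\<^bsub>A\<^esub> \<in> gr 0"
    and mult_degree: "\<lbrakk>a \<in> gr i; b \<in> gr j\<rbrakk> \<Longrightarrow> a \<otimes>\<^bsub>A\<^esub> b \<in> gr (i + j)"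
    and comult_linear: "k_linear A (tensor A A) \<Delta>"
    and comult_degree: "a \<in> gr n \<Longrightarrow> \<Delta> a \<in> tensor_grading A gr n"
    and counit_add: "\<lbrakk>a \<in> carrier A; b \<in> carrier A\<rbrakk> \<Longrightarrow> \<epsilon> (a \<oplus>\<^bsub>A\<^esub> b) = \<epsilon> a + \<epsilon> b"
    and counit_smult: "a \<in> carrier A \<Longrightarrow> \<epsilon> (c \<odot>\<^bsub>A\<^esub> a) = c * \<epsilon> a"
    and counit_degree: "\<lbrakk>a \<in> gr n; n \<noteq> 0\<rbrakk> \<Longrightarrow> \<epsilon> a = 0"
    and coassoc: "a \<in> carrier A \<Longrightarrow>
        tensor_assoc A A A (tensor_map (tensor A A) A \<Delta> (\<lambda>x. x) (\<Delta> a)) =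
        tensor_map A (tensor A A) (\<lambda>x. x) \<Delta> (\<Delta> a)"
    and counit_left: "a \<in> carrier A \<Longrightarrow> tensor_lift A (\<lambda>b c. \<epsilon> b \<odot>\<^bsub>A\<^esub> c) (\<Delta> a) = a"
    and counit_right: "a \<in> carrier A \<Longrightarrow> tensor_lift A (\<lambda>b c. \<epsilon> c \<odot>\<^bsub>A\<^esub> b) (\<Delta> a) = a"
    and comult_ring_hom: "\<Delta> \<in> ring_hom A (tensor_algebra A gr)"
    and counit_mult: "\<lbrakk>a \<in> carrier A; b \<in> carrier A\<rbrakk> \<Longrightarrow> \<epsilon> (a \<otimes>\<^bsub>A\<^esub> b) = \<epsilon> a * \<epsilon> b"
    and counit_one: "\<epsilon> \<one>\<^bsub>A\<^esub> = 1"
    and antipode: "\<exists>S. is_antipode A gr \<Delta> \<epsilon> S"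

definition is_differential ::
  "('k::field, 'a) module \<Rightarrow> (int \<Rightarrow> 'a set) \<Rightarrow> ('a \<Rightarrow> 'a) \<Rightarrow> bool"
  where "is_differential A gr D \<longleftrightarrow>
    k_linear A A D \<and> (\<forall>n. D ` gr n \<subseteq> gr (n + 1)) \<and> (\<forall>a\<in>carrier A. D (D a) = \<zero>\<^bsub>A\<^esub>)"

definition is_derivation ::
  "('k::field, 'a) module \<Rightarrow> (int \<Rightarrow> 'a set) \<Rightarrow> ('a \<Rightarrow> 'a) \<Rightarrow> bool"
  where "is_derivation A gr D \<longleftrightarrow>
    (\<forall>n. \<forall>a\<in>gr n. \<forall>b\<in>carrier A.
       D (a \<otimes>\<^bsub>A\<^esub> b) = D a \<otimes>\<^bsub>A\<^esub> b \<oplus>\<^bsub>A\<^esub> ((-1) powi n) \<odot>\<^bsub>A\<^esub> (a \<otimes>\<^bsub>A\<^esub> D b))"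

definition is_coderivation ::
  "('k::field, 'a) module \<Rightarrow> (int \<Rightarrow> 'a set) \<Rightarrow> ('a \<Rightarrow> ('a \<times> 'a \<Rightarrow>\<^sub>0 'k) set) \<Rightarrow> ('a \<Rightarrow> 'k) \<Rightarrow>
   ('a \<Rightarrow> 'a) \<Rightarrow> bool"
  where "is_coderivation A gr \<Delta> \<epsilon> D \<longleftrightarrow>
    (\<forall>a\<in>carrier A. \<Delta> (D a) = tensor_diff A gr D (\<Delta> a) \<and> \<epsilon> (D a) = 0)"

text \<open>
  A Hopf dg-algebra is a Hopf monoid in complexes of vector spaces: all structure maps,
  the antipode included, have degree 0 and commute with the differentials.
\<close>

locale hopf_dg_algebra = graded_hopf_algebra A gr \<Delta> \<epsilon>
  for A :: "('k::field, 'a) module" and gr :: "int \<Rightarrow> 'a set"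
    and \<Delta> :: "'a \<Rightarrow> ('a \<times> 'a \<Rightarrow>\<^sub>0 'k) set" and \<epsilon> :: "'a \<Rightarrow> 'k" +
  fixes D :: "'a \<Rightarrow> 'a"
  assumes differential: "is_differential A gr D"
    and derivation: "is_derivation A gr D"
    and coderivation: "is_coderivation A gr \<Delta> \<epsilon> D"
    and antipode_differential:
      "\<exists>S. is_antipode A gr \<Delta> \<epsilon> S \<and> (\<forall>a\<in>carrier A. D (S a) = S (D a))"


section \<open>Tate \<open>\<phi>\<close>-dg algebras\<close>

text \<open>
  \<open>R\<close> is the whole type \<open>'r\<close>; \<open>G n m\<close> is the component \<open>R\<^bsup>n\<^esup>\<^sub>m\<close> of cohomological degree \<open>n\<close> and
  \<open>\<phi>\<close>-degree \<open>m\<close>; \<open>L\<close> is the Tate line \<open>k(1)\<close>.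
\<close>

locale tate_phi_dg_algebra = vector_space scale
  for scale :: "'k::field \<Rightarrow> 'r::ring_1 \<Rightarrow> 'r" +
  fixes G :: "int \<Rightarrow> int \<Rightarrow> 'r set"
    and d :: "'r \<Rightarrow> 'r"
    and L :: "'r set"
  assumes scale_mult_left: "scale c x * y = scale c (x * y)"
    and scale_mult_right: "x * scale c y = scale c (x * y)"
    and G_subspace: "subspace (G n m)"
    and G_direct_sum: "\<exists>!c. (\<forall>n m. c (n, m) \<in> G n m) \<and> finite {p. c p \<noteq> 0} \<and>
        x = (\<Sum>p | c p \<noteq> 0. c p)"
    and G_one: "1 \<in> G 0 0"
    and G_mult: "\<lbrakk>x \<in> G n m; y \<in> G n' m'\<rbrakk> \<Longrightarrow> x * y \<in> G (n + n') (m + m')"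
    and d_linear: "Vector_Spaces.linear scale scale d"
    and d_degree: "x \<in> G n m \<Longrightarrow> d x \<in> G (n + 1) (m - 1)"
    and d_squared: "d (d x) = 0"
    and d_leibniz: "x \<in> G n m \<Longrightarrow> d (x * y) = d x * y + scale ((-1) powi n) (x * d y)"
    and L_subspace: "subspace L"
    and L_dim: "dim L = 1"
    and L_degree: "L \<subseteq> G 0 1"
    and L_central: "t \<in> L \<Longrightarrow> t * x = x * t"
    and d_L: "t \<in> L \<Longrightarrow> d t = 0"
    and L_invertible: "\<lbrakk>t \<in> L; t \<noteq> 0\<rbrakk> \<Longrightarrow> \<exists>u. t * u = 1 \<and> u * t = 1"
begin

text \<open>
  The derivation property of \<open>D\<close> needs this: \<open>D\<close> vanishes in tensor length 1, while
  \<open>D (m x y)\<close> is the class of \<open>(-1)\<^bsup>|x| |y|\<^esup> dy x - (-1)\<^bsup>|x|\<^esup> x dy\<close> for homogeneous \<open>x\<close>, \<open>y\<close> in \<open>R\<^sub>1\<close>.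
\<close>

definition graded_commutative :: bool
  where "graded_commutative \<longleftrightarrow>
    (\<forall>n m n' m'. \<forall>x\<in>G n m. \<forall>y\<in>G n' m'. x * y = scale ((-1) powi (n * n')) (y * x))"

definition R1 :: "'r set"
  where "R1 = span (\<Union>n. G n 1)"

definition comp1 :: "'r \<Rightarrow> int \<Rightarrow> 'r"
  where "comp1 x n = (THE c. (\<forall>n m. c (n, m) \<in> G n m) \<and> finite {p. c p \<noteq> 0} \<and>
        x = (\<Sum>p | c p \<noteq> 0. c p)) (n, 1)"

text \<open>The degree of a nonzero homogeneous element of \<^term>\<open>R1\<close>.\<close>

definition deg :: "'r \<Rightarrow> int"
  where "deg x = (THE n. x \<in> G n 1)"

definition degs :: "'r list \<Rightarrow> int"
  where "degs xs = sum_list (map deg xs)"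

definition tinv :: "'r \<Rightarrow> 'r"
  where "tinv t = (THE u. t * u = 1 \<and> u * t = 1)"

text \<open>
  The list \<open>[x\<^sub>1, \<dots>, x\<^sub>n]\<close> stands for \<open>x\<^sub>1 \<otimes> \<dots> \<otimes> x\<^sub>n\<close>. The space \<open>Aphi_rel\<close> is spanned by the
  multilinearity relations and the relations saying that \<open>x\<^sub>1\<close> matters only modulo \<open>k(1)\<close>; so the
  quotient is the direct sum over \<open>n\<close> of \<open>(R\<^sub>1 / k(1)) \<otimes> R\<^sub>1 \<otimes> \<dots> \<otimes> R\<^sub>1\<close>, with \<open>k\<close> for \<open>n = 0\<close>.
\<close>

definition Aphi_rel :: "('r list \<Rightarrow>\<^sub>0 'k) set"
  where "Aphi_rel = fspan (
    {gen (xs @ (x + y) # zs) - gen (xs @ x # zs) - gen (xs @ y # zs) | xs x y zs.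
       set xs \<subseteq> R1 \<and> x \<in> R1 \<and> y \<in> R1 \<and> set zs \<subseteq> R1} \<union>
    {gen (xs @ scale c x # zs) - fscale c (gen (xs @ x # zs)) | c xs x zs.
       set xs \<subseteq> R1 \<and> x \<in> R1 \<and> set zs \<subseteq> R1} \<union>
    {gen (x # zs) - gen (y # zs) | x y zs.
       x \<in> R1 \<and> y \<in> R1 \<and> x - y \<in> L \<and> set zs \<subseteq> R1})"

definition pr :: "('r list \<Rightarrow>\<^sub>0 'k) \<Rightarrow> ('r list \<Rightarrow>\<^sub>0 'k) set"
  where "pr = qclass Aphi_rel"

definition prepend :: "'r \<Rightarrow> ('r list \<Rightarrow>\<^sub>0 'k) \<Rightarrow> ('r list \<Rightarrow>\<^sub>0 'k)"
  where "prepend x = lin_ext (\<lambda>xs. gen (x # xs))"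

text \<open>Multilinear expansion of \<open>x\<^sub>1 \<otimes> \<dots> \<otimes> x\<^sub>n\<close> into tensors of nonzero homogeneous elements.\<close>

fun hexp :: "'r list \<Rightarrow> ('r list \<Rightarrow>\<^sub>0 'k)"
  where
    "hexp [] = gen []"
  | "hexp (x # xs) = (\<Sum>n | comp1 x n \<noteq> 0. prepend (comp1 x n) (hexp xs))"

text \<open>\<open>diff_hom\<close> and \<open>shuffle_hom\<close> are meant for lists of nonzero homogeneous elements of \<^term>\<open>R1\<close>.\<close>

fun diff_hom :: "'r list \<Rightarrow> ('r list \<Rightarrow>\<^sub>0 'k)"
  where
    "diff_hom [] = 0"
  | "diff_hom [x] = 0"
  | "diff_hom (x # y # zs) =
       gen ((d x * y) # zs) + fscale ((-1) powi (deg x)) (prepend x (diff_hom (y # zs)))"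

definition diff' :: "('r list \<Rightarrow>\<^sub>0 'k) \<Rightarrow> ('r list \<Rightarrow>\<^sub>0 'k)"
  where "diff' f = lin_ext diff_hom (lin_ext hexp f)"

function shuffle_hom :: "'r \<Rightarrow> 'r list \<Rightarrow> 'r list \<Rightarrow> ('r list \<Rightarrow>\<^sub>0 'k)"
  where
    "shuffle_hom t [] ys = gen ys"
  | "shuffle_hom t (x # xs) [] = gen (x # xs)"
  | "shuffle_hom t (x # xs) (y # ys) =
       prepend x (shuffle_hom t xs (y # ys))
       + fscale ((-1) powi (degs (x # xs) * deg y)) (prepend y (shuffle_hom t (x # xs) ys))
       - fscale ((-1) powi (degs xs * deg y))
           (prepend (x * y * tinv t) (prepend t (shuffle_hom t xs ys)))"
  by pat_completeness auto
termination by (relation "measure (\<lambda>(t, xs, ys). length xs + length ys)") auto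

definition shuffle' ::
  "'r \<Rightarrow> ('r list \<Rightarrow>\<^sub>0 'k) \<Rightarrow> ('r list \<Rightarrow>\<^sub>0 'k) \<Rightarrow> ('r list \<Rightarrow>\<^sub>0 'k)"
  where "shuffle' t f g =
    lin_ext (\<lambda>xs. lin_ext (\<lambda>ys. shuffle_hom t xs ys) (lin_ext hexp g)) (lin_ext hexp f)"

text \<open>\<open>Aphi t\<close> is the algebra with product \<open>m (pr X) (pr Y) = pr (m' X Y)\<close> for the chosen \<open>t\<close>.\<close>

definition Aphi :: "'r \<Rightarrow> ('k, ('r list \<Rightarrow>\<^sub>0 'k) set) module"
  where "Aphi t = (quotient_module (free_on (lists R1)) Aphi_rel)
    \<lparr>monoid.mult := (\<lambda>P Q. \<Union>f\<in>P. \<Union>g\<in>Q. pr (shuffle' t f g)), one := pr (gen [])\<rparr>"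

definition Aphi_gr :: "int \<Rightarrow> ('r list \<Rightarrow>\<^sub>0 'k) set set"
  where "Aphi_gr n = pr ` free_on {xs. \<exists>ns. list_all2 (\<lambda>x i. x \<in> G i 1) xs ns \<and> sum_list ns = n}"

definition Aphi_diff :: "('r list \<Rightarrow>\<^sub>0 'k) set \<Rightarrow> ('r list \<Rightarrow>\<^sub>0 'k) set"
  where "Aphi_diff P = (\<Union>f\<in>P. pr (diff' f))"

definition Aphi_comult ::
  "'r \<Rightarrow> ('r list \<Rightarrow>\<^sub>0 'k) set \<Rightarrow> (('r list \<Rightarrow>\<^sub>0 'k) set \<times> ('r list \<Rightarrow>\<^sub>0 'k) set \<Rightarrow>\<^sub>0 'k) set"
  where "Aphi_comult t P = (\<Union>f\<in>P. qclass (tensor_rel (Aphi t) (Aphi t))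
    (lin_ext (\<lambda>xs. \<Sum>j\<le>length xs. gen (pr (gen (take j xs)), pr (gen (drop j xs)))) f))"

text \<open>The counit is the projection to \<open>k\<close>, the part of tensor length 0.\<close>

definition Aphi_counit :: "('r list \<Rightarrow>\<^sub>0 'k) set \<Rightarrow> 'k"
  where "Aphi_counit P = the_elem ((\<lambda>f. Poly_Mapping.lookup f []) ` P)"

end

end

theory Submission
  imports Defs
begin

text \<open>
  The tensor algebra \<open>T = T(R\<^sub>1)\<close> carries all the structure, and every axiom except one already holds
  in \<open>T\<close>. Choose a basis \<open>B\<close> of \<open>R\<^sub>1\<close> that consists of homogeneous elements and contains \<open>t\<close>. Then \<open>T\<close> is the
  free vector space on the words in \<open>B\<close>, the quotient \<open>A\<close> is \<open>T\<close> modulo the words that begin with \<open>t\<close>,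
  and elements of \<open>A \<otimes> A\<close> are represented by combinations of pairs of words. All identities thus become
  equations between finitely supported functions, which are proved by induction on the length of
  words. Letters that do not lie in \<open>B\<close>, such as \<open>x y t\<^sup>-\<^sup>1\<close> or \<open>dx y\<close>, are expanded in \<open>B\<close> by the bilinear
  operation \<open>cons\<close>.

  Product. The recursion of the product makes sense for arbitrary homogeneous letters (\<open>msh_cons\<close>). It
  gives \<open>m'(t P, Q) = t m'(P, Q) = m'(P, t Q)\<close> (\<open>msh_cons_t_left\<close>, \<open>msh_cons_t_right\<close>), because the second
  and the third term cancel. So the words that begin with \<open>t\<close> span an ideal and the product descends to \<open>A\<close>.
  It also means that \<open>T\<close> is a \<open>k[t]\<close>-algebra in which \<open>m'\<close> is a quasi-shuffle product of weight \<open>- t\<close> over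
  \<open>R\<^sub>0 = R\<^sub>1 t\<^sup>-\<^sup>1\<close>; associativity follows as for quasi-shuffles, by expanding both sides of
  \<open>(x P * y Q) * z U = x P * (y Q * z U)\<close> (\<open>msh_assoc_word\<close>).

  Differential. It satisfies \<open>D (x P) = dx . P + (-1)\<^bsup>|x|\<^esup> x D P\<close>, where \<open>a . P\<close> multiplies the first letter of
  \<open>P\<close> by \<open>a \<in> R\<^sub>0\<close>. Since \<open>dx\<close> is a cycle, \<open>D\<close> commutes with \<open>dx .\<close> up to the sign of \<open>|dx|\<close>, whence \<open>D D = 0\<close>
  (\<open>mdf_mdf\<close>). For the Leibniz rule one computes how \<open>dx .\<close> and \<open>dy .\<close> act on a product. Compared with their
  action on the two factors, this leaves the terms \<open>dx y m'(P, Q)\<close> and \<open>\<plusminus> x dy m'(P, Q)\<close>. As \<open>t\<close> is a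
  central cycle, they are the two parts of \<open>d (x y t\<^sup>-\<^sup>1) t m'(P, Q)\<close>, so they cancel against the
  differential of the third term of the recursion (\<open>mdf_msh_word\<close>). Graded commutativity enters only through \<open>x dy = \<plusminus> dy x\<close>.

  Coproduct. Deconcatenation is coassociative and \<open>D\<close> is a coderivation on \<open>T\<close>. The coproduct is
  multiplicative only modulo \<open>t\<close>: cutting the word \<open>(x y t\<^sup>-\<^sup>1) t P\<close> behind its first letter leaves a
  second factor that begins with \<open>t\<close>, and this is zero in \<open>A\<close> (\<open>dec_msh_word\<close>).

  Antipode. Tensor length is respected by product and coproduct, so the left antipode \<open>S\<close> exists by
  recursion on the length. It is a right antipode since \<open>S * id * S = S\<close>, and it commutes with \<open>D\<close>
  since the commutator \<open>E\<close> satisfies \<open>E * id = 0\<close>.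
\<close>

section \<open>Free vector spaces\<close>

lemma lookup_fscale [simp]: "Poly_Mapping.lookup (fscale c f) x = c * Poly_Mapping.lookup f x"
  by (simp add: fscale_def Poly_Mapping.map.rep_eq when_def)

interpretation fs: vector_space "fscale :: 'k::field \<Rightarrow> ('x \<Rightarrow>\<^sub>0 'k) \<Rightarrow> 'x \<Rightarrow>\<^sub>0 'k"
  by unfold_locales (auto intro!: poly_mapping_eqI simp: lookup_add algebra_simps)

abbreviation flinear :: "(('x \<Rightarrow>\<^sub>0 'k::field) \<Rightarrow> ('y \<Rightarrow>\<^sub>0 'k)) \<Rightarrow> bool"
  where "flinear \<equiv> Vector_Spaces.linear fscale fscale"

lemma flinearI:
  assumes "\<And>x y. f (x + y) = f x + f y" "\<And>c x. f (fscale c x) = fscale c (f x)"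
  shows "flinear f"
  unfolding Vector_Spaces.linear_iff using assms by (blast intro: fs.vector_space_axioms)

lemma flinear_add: "flinear f \<Longrightarrow> f (x + y) = f x + f y"
  and flinear_scale: "flinear f \<Longrightarrow> f (fscale c x) = fscale c (f x)"
  by (auto simp: Vector_Spaces.linear_iff)

lemma flinear_0: "flinear f \<Longrightarrow> f 0 = 0"
  using flinear_scale[of f 0 0] by simp

lemma flinear_uminus: "flinear f \<Longrightarrow> f (- x) = - f x"
  using flinear_scale[of f "-1" x] by simp

lemma flinear_diff: "flinear f \<Longrightarrow> f (x - y) = f x - f y"
  using flinear_add[of f x "- y"] by (simp add: flinear_uminus)

lemma flinear_sum: "flinear f \<Longrightarrow> f (\<Sum>i\<in>I. g i) = (\<Sum>i\<in>I. f (g i))"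
  by (induction I rule: infinite_finite_induct) (auto simp: flinear_0 flinear_add)

lemmas flinear_simps = flinear_0 flinear_add flinear_scale flinear_uminus flinear_diff flinear_sum

lemma lin_ext_superset:
  assumes "finite K" "Poly_Mapping.keys f \<subseteq> K"
  shows "lin_ext F f = (\<Sum>x\<in>K. fscale (Poly_Mapping.lookup f x) (F x))"
  unfolding lin_ext_def using assms
  by (intro sum.mono_neutral_left) (auto simp: in_keys_iff)

lemma lin_ext_add: "lin_ext F (f + g) = lin_ext F f + lin_ext F g"
proof -
  let ?K = "Poly_Mapping.keys f \<union> Poly_Mapping.keys g"
  have "lin_ext F h = (\<Sum>x\<in>?K. fscale (Poly_Mapping.lookup h x) (F x))"
    if "h \<in> insert f {g, f + g}" for h
    using that Poly_Mapping.keys_add[of f g] by (intro lin_ext_superset) auto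
  thus ?thesis by (simp add: lookup_add fs.scale_left_distrib sum.distrib)
qed

lemma lin_ext_fscale: "lin_ext F (fscale c f) = fscale c (lin_ext F f)"
  by (subst lin_ext_superset[where K = "Poly_Mapping.keys f"])
     (auto simp: lin_ext_def fs.scale_sum_right in_keys_iff)

lemma flinear_lin_ext_base: "flinear (lin_ext F)"
  by (intro flinearI lin_ext_add lin_ext_fscale)

lemma lin_ext_gen [simp]: "lin_ext F (gen x) = F x"
  by (simp add: lin_ext_def)

lemma lin_ext_simps [simp]:
  "lin_ext F 0 = 0" "lin_ext F (- f) = - lin_ext F f" "lin_ext F (f - g) = lin_ext F f - lin_ext F g"
  "lin_ext F (\<Sum>i\<in>I. h i) = (\<Sum>i\<in>I. lin_ext F (h i))"
  "lin_ext F (f + g) = lin_ext F f + lin_ext F g"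
  "lin_ext F (fscale c f) = fscale c (lin_ext F f)"
  by (simp_all only: flinear_simps[OF flinear_lin_ext_base])

lemma lin_ext_gen_id: "lin_ext gen f = f"
proof (rule poly_mapping_eqI)
  fix x
  have "Poly_Mapping.lookup (lin_ext gen f) x
      = (\<Sum>y\<in>Poly_Mapping.keys f. Poly_Mapping.lookup f y * (if y = x then 1 else 0))"
    by (simp add: lin_ext_def lookup_sum lookup_single when_def)
  also have "\<dots> = Poly_Mapping.lookup f x"
    by (simp add: if_distrib[of "(*) _"] in_keys_iff cong: if_cong)
  finally show "Poly_Mapping.lookup (lin_ext gen f) x = Poly_Mapping.lookup f x" .
qed

lemma free_on_iff_lookup: "f \<in> free_on S \<longleftrightarrow> (\<forall>x. Poly_Mapping.lookup f x \<noteq> 0 \<longrightarrow> x \<in> S)"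
  by (auto simp: free_on_def in_keys_iff)

lemma subspace_free_on: "fs.subspace (free_on S)"
  by (rule fs.subspaceI) (auto simp: free_on_iff_lookup lookup_add, metis add_0)

lemmas free_on_closed [simp, intro] =
  fs.subspace_0[OF subspace_free_on] fs.subspace_add[OF subspace_free_on]
  fs.subspace_scale[OF subspace_free_on] fs.subspace_neg[OF subspace_free_on]
  fs.subspace_diff[OF subspace_free_on] fs.subspace_sum[OF subspace_free_on]

lemma gen_free_on [simp]: "gen x \<in> free_on S \<longleftrightarrow> x \<in> S"
  by (auto simp: free_on_def)

lemma free_on_UNIV [simp]: "f \<in> free_on UNIV"
  by (simp add: free_on_def)

lemma free_on_mono: "S \<subseteq> S' \<Longrightarrow> f \<in> free_on S \<Longrightarrow> f \<in> free_on S'"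
  by (auto simp: free_on_def)

lemma free_on_induct [consumes 1, case_names zero add scale gen]:
  assumes "f \<in> free_on S" and "P 0"
    and "\<And>f g. \<lbrakk>f \<in> free_on S; g \<in> free_on S; P f; P g\<rbrakk> \<Longrightarrow> P (f + g)"
    and "\<And>c f. \<lbrakk>f \<in> free_on S; P f\<rbrakk> \<Longrightarrow> P (fscale c f)"
    and "\<And>x. x \<in> S \<Longrightarrow> P (gen x)"
  shows "P f"
proof -
  have "(\<Sum>x\<in>K. fscale (Poly_Mapping.lookup f x) (gen x)) \<in> free_on S
      \<and> P (\<Sum>x\<in>K. fscale (Poly_Mapping.lookup f x) (gen x))"
    if "finite K" "K \<subseteq> S" for K
    using that
  proof (induction K)
    case (insert x K)
    have "fscale (Poly_Mapping.lookup f x) (gen x) \<in> free_on S"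
      and "P (fscale (Poly_Mapping.lookup f x) (gen x))"
      using insert.prems by (auto intro: assms)
    thus ?case using insert by (auto intro: assms)
  qed (simp add: assms(2))
  from this[of "Poly_Mapping.keys f"] have "P (lin_ext gen f)"
    using assms(1) unfolding lin_ext_def by (auto simp: free_on_def)
  thus ?thesis by (simp add: lin_ext_gen_id)
qed

lemma flinear_eqI:
  assumes "flinear f" "flinear g" "\<And>x. x \<in> S \<Longrightarrow> f (gen x) = g (gen x)" "P \<in> free_on S"
  shows "f P = g P"
  using assms(4) by (induction rule: free_on_induct)
    (simp_all add: flinear_simps[OF assms(1)] flinear_simps[OF assms(2)] assms(3))

lemma flinear_closed:
  assumes "flinear f" "\<And>x. x \<in> S \<Longrightarrow> f (gen x) \<in> free_on S'" "P \<in> free_on S"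
  shows "f P \<in> free_on S'"
  using assms(3) by (induction rule: free_on_induct)
    (auto simp: flinear_simps[OF assms(1)] assms(2))

lemma lin_ext_closed: "\<lbrakk>\<And>x. x \<in> S \<Longrightarrow> F x \<in> free_on S'; P \<in> free_on S\<rbrakk> \<Longrightarrow> lin_ext F P \<in> free_on S'"
  by (rule flinear_closed[OF flinear_lin_ext_base]) auto

lemma lin_ext_cong: "\<lbrakk>P \<in> free_on S; \<And>x. x \<in> S \<Longrightarrow> F x = G x\<rbrakk> \<Longrightarrow> lin_ext F P = lin_ext G P"
  by (rule flinear_eqI[where S = S]) (auto intro: flinear_lin_ext_base)

lemma flinear_id: "flinear (\<lambda>x. x)"
  and flinear_zero: "flinear (\<lambda>_. 0)"
  by (auto intro!: flinearI)

lemma flinear_comp: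
  assumes "flinear f" "flinear g"
  shows "flinear (\<lambda>x. f (g x))"
  by (rule flinearI) (simp_all only: flinear_simps[OF assms(1)] flinear_simps[OF assms(2)])

lemma
  assumes "flinear f" "flinear g"
  shows flinear_plus: "flinear (\<lambda>x. f x + g x)"
    and flinear_minus: "flinear (\<lambda>x. f x - g x)"
  by (rule flinearI; simp add: flinear_simps[OF assms(1)] flinear_simps[OF assms(2)]
      fs.scale_right_distrib fs.scale_right_diff_distrib)+

lemma
  assumes "flinear f"
  shows flinear_neg: "flinear (\<lambda>x. - f x)"
    and flinear_fscale: "flinear (\<lambda>x. fscale c (f x))"
  by (rule flinearI; simp add: flinear_simps[OF assms] fs.scale_right_distrib mult.commute)+

lemma flinear_sumI:
  assumes "\<And>i. i \<in> I \<Longrightarrow> flinear (f i)"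
  shows "flinear (\<lambda>x. \<Sum>i\<in>I. f i x)"
proof (rule flinearI)
  show "(\<Sum>i\<in>I. f i (x + y)) = (\<Sum>i\<in>I. f i x) + (\<Sum>i\<in>I. f i y)" for x y
    by (simp add: flinear_add[OF assms] sum.distrib cong: sum.cong)
  show "(\<Sum>i\<in>I. f i (fscale c x)) = fscale c (\<Sum>i\<in>I. f i x)" for c x
    by (simp add: flinear_scale[OF assms] fs.scale_sum_right cong: sum.cong)
qed

lemma flinear_lin_ext: "flinear g \<Longrightarrow> flinear (\<lambda>x. lin_ext F (g x))"
  by (rule flinear_comp[OF flinear_lin_ext_base])

lemma flinear_lin_ext_param: "(\<And>x. flinear (\<lambda>a. F a x)) \<Longrightarrow> flinear (\<lambda>a. lin_ext (F a) f)"
  unfolding lin_ext_def by (intro flinear_sumI flinear_fscale)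

lemmas flinear_intros = flinear_id flinear_zero flinear_plus flinear_minus flinear_neg
  flinear_fscale flinear_sumI flinear_lin_ext flinear_lin_ext_param

lemma flinear_lin_ext_comp:
  assumes "flinear h"
  shows "h (lin_ext F f) = lin_ext (\<lambda>x. h (F x)) f"
  by (simp add: lin_ext_def flinear_simps[OF assms])

text \<open>
  Under the identification of \<open>k[S] \<otimes> k[S']\<close> with \<open>k[S \<times> S']\<close> this is the pure tensor \<open>P \<otimes> Q\<close>.
\<close>

definition ftensor :: "('x \<Rightarrow>\<^sub>0 'k::field) \<Rightarrow> ('y \<Rightarrow>\<^sub>0 'k) \<Rightarrow> ('x \<times> 'y \<Rightarrow>\<^sub>0 'k)"
  where "ftensor P Q = lin_ext (\<lambda>u. lin_ext (\<lambda>v. gen (u, v)) Q) P"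

lemma ftensor_gen [simp]: "ftensor (gen u) (gen v) = gen (u, v)"
  by (simp add: ftensor_def)

lemma flinear_ftensor_left: "flinear g \<Longrightarrow> flinear (\<lambda>x. ftensor (g x) Q)"
  unfolding ftensor_def by (intro flinear_intros)

lemma flinear_ftensor_right: "flinear g \<Longrightarrow> flinear (\<lambda>x. ftensor P (g x))"
  unfolding ftensor_def by (intro flinear_intros)

lemma ftensor_closed: "P \<in> free_on S \<Longrightarrow> Q \<in> free_on S' \<Longrightarrow> ftensor P Q \<in> free_on (S \<times> S')"
  unfolding ftensor_def by (intro lin_ext_closed[where S = S] lin_ext_closed[where S = S']) auto

lemma fbilinear_eqI:
  assumes "\<And>Q. flinear (\<lambda>P. f P Q)" "\<And>P. flinear (f P)"
    and "\<And>Q. flinear (\<lambda>P. g P Q)" "\<And>P. flinear (g P)"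
    and "\<And>x y. x \<in> S \<Longrightarrow> y \<in> S' \<Longrightarrow> f (gen x) (gen y) = g (gen x) (gen y)"
    and "P \<in> free_on S" "Q \<in> free_on S'"
  shows "f P Q = g P Q"
proof (rule flinear_eqI[OF assms(1,3) _ assms(6)])
  fix x assume "x \<in> S"
  show "f (gen x) Q = g (gen x) Q"
    by (rule flinear_eqI[OF assms(2,4) _ assms(7)]) (use \<open>x \<in> S\<close> assms(5) in auto)
qed

subsection \<open>Maps on one factor of a tensor product\<close>

text \<open>
  With \<open>k[S] \<otimes> k[S'] = k[S \<times> S']\<close>, this is \<open>h \<otimes> id\<close>, and \<open>map_right h\<close> below is \<open>id \<otimes> h\<close>.
\<close>

definition map_left :: "(('x \<Rightarrow>\<^sub>0 'k::field) \<Rightarrow> ('y \<Rightarrow>\<^sub>0 'k)) \<Rightarrow> ('x \<times> 'z \<Rightarrow>\<^sub>0 'k) \<Rightarrow> ('y \<times> 'z \<Rightarrow>\<^sub>0 'k)"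
  where "map_left h = lin_ext (\<lambda>p. ftensor (h (gen (fst p))) (gen (snd p)))"

definition map_right :: "(('x \<Rightarrow>\<^sub>0 'k::field) \<Rightarrow> ('y \<Rightarrow>\<^sub>0 'k)) \<Rightarrow> ('z \<times> 'x \<Rightarrow>\<^sub>0 'k) \<Rightarrow> ('z \<times> 'y \<Rightarrow>\<^sub>0 'k)"
  where "map_right h = lin_ext (\<lambda>p. ftensor (gen (fst p)) (h (gen (snd p))))"

lemma flinear_map_left: "flinear g \<Longrightarrow> flinear (\<lambda>Z. map_left h (g Z))"
  unfolding map_left_def by (intro flinear_intros)

lemma flinear_map_right: "flinear g \<Longrightarrow> flinear (\<lambda>Z. map_right h (g Z))"
  unfolding map_right_def by (intro flinear_intros)

lemmas map_left2_vec [simp] =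
  flinear_simps[OF flinear_map_left[OF flinear_id]] flinear_simps[OF flinear_map_right[OF flinear_id]]

lemmas ftensor_vec [simp] = flinear_simps[OF flinear_ftensor_left[OF flinear_id]]
  flinear_simps[OF flinear_ftensor_right[OF flinear_id]]

lemma map_left_gen: "map_left h (gen (u, v)) = ftensor (h (gen u)) (gen v)"
  by (simp add: map_left_def)

lemma map_right_gen: "map_right h (gen (u, v)) = ftensor (gen u) (h (gen v))"
  by (simp add: map_right_def)

lemma map_left_ftensor:
  assumes "flinear h"
  shows "map_left h (ftensor P Q) = ftensor (h P) Q" (is "?f P Q = ?g P Q")
  by (rule fbilinear_eqI[where f = ?f and g = ?g
        and S = UNIV and S' = UNIV])
     (intro flinear_map_left flinear_ftensor_left flinear_ftensor_right flinear_id assms | simp add: map_left_gen)+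

lemma map_right_ftensor:
  assumes "flinear h"
  shows "map_right h (ftensor P Q) = ftensor P (h Q)"
  by (rule fbilinear_eqI[where f = "\<lambda>P Q. map_right h (ftensor P Q)" and g = "\<lambda>P Q. ftensor P (h Q)"
        and S = UNIV and S' = UNIV])
     (intro flinear_map_right flinear_ftensor_left flinear_ftensor_right flinear_id assms | simp add: map_right_gen)+

lemma map_right_map_left:
  assumes "flinear h" "flinear k"
  shows "map_right k (map_left h Z) = map_left h (map_right k Z)" (is "?f Z = ?g Z")
proof (rule flinear_eqI[where f = ?f and g = ?g and S = UNIV])
  fix p show "map_right k (map_left h (gen p)) = map_left h (map_right k (gen p))"
    by (cases p) (simp add: map_left_gen map_right_gen map_left_ftensor[OF assms(1)] map_right_ftensor[OF assms(2)])
qed (intro flinear_map_left flinear_map_right flinear_id | simp)+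

lemma map_left_map_left:
  assumes "flinear h"
  shows "map_left h (map_left k Z) = map_left (\<lambda>P. h (k P)) Z"
proof (rule flinear_eqI[where f = "\<lambda>Z. map_left h (map_left k Z)" and g = "map_left (\<lambda>P. h (k P))" and S = UNIV])
  fix p show "map_left h (map_left k (gen p)) = map_left (\<lambda>P. h (k P)) (gen p)"
    by (cases p) (simp add: map_left_gen map_left_ftensor[OF assms(1)])
qed (intro flinear_map_left flinear_id | simp)+

lemma map_left_cong: "\<lbrakk>Z \<in> free_on (S \<times> S'); \<And>u. u \<in> S \<Longrightarrow> h (gen u) = k (gen u)\<rbrakk> \<Longrightarrow> map_left h Z = map_left k Z"
  unfolding map_left_def by (rule lin_ext_cong[where S = "S \<times> S'"]) auto

lemma map_left_add: "map_left (\<lambda>P. h P + k P) Z = map_left h Z + map_left k Z"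
  and map_left_fscale: "map_left (\<lambda>P. fscale c (h P)) Z = fscale c (map_left h Z)"
  by (simp_all add: map_left_def lin_ext_def fs.scale_right_distrib sum.distrib fs.scale_sum_right mult.commute)

section \<open>Modules over a field, and quotients of free spaces\<close>

abbreviation kmodule :: "('k::field, 'v) module \<Rightarrow> bool"
  where "kmodule V \<equiv> Module.module (ring_of_type_algebra :: 'k ring) V"

lemma ring_of_type_algebra_sel [simp]:
  "carrier ring_of_type_algebra = UNIV" "add ring_of_type_algebra = (+)"
  "monoid.mult ring_of_type_algebra = (*)" "one ring_of_type_algebra = 1"
  "ring.zero ring_of_type_algebra = 0"
  by (auto simp: ring_of_type_algebra_def)

text \<open>Negatives come for free over a field, as the multiples by \<open>-1\<close>.\<close>

lemma kmoduleI:
  fixes V :: "('k::field, 'v) module" (structure)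
  assumes "\<And>x y. x \<in> carrier V \<Longrightarrow> y \<in> carrier V \<Longrightarrow> x \<oplus> y \<in> carrier V"
    and "\<zero> \<in> carrier V"
    and "\<And>x y z. x \<in> carrier V \<Longrightarrow> y \<in> carrier V \<Longrightarrow> z \<in> carrier V \<Longrightarrow> (x \<oplus> y) \<oplus> z = x \<oplus> (y \<oplus> z)"
    and "\<And>x y. x \<in> carrier V \<Longrightarrow> y \<in> carrier V \<Longrightarrow> x \<oplus> y = y \<oplus> x"
    and "\<And>x. x \<in> carrier V \<Longrightarrow> \<zero> \<oplus> x = x"
    and "\<And>c x. x \<in> carrier V \<Longrightarrow> c \<odot> x \<in> carrier V"
    and "\<And>c x y. x \<in> carrier V \<Longrightarrow> y \<in> carrier V \<Longrightarrow> c \<odot> (x \<oplus> y) = c \<odot> x \<oplus> c \<odot> y"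
    and "\<And>c c' x. x \<in> carrier V \<Longrightarrow> (c + c') \<odot> x = c \<odot> x \<oplus> c' \<odot> x"
    and "\<And>c c' x. x \<in> carrier V \<Longrightarrow> (c * c') \<odot> x = c \<odot> (c' \<odot> x)"
    and "\<And>x. x \<in> carrier V \<Longrightarrow> 1 \<odot> x = x"
    and "\<And>x. x \<in> carrier V \<Longrightarrow> (-1) \<odot> x \<oplus> x = \<zero>"
  shows "kmodule V"
proof (rule moduleI)
  show "cring (ring_of_type_algebra :: 'k ring)"
    by (rule cring_from_type_algebra)
  show "abelian_group V"
  proof (rule abelian_groupI)
    show "\<exists>y\<in>carrier V. y \<oplus> x = \<zero>" if "x \<in> carrier V" for x
      using assms(6,11) that by blast
  qed (fact assms)+
qed (simp_all add: assms)

lemma k_linearI: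
  assumes "\<And>x. x \<in> carrier V \<Longrightarrow> f x \<in> carrier W"
    and "\<And>x y. \<lbrakk>x \<in> carrier V; y \<in> carrier V\<rbrakk> \<Longrightarrow> f (x \<oplus>\<^bsub>V\<^esub> y) = f x \<oplus>\<^bsub>W\<^esub> f y"
    and "\<And>c x. x \<in> carrier V \<Longrightarrow> f (c \<odot>\<^bsub>V\<^esub> x) = c \<odot>\<^bsub>W\<^esub> f x"
  shows "k_linear V W f"
  using assms by (auto simp: k_linear_def)

lemma k_linearD:
  assumes "k_linear V W f"
  shows "x \<in> carrier V \<Longrightarrow> f x \<in> carrier W"
    and "\<lbrakk>x \<in> carrier V; y \<in> carrier V\<rbrakk> \<Longrightarrow> f (x \<oplus>\<^bsub>V\<^esub> y) = f x \<oplus>\<^bsub>W\<^esub> f y"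
    and "x \<in> carrier V \<Longrightarrow> f (c \<odot>\<^bsub>V\<^esub> x) = c \<odot>\<^bsub>W\<^esub> f x"
  using assms by (auto simp: k_linear_def)

lemma k_linear_cong:
  fixes V :: "('k::field, 'v) module"
  assumes "k_linear V W f" "kmodule V" "\<And>x. x \<in> carrier V \<Longrightarrow> f x = g x"
  shows "k_linear V W g"
proof -
  interpret V: Module.module "ring_of_type_algebra :: 'k ring" V by fact
  show ?thesis using assms(1,3) by (auto simp: k_linear_def Pi_iff V.smult_closed)
qed

lemma k_linear_id: "k_linear V V (\<lambda>x. x)"
  by (auto simp: k_linear_def)

lemma k_linear_comp: "\<lbrakk>k_linear U V f; k_linear V W g\<rbrakk> \<Longrightarrow> k_linear U W (\<lambda>x. g (f x))"
  by (auto simp: k_linear_def Pi_iff)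

lemma k_linear_zero:
  fixes V :: "('k::field, 'v) module"
  assumes "k_linear V W f" "kmodule V" "kmodule W"
  shows "f \<zero>\<^bsub>V\<^esub> = \<zero>\<^bsub>W\<^esub>"
proof -
  interpret V: Module.module "ring_of_type_algebra :: 'k ring" V by fact
  interpret W: Module.module "ring_of_type_algebra :: 'k ring" W by fact
  have "f (0 \<odot>\<^bsub>V\<^esub> \<zero>\<^bsub>V\<^esub>) = 0 \<odot>\<^bsub>W\<^esub> f \<zero>\<^bsub>V\<^esub>"
    by (rule k_linearD(3)[OF assms(1)]) simp
  thus ?thesis
    using V.smult_l_null[of "\<zero>\<^bsub>V\<^esub>"] W.smult_l_null[OF k_linearD(1)[OF assms(1), of "\<zero>\<^bsub>V\<^esub>"]] by simp
qed

lemma k_linear_add: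
  fixes W :: "('k::field, 'v) module"
  assumes "kmodule W" "k_linear V W f" "k_linear V W g"
  shows "k_linear V W (\<lambda>x. f x \<oplus>\<^bsub>W\<^esub> g x)"
proof -
  interpret W: Module.module "ring_of_type_algebra :: 'k ring" W by fact
  show ?thesis
    by (rule k_linearI)
       (simp_all add: k_linearD[OF assms(2)] k_linearD[OF assms(3)] W.smult_r_distr W.add.m_ac)
qed

lemma k_linear_smult:
  fixes W :: "('k::field, 'v) module"
  assumes "kmodule W" "k_linear V W f"
  shows "k_linear V W (\<lambda>x. c \<odot>\<^bsub>W\<^esub> f x)"
proof -
  interpret W: Module.module "ring_of_type_algebra :: 'k ring" W by fact
  show ?thesis
    by (rule k_linearI)
       (simp_all add: k_linearD[OF assms(2)] W.smult_r_distr W.smult_assoc1[symmetric, simplified]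
         mult.commute)
qed

lemma k_linear_finsum:
  fixes W :: "('k::field, 'v) module"
  assumes "kmodule W" "finite I" "\<And>i. i \<in> I \<Longrightarrow> k_linear V W (f i)"
  shows "k_linear V W (\<lambda>x. \<Oplus>\<^bsub>W\<^esub>i\<in>I. f i x)"
proof -
  interpret W: Module.module "ring_of_type_algebra :: 'k ring" W by fact
  have closed: "(\<lambda>i. f i x) \<in> I \<rightarrow> carrier W" if "x \<in> carrier V" for x
    using k_linearD(1)[OF assms(3) that] by auto
  show ?thesis
  proof (rule k_linearI)
    fix x y assume xy: "x \<in> carrier V" "y \<in> carrier V"
    have "(\<Oplus>\<^bsub>W\<^esub>i\<in>I. f i (x \<oplus>\<^bsub>V\<^esub> y)) = (\<Oplus>\<^bsub>W\<^esub>i\<in>I. f i x \<oplus>\<^bsub>W\<^esub> f i y)"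
      using k_linearD(1)[OF assms(3)] xy
      by (intro W.finsum_cong') (auto simp: k_linearD(2)[OF assms(3)])
    also have "\<dots> = (\<Oplus>\<^bsub>W\<^esub>i\<in>I. f i x) \<oplus>\<^bsub>W\<^esub> (\<Oplus>\<^bsub>W\<^esub>i\<in>I. f i y)"
      by (intro W.finsum_addf closed xy)
    finally show "(\<Oplus>\<^bsub>W\<^esub>i\<in>I. f i (x \<oplus>\<^bsub>V\<^esub> y)) = (\<Oplus>\<^bsub>W\<^esub>i\<in>I. f i x) \<oplus>\<^bsub>W\<^esub> (\<Oplus>\<^bsub>W\<^esub>i\<in>I. f i y)" .
  next
    fix c x assume x: "x \<in> carrier V"
    have "(\<Oplus>\<^bsub>W\<^esub>i\<in>I. f i (c \<odot>\<^bsub>V\<^esub> x)) = (\<Oplus>\<^bsub>W\<^esub>i\<in>I. c \<odot>\<^bsub>W\<^esub> f i x)"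
      using k_linearD(1)[OF assms(3)] x
      by (intro W.finsum_cong') (auto simp: k_linearD(3)[OF assms(3)])
    also have "\<dots> = c \<odot>\<^bsub>W\<^esub> (\<Oplus>\<^bsub>W\<^esub>i\<in>I. f i x)"
      by (rule W.finsum_smult_ldistr[symmetric]) (use assms(2) closed[OF x] in auto)
    finally show "(\<Oplus>\<^bsub>W\<^esub>i\<in>I. f i (c \<odot>\<^bsub>V\<^esub> x)) = c \<odot>\<^bsub>W\<^esub> (\<Oplus>\<^bsub>W\<^esub>i\<in>I. f i x)" .
  next
    fix x assume "x \<in> carrier V"
    thus "(\<Oplus>\<^bsub>W\<^esub>i\<in>I. f i x) \<in> carrier W" by (intro W.finsum_closed closed)
  qed
qed

text \<open>
  A free space as a module record, so that maps on representatives and maps on cosets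
  can be composed by the same rules.
\<close>

definition free_module :: "'x set \<Rightarrow> ('k::field, 'x \<Rightarrow>\<^sub>0 'k) module"
  where "free_module S = \<lparr>carrier = free_on S, monoid.mult = undefined, one = undefined,
    ring.zero = 0, add = (+), module.smult = fscale\<rparr>"

lemma free_module_sel [simp]:
  "carrier (free_module S) = free_on S" "add (free_module S) = (+)"
  "ring.zero (free_module S) = 0" "module.smult (free_module S) = fscale"
  by (simp_all add: free_module_def)

lemma kmodule_free: "kmodule (free_module S)"
  by (rule kmoduleI) (auto simp: algebra_simps fs.scale_right_distrib fs.scale_left_distrib)

lemma k_linear_flinear:
  "flinear f \<Longrightarrow> (\<And>x. x \<in> S \<Longrightarrow> f (gen x) \<in> free_on S') \<Longrightarrow> k_linear (free_module S) (free_module S') f"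
  by (rule k_linearI) (auto intro: flinear_closed flinear_add flinear_scale)

lemma k_linear_free_eqI:
  assumes "k_linear (free_module S) U f" "k_linear (free_module S) U g"
    and "kmodule U" "\<And>x. x \<in> S \<Longrightarrow> f (gen x) = g (gen x)" "P \<in> free_on S"
  shows "f P = g P"
  using assms(5)
  by (induction rule: free_on_induct)
    (simp_all add: assms(4) k_linearD(2,3)[OF assms(1), simplified] k_linearD(2,3)[OF assms(2), simplified]
      k_linear_zero[OF assms(1) kmodule_free assms(3), simplified]
      k_linear_zero[OF assms(2) kmodule_free assms(3), simplified])

text \<open>
  The extension of \<open>u\<close> to a linear map from the free space on its domain to \<open>U\<close>. The
  representative-wise formula in \<^const>\<open>tensor_lift\<close> is of this form.
\<close>

definition lcomb :: "('k::field, 'u) module \<Rightarrow> ('x \<Rightarrow> 'u) \<Rightarrow> ('x \<Rightarrow>\<^sub>0 'k) \<Rightarrow> 'u"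
  where "lcomb U u f = (\<Oplus>\<^bsub>U\<^esub>p\<in>Poly_Mapping.keys f. Poly_Mapping.lookup f p \<odot>\<^bsub>U\<^esub> u p)"

context
  fixes U :: "('k::field, 'u) module"
  assumes U: "kmodule U"
begin

interpretation U: Module.module "ring_of_type_algebra :: 'k ring" U by (fact U)

lemma lcomb_superset:
  assumes "\<And>x. x \<in> S \<Longrightarrow> u x \<in> carrier U" "finite K" "K \<subseteq> S" "Poly_Mapping.keys f \<subseteq> K"
  shows "lcomb U u f = (\<Oplus>\<^bsub>U\<^esub>p\<in>K. Poly_Mapping.lookup f p \<odot>\<^bsub>U\<^esub> u p)"
  unfolding lcomb_def
proof (rule U.add.finprod_mono_neutral_cong_left)
  fix p assume "p \<in> K - Poly_Mapping.keys f"
  thus "Poly_Mapping.lookup f p \<odot>\<^bsub>U\<^esub> u p = \<zero>\<^bsub>U\<^esub>"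
    using assms U.smult_l_null by (auto simp: in_keys_iff)
qed (use assms in auto)

lemma lcomb_gen: "u x \<in> carrier U \<Longrightarrow> lcomb U u (gen x) = u x"
  using U.smult_one by (simp add: lcomb_def)

lemma k_linear_lcomb:
  assumes "\<And>x. x \<in> S \<Longrightarrow> u x \<in> carrier U"
  shows "k_linear (free_module S) U (lcomb U u)"
proof (rule k_linearI)
  fix f g :: "'a \<Rightarrow>\<^sub>0 'k" assume "f \<in> carrier (free_module S)" "g \<in> carrier (free_module S)"
  hence K: "Poly_Mapping.keys f \<union> Poly_Mapping.keys g \<subseteq> S" (is "?K \<subseteq> S")
    by (auto simp: free_on_def)
  have eq: "lcomb U u h = (\<Oplus>\<^bsub>U\<^esub>p\<in>?K. Poly_Mapping.lookup h p \<odot>\<^bsub>U\<^esub> u p)"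
    if "h \<in> insert f {g, f + g}" for h
    using that Poly_Mapping.keys_add[of f g] K by (intro lcomb_superset[OF assms]) auto
  have "lcomb U u (f + g)
      = (\<Oplus>\<^bsub>U\<^esub>p\<in>?K. Poly_Mapping.lookup f p \<odot>\<^bsub>U\<^esub> u p \<oplus>\<^bsub>U\<^esub> Poly_Mapping.lookup g p \<odot>\<^bsub>U\<^esub> u p)"
    unfolding eq[of "f + g", simplified]
    using assms K by (intro U.finsum_cong') (auto simp: lookup_add U.smult_l_distr[simplified])
  also have "\<dots> = lcomb U u f \<oplus>\<^bsub>U\<^esub> lcomb U u g"
    unfolding eq[of f, simplified] eq[of g, simplified]
    using assms K by (intro U.finsum_addf) auto
  finally show "lcomb U u (f \<oplus>\<^bsub>free_module S\<^esub> g) = lcomb U u f \<oplus>\<^bsub>U\<^esub> lcomb U u g" by simp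
next
  fix c and f :: "'a \<Rightarrow>\<^sub>0 'k" assume "f \<in> carrier (free_module S)"
  hence K: "Poly_Mapping.keys f \<subseteq> S" by (auto simp: free_on_def)
  have "lcomb U u (fscale c f)
      = (\<Oplus>\<^bsub>U\<^esub>p\<in>Poly_Mapping.keys f. Poly_Mapping.lookup (fscale c f) p \<odot>\<^bsub>U\<^esub> u p)"
    using K by (intro lcomb_superset[OF assms]) (auto simp: in_keys_iff)
  also have "\<dots> = (\<Oplus>\<^bsub>U\<^esub>p\<in>Poly_Mapping.keys f. c \<odot>\<^bsub>U\<^esub> (Poly_Mapping.lookup f p \<odot>\<^bsub>U\<^esub> u p))"
    using assms K by (intro U.finsum_cong') (auto simp: U.smult_assoc1[simplified])
  also have "\<dots> = c \<odot>\<^bsub>U\<^esub> lcomb U u f"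
    unfolding lcomb_def using assms K by (intro U.finsum_smult_ldistr[symmetric]) auto
  finally show "lcomb U u (c \<odot>\<^bsub>free_module S\<^esub> f) = c \<odot>\<^bsub>U\<^esub> lcomb U u f" by simp
next
  fix f :: "'a \<Rightarrow>\<^sub>0 'k" assume "f \<in> carrier (free_module S)"
  thus "lcomb U u f \<in> carrier U"
    unfolding lcomb_def using assms by (intro U.finsum_closed) (auto simp: free_on_def)
qed

end

lemma mem_qclass_iff: "h \<in> qclass N f \<longleftrightarrow> h - f \<in> N"
  by (auto simp: qclass_def image_iff algebra_simps intro: bexI[of _ "h - f"])

lemma qclass_eq_iff:
  assumes "fs.subspace N"
  shows "qclass N f = qclass N g \<longleftrightarrow> f - g \<in> N"
proof
  assume "qclass N f = qclass N g"
  moreover have "f \<in> qclass N f" using fs.subspace_0[OF assms] by (simp add: mem_qclass_iff)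
  ultimately show "f - g \<in> N" by (simp add: mem_qclass_iff)
next
  assume fg: "f - g \<in> N"
  have "h - f \<in> N \<longleftrightarrow> h - g \<in> N" for h
    using fs.subspace_add[OF assms _ fg, of "h - f"] fs.subspace_diff[OF assms _ fg, of "h - g"]
    by auto
  thus "qclass N f = qclass N g" by (auto simp: mem_qclass_iff)
qed

lemma qclass_self: "fs.subspace N \<Longrightarrow> f \<in> qclass N f"
  by (simp add: mem_qclass_iff fs.subspace_0)

lemma UN_qclass:
  assumes "fs.subspace N" "\<And>h. h - f \<in> N \<Longrightarrow> F h = F f"
  shows "(\<Union>h\<in>qclass N f. F h) = F f"
proof -
  have "(\<Union>h\<in>qclass N f. F h) = (\<Union>h\<in>qclass N f. F f)"
    by (rule SUP_cong[OF refl]) (rule assms(2), simp only: mem_qclass_iff)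
  thus ?thesis using qclass_self[OF assms(1), of f] by auto
qed

lemma subspace_fspan: "fs.subspace (fspan S)"
  by (simp add: fspan_def)

text \<open>
  \<open>Q\<close> may differ from the quotient module in its product and its unit, so that the locale applies
  both to tensor products and to the algebra \<open>A\<close>.
\<close>

locale quotient_space =
  fixes V N :: "('x \<Rightarrow>\<^sub>0 'k::field) set" and Q :: "('k, ('x \<Rightarrow>\<^sub>0 'k) set) module"
  assumes subspace_V: "fs.subspace V" and subspace_N: "fs.subspace N" and N_le: "N \<subseteq> V"
    and quotient: "\<exists>mu on. Q = (quotient_module V N)\<lparr>monoid.mult := mu, one := on\<rparr>"
begin

lemma sel: "carrier Q = qclass N ` V" "ring.zero Q = qclass N 0"
    "add Q = (\<lambda>P Q. \<Union>p\<in>P. \<Union>q\<in>Q. qclass N (p + q))"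
    "module.smult Q = (\<lambda>c P. \<Union>p\<in>P. qclass N (fscale c p))"
  using quotient by (auto simp: quotient_module_def)

lemma add_qclass: "qclass N f \<oplus>\<^bsub>Q\<^esub> qclass N g = qclass N (f + g)"
proof -
  have eq: "qclass N (p + q) = qclass N (f + g)" if "p - f \<in> N" "q - g \<in> N" for p q
    using fs.subspace_add[OF subspace_N that] by (simp add: qclass_eq_iff[OF subspace_N] algebra_simps)
  have "qclass N f \<oplus>\<^bsub>Q\<^esub> qclass N g = (\<Union>p\<in>qclass N f. qclass N (p + g))"
    unfolding sel
    by (intro SUP_cong refl UN_qclass subspace_N)
       (simp add: qclass_eq_iff[OF subspace_N])
  also have "\<dots> = qclass N (f + g)"
    by (rule UN_qclass[OF subspace_N]) (simp add: qclass_eq_iff[OF subspace_N])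
  finally show ?thesis .
qed

lemma smult_qclass: "c \<odot>\<^bsub>Q\<^esub> qclass N f = qclass N (fscale c f)"
  unfolding sel
  by (rule UN_qclass[OF subspace_N])
     (simp add: qclass_eq_iff[OF subspace_N] fs.subspace_scale[OF subspace_N]
       flip: fs.scale_right_diff_distrib)

lemma kmodule: "kmodule Q"
  by (rule kmoduleI)
     (auto simp: sel(1,2) add_qclass smult_qclass fs.subspace_0[OF subspace_V] algebra_simps
       fs.scale_right_distrib fs.scale_left_distrib
       intro!: imageI fs.subspace_add[OF subspace_V] fs.subspace_scale[OF subspace_V])

lemma qclass_closed: "f \<in> V \<Longrightarrow> qclass N f \<in> carrier Q"
  by (simp add: sel)

lemma k_linear_qclass:
  "V = free_on S \<Longrightarrow> k_linear (free_module S) Q (qclass N)"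
  by (rule k_linearI) (simp_all add: sel(1) add_qclass smult_qclass)

end

section \<open>Tensor products\<close>

definition k_bilinear ::
  "('k::field, 'v) module \<Rightarrow> ('k, 'w) module \<Rightarrow> ('k, 'u) module \<Rightarrow> ('v \<Rightarrow> 'w \<Rightarrow> 'u) \<Rightarrow> bool"
  where "k_bilinear V W U \<beta> \<longleftrightarrow>
    (\<forall>w\<in>carrier W. k_linear V U (\<lambda>v. \<beta> v w)) \<and> (\<forall>v\<in>carrier V. k_linear W U (\<beta> v))"

lemma k_bilinearI:
  "\<lbrakk>\<And>w. w \<in> carrier W \<Longrightarrow> k_linear V U (\<lambda>v. \<beta> v w); \<And>v. v \<in> carrier V \<Longrightarrow> k_linear W U (\<beta> v)\<rbrakk>
   \<Longrightarrow> k_bilinear V W U \<beta>"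
  by (simp add: k_bilinear_def)

lemma k_bilinearD:
  assumes "k_bilinear V W U \<beta>"
  shows "w \<in> carrier W \<Longrightarrow> k_linear V U (\<lambda>v. \<beta> v w)" "v \<in> carrier V \<Longrightarrow> k_linear W U (\<beta> v)"
    "v \<in> carrier V \<Longrightarrow> w \<in> carrier W \<Longrightarrow> \<beta> v w \<in> carrier U"
  using assms by (auto simp: k_bilinear_def dest: k_linearD(1))

text \<open>
  The linear map is controlled on a free space only, so the generators have to be located there.
\<close>

lemma k_linear_kernel_fspan:
  fixes U :: "('k::field, 'u) module"
  assumes "k_linear (free_module S) U h" "kmodule U"
    and "\<And>g. g \<in> A \<Longrightarrow> g \<in> free_on S \<and> h g = \<zero>\<^bsub>U\<^esub>" "f \<in> fspan A"
  shows "f \<in> free_on S \<and> h f = \<zero>\<^bsub>U\<^esub>"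
proof -
  interpret U: Module.module "ring_of_type_algebra :: 'k ring" U by fact
  note h = k_linearD[OF assms(1), simplified]
  have sub: "fs.subspace {g \<in> free_on S. h g = \<zero>\<^bsub>U\<^esub>}"
    by (rule fs.subspaceI)
       (auto simp: h U.smult_r_null[simplified] k_linear_zero[OF assms(1) kmodule_free assms(2), simplified])
  show ?thesis
    using fs.span_induct[OF assms(4)[unfolded fspan_def] sub] assms(3) by simp
qed

locale two_modules =
  V: Module.module "ring_of_type_algebra :: 'k ring" V +
  W: Module.module "ring_of_type_algebra :: 'k ring" W
  for V :: "('k::field, 'v) module" and W :: "('k, 'w) module"
begin

abbreviation "vw \<equiv> free_on (carrier V \<times> carrier W)"

lemma tensor_rel_le: "tensor_rel V W \<subseteq> vw"
  unfolding tensor_rel_def fspan_def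
  by (rule fs.span_minimal[OF _ subspace_free_on]) auto

sublocale tens: quotient_space vw "tensor_rel V W" "tensor V W"
proof
  show "\<exists>mu on. tensor V W = quotient_module vw (tensor_rel V W)\<lparr>monoid.mult := mu, one := on\<rparr>"
    by (intro exI[of _ undefined]) (simp add: tensor_def quotient_module_def)
  show "fs.subspace (tensor_rel V W)" by (simp add: tensor_rel_def subspace_fspan)
qed (simp_all add: subspace_free_on tensor_rel_le)

lemma pure_tensor_closed: "\<lbrakk>v \<in> carrier V; w \<in> carrier W\<rbrakk> \<Longrightarrow> pure_tensor V W v w \<in> carrier (tensor V W)"
  unfolding pure_tensor_def by (rule tens.qclass_closed) simp

lemma k_bilinear_pure_tensor: "k_bilinear V W (tensor V W) (pure_tensor V W)"
proof -
  have eq: "qclass (tensor_rel V W) f = qclass (tensor_rel V W) g" if "f - g \<in> tensor_rel V W" for f g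
    using that by (simp add: qclass_eq_iff[OF tens.subspace_N])
  have base: "f \<in> fspan A" if "f \<in> A" for A and f :: "'v \<times> 'w \<Rightarrow>\<^sub>0 'k"
    using that by (simp add: fspan_def fs.span_base)
  note rel = tensor_rel_def[where V = V and W = W]
  show ?thesis
  proof (rule k_bilinearI; rule k_linearI)
    fix v v' w assume "v \<in> carrier V" "v' \<in> carrier V" "w \<in> carrier W"
    hence "gen (v \<oplus>\<^bsub>V\<^esub> v', w) - gen (v, w) - gen (v', w) \<in> tensor_rel V W"
      unfolding rel by (intro base) auto
    thus "pure_tensor V W (v \<oplus>\<^bsub>V\<^esub> v') w = pure_tensor V W v w \<oplus>\<^bsub>tensor V W\<^esub> pure_tensor V W v' w"
      unfolding pure_tensor_def tens.add_qclass by (intro eq) (simp add: diff_diff_eq)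
  next
    fix v w w' assume "v \<in> carrier V" "w \<in> carrier W" "w' \<in> carrier W"
    hence "gen (v, w \<oplus>\<^bsub>W\<^esub> w') - gen (v, w) - gen (v, w') \<in> tensor_rel V W"
      unfolding rel by (intro base) auto
    thus "pure_tensor V W v (w \<oplus>\<^bsub>W\<^esub> w') = pure_tensor V W v w \<oplus>\<^bsub>tensor V W\<^esub> pure_tensor V W v w'"
      unfolding pure_tensor_def tens.add_qclass by (intro eq) (simp add: diff_diff_eq)
  next
    fix c v w assume "v \<in> carrier V" "w \<in> carrier W"
    hence "gen (c \<odot>\<^bsub>V\<^esub> v, w) - fscale c (gen (v, w)) \<in> tensor_rel V W"
      and "gen (v, c \<odot>\<^bsub>W\<^esub> w) - fscale c (gen (v, w)) \<in> tensor_rel V W"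
      unfolding rel by (intro base; auto)+
    thus "pure_tensor V W (c \<odot>\<^bsub>V\<^esub> v) w = c \<odot>\<^bsub>tensor V W\<^esub> pure_tensor V W v w"
      and "pure_tensor V W v (c \<odot>\<^bsub>W\<^esub> w) = c \<odot>\<^bsub>tensor V W\<^esub> pure_tensor V W v w"
      unfolding pure_tensor_def tens.smult_qclass by (simp_all add: eq)
  qed (simp_all add: pure_tensor_closed)
qed

context
  fixes U :: "('k, 'u) module" and \<beta> :: "'v \<Rightarrow> 'w \<Rightarrow> 'u"
  assumes U: "kmodule U" and \<beta>: "k_bilinear V W U \<beta>"
begin

interpretation U: Module.module "ring_of_type_algebra :: 'k ring" U by (fact U)

abbreviation (input) "\<beta>ext \<equiv> lcomb U (\<lambda>p. \<beta> (fst p) (snd p))"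

lemma k_linear_bilinear_ext: "k_linear (free_module (carrier V \<times> carrier W)) U \<beta>ext"
  by (rule k_linear_lcomb[OF U]) (auto intro: k_bilinearD(3)[OF \<beta>])

lemma bilinear_ext_tensor_rel: "f \<in> tensor_rel V W \<Longrightarrow> \<beta>ext f = \<zero>\<^bsub>U\<^esub>"
proof -
  note lin = k_linearD(2,3)[OF k_linear_bilinear_ext, simplified]
  have minus: "\<beta>ext (f - g) = \<beta>ext f \<ominus>\<^bsub>U\<^esub> \<beta>ext g" if "f \<in> vw" "g \<in> vw" for f g
  proof -
    have cl: "\<beta>ext h \<in> carrier U" if "h \<in> vw" for h
      using k_linearD(1)[OF k_linear_bilinear_ext] that by simp
    have "\<beta>ext f = \<beta>ext (f - g) \<oplus>\<^bsub>U\<^esub> \<beta>ext g"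
      using lin(1)[of "f - g" g] that by simp
    thus ?thesis using cl that U.minus_eq U.add.m_assoc U.r_neg by simp
  qed
  have gen: "\<beta>ext (gen (v, w)) = \<beta> v w" if "v \<in> carrier V" "w \<in> carrier W" for v w
    using that by (subst lcomb_gen[OF U]) (auto intro: k_bilinearD(3)[OF \<beta>])
  note cl = k_bilinearD(3)[OF \<beta>]
  have zero: "(x \<oplus>\<^bsub>U\<^esub> y) \<ominus>\<^bsub>U\<^esub> x \<ominus>\<^bsub>U\<^esub> y = \<zero>\<^bsub>U\<^esub>" if "x \<in> carrier U" "y \<in> carrier U" for x y
    using that by (simp add: U.minus_eq U.a_comm[of x y] U.a_assoc U.r_neg)
  have zero': "x \<ominus>\<^bsub>U\<^esub> x = \<zero>\<^bsub>U\<^esub>" if "x \<in> carrier U" for x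
    using that by (simp add: U.minus_eq U.r_neg)
  show "f \<in> tensor_rel V W \<Longrightarrow> \<beta>ext f = \<zero>\<^bsub>U\<^esub>"
    unfolding tensor_rel_def
    by (drule k_linear_kernel_fspan[OF k_linear_bilinear_ext U, rotated])
       (auto simp: minus gen lin cl zero zero' k_linearD[OF k_bilinearD(1)[OF \<beta>]] k_linearD[OF k_bilinearD(2)[OF \<beta>]])
qed

text \<open>
  The extension of a bilinear map kills the defining relations of the tensor product, so it takes a
  single value on each coset, and that value is the one selected by \<^const>\<open>tensor_lift\<close>.
\<close>

lemma tensor_lift_qclass:
  assumes "f \<in> vw"
  shows "tensor_lift U \<beta> (qclass (tensor_rel V W) f) = \<beta>ext f"
proof -
  have "\<beta>ext h = \<beta>ext f" if "h \<in> qclass (tensor_rel V W) f" for h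
  proof -
    have hf: "h - f \<in> tensor_rel V W" using that by (simp add: mem_qclass_iff)
    have "\<beta>ext h = \<beta>ext (f + (h - f))" by simp
    also have "\<dots> = \<beta>ext f \<oplus>\<^bsub>U\<^esub> \<beta>ext (h - f)"
      using k_linearD(2)[OF k_linear_bilinear_ext, simplified, of f "h - f"] assms hf tensor_rel_le by blast
    also have "\<dots> = \<beta>ext f"
      using bilinear_ext_tensor_rel[OF hf] k_linearD(1)[OF k_linear_bilinear_ext, of f] assms by simp
    finally show ?thesis .
  qed
  hence "\<beta>ext ` qclass (tensor_rel V W) f = {\<beta>ext f}"
    using qclass_self[OF tens.subspace_N] by blast
  thus ?thesis unfolding tensor_lift_def lcomb_def by (simp add: the_elem_def)
qed

lemma tensor_lift_pure:
  "\<lbrakk>v \<in> carrier V; w \<in> carrier W\<rbrakk> \<Longrightarrow> tensor_lift U \<beta> (pure_tensor V W v w) = \<beta> v w"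
  unfolding pure_tensor_def
  by (subst tensor_lift_qclass) (auto simp: lcomb_gen[OF U] k_bilinearD(3)[OF \<beta>])

lemma k_linear_tensor_lift: "k_linear (tensor V W) U (tensor_lift U \<beta>)"
  by (rule k_linearI)
     (auto simp: tens.sel(1) tens.add_qclass tens.smult_qclass tensor_lift_qclass
       k_linearD[OF k_linear_bilinear_ext, simplified])

end

text \<open>
  Needed for nested lifts, where the bilinear map depends linearly on an element of another module.
\<close>

lemma k_linear_tensor_lift_param:
  assumes "kmodule U" "\<And>x. x \<in> carrier Z \<Longrightarrow> k_bilinear V W U (\<beta> x)" "kmodule Z"
    and "\<And>v w. v \<in> carrier V \<Longrightarrow> w \<in> carrier W \<Longrightarrow> k_linear Z U (\<lambda>x. \<beta> x v w)"
    and "\<xi> \<in> carrier (tensor V W)"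
  shows "k_linear Z U (\<lambda>x. tensor_lift U (\<beta> x) \<xi>)"
proof -
  obtain f where f: "\<xi> = qclass (tensor_rel V W) f" "f \<in> vw"
    using assms(5) by (auto simp: tens.sel(1))
  have "k_linear Z U (\<lambda>x. lcomb U (\<lambda>p. \<beta> x (fst p) (snd p)) f)"
    unfolding lcomb_def using f(2)
    by (intro k_linear_finsum k_linear_smult assms) (auto simp: free_on_def)
  thus ?thesis
    by (rule k_linear_cong[OF _ assms(3)]) (simp add: f tensor_lift_qclass[OF assms(1,2)])
qed

lemma k_bilinear_comp_pure_tensor:
  "\<lbrakk>k_linear V' V f; k_linear W' W g\<rbrakk> \<Longrightarrow>
    k_bilinear V' W' (tensor V W) (\<lambda>a b. pure_tensor V W (f a) (g b))"
  by (rule k_bilinearI)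
     (erule k_linear_comp, rule k_bilinearD[OF k_bilinear_pure_tensor], erule (1) k_linearD(1))+

end

lemma two_modulesI: "\<lbrakk>kmodule V; kmodule W\<rbrakk> \<Longrightarrow> two_modules V W"
  by (simp add: two_modules_def)

lemma tensor_map_pure:
  fixes V :: "('k::field, 'v) module" and W :: "('k, 'w) module"
  assumes "kmodule V" "kmodule W" "kmodule V'" "kmodule W'" "k_linear V' V f" "k_linear W' W g"
  shows "k_linear (tensor V' W') (tensor V W) (tensor_map V W f g)"
    and "\<lbrakk>v \<in> carrier V'; w \<in> carrier W'\<rbrakk> \<Longrightarrow>
      tensor_map V W f g (pure_tensor V' W' v w) = pure_tensor V W (f v) (g w)"
proof -
  interpret T: two_modules V W by (rule two_modulesI) fact+
  interpret T': two_modules V' W' by (rule two_modulesI) fact+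
  note b = T.k_bilinear_comp_pure_tensor[OF assms(5,6)]
  show "k_linear (tensor V' W') (tensor V W) (tensor_map V W f g)"
    unfolding tensor_map_def by (rule T'.k_linear_tensor_lift[OF T.tens.kmodule b])
  show "\<lbrakk>v \<in> carrier V'; w \<in> carrier W'\<rbrakk> \<Longrightarrow>
      tensor_map V W f g (pure_tensor V' W' v w) = pure_tensor V W (f v) (g w)"
    unfolding tensor_map_def by (rule T'.tensor_lift_pure[OF T.tens.kmodule b])
qed

lemma tensor_assoc_pure:
  fixes U :: "('k::field, 'u) module" and V :: "('k, 'v) module" and W :: "('k, 'w) module"
  assumes "kmodule U" "kmodule V" "kmodule W"
  shows "k_linear (tensor (tensor U V) W) (tensor U (tensor V W)) (tensor_assoc U V W)"
    and "\<lbrakk>u \<in> carrier U; v \<in> carrier V; w \<in> carrier W\<rbrakk> \<Longrightarrow>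
      tensor_assoc U V W (pure_tensor (tensor U V) W (pure_tensor U V u v) w) =
      pure_tensor U (tensor V W) u (pure_tensor V W v w)"
proof -
  let ?T = "tensor U (tensor V W)"
  interpret UV: two_modules U V by (rule two_modulesI) fact+
  interpret VW: two_modules V W by (rule two_modulesI) fact+
  interpret L: two_modules "tensor U V" W by (rule two_modulesI) (fact UV.tens.kmodule assms)+
  interpret R: two_modules U "tensor V W" by (rule two_modulesI) (fact VW.tens.kmodule assms)+
  let ?\<gamma> = "\<lambda>w u v. pure_tensor U (tensor V W) u (pure_tensor V W v w)"
  have \<gamma>: "k_bilinear U V ?T (?\<gamma> w)" if "w \<in> carrier W" for w
    using that by (intro R.k_bilinear_comp_pure_tensor k_linear_id k_bilinearD[OF VW.k_bilinear_pure_tensor])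
  have \<gamma>': "k_linear W ?T (\<lambda>w. ?\<gamma> w u v)" if "u \<in> carrier U" "v \<in> carrier V" for u v
    using that k_linear_comp[OF k_bilinearD(2)[OF VW.k_bilinear_pure_tensor]
        k_bilinearD(2)[OF R.k_bilinear_pure_tensor]] by blast
  have b: "k_bilinear (tensor U V) W ?T (\<lambda>\<xi> w. tensor_lift ?T (?\<gamma> w) \<xi>)"
    by (intro k_bilinearI UV.k_linear_tensor_lift UV.k_linear_tensor_lift_param \<gamma> \<gamma>' R.tens.kmodule assms)
  show "k_linear (tensor (tensor U V) W) ?T (tensor_assoc U V W)"
    unfolding tensor_assoc_def Let_def by (rule L.k_linear_tensor_lift[OF R.tens.kmodule b])
  show "\<lbrakk>u \<in> carrier U; v \<in> carrier V; w \<in> carrier W\<rbrakk> \<Longrightarrow>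
      tensor_assoc U V W (pure_tensor (tensor U V) W (pure_tensor U V u v) w) =
      pure_tensor U (tensor V W) u (pure_tensor V W v w)"
    unfolding tensor_assoc_def Let_def
    by (simp add: L.tensor_lift_pure[OF R.tens.kmodule b] UV.pure_tensor_closed
        UV.tensor_lift_pure[OF R.tens.kmodule \<gamma>])
qed

section \<open>Homogeneous components\<close>

context graded_space
begin

lemma kmodule: "kmodule V"
  by unfold_locales

lemma gr_closed: "v \<in> gr n \<Longrightarrow> v \<in> carrier V"
  using submoduleE(1)[OF gr_submodule] by blast

lemma gr_ops: "\<zero>\<^bsub>V\<^esub> \<in> gr n" "\<lbrakk>v \<in> gr n; w \<in> gr n\<rbrakk> \<Longrightarrow> v \<oplus>\<^bsub>V\<^esub> w \<in> gr n" "v \<in> gr n \<Longrightarrow> c \<odot>\<^bsub>V\<^esub> v \<in> gr n"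
proof -
  interpret submodule "gr n" "ring_of_type_algebra :: 'k ring" V by (rule gr_submodule)
  show "\<zero>\<^bsub>V\<^esub> \<in> gr n" using one_closed by simp
  show "v \<in> gr n \<Longrightarrow> w \<in> gr n \<Longrightarrow> v \<oplus>\<^bsub>V\<^esub> w \<in> gr n" using m_closed by simp
  show "v \<in> gr n \<Longrightarrow> c \<odot>\<^bsub>V\<^esub> v \<in> gr n" by simp
qed

lemma decomposes_component: "v \<in> carrier V \<Longrightarrow> decomposes V gr v (component V gr v)"
  using theI'[OF gr_direct_sum] by (simp add: component_def)

lemma component_eqI: "\<lbrakk>v \<in> carrier V; decomposes V gr v c\<rbrakk> \<Longrightarrow> component V gr v = c"
  using gr_direct_sum decomposes_component by blast

lemma decomposesI:
  assumes "\<And>n. c n \<in> gr n" "finite K" "\<And>n. n \<notin> K \<Longrightarrow> c n = \<zero>\<^bsub>V\<^esub>" "v = (\<Oplus>\<^bsub>V\<^esub>n\<in>K. c n)"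
  shows "decomposes V gr v c"
proof -
  have sub: "{n. c n \<noteq> \<zero>\<^bsub>V\<^esub>} \<subseteq> K" using assms(3) by blast
  have "(\<Oplus>\<^bsub>V\<^esub>n\<in>{n. c n \<noteq> \<zero>\<^bsub>V\<^esub>}. c n) = v"
    unfolding assms(4) using sub assms(1,2)
    by (intro add.finprod_mono_neutral_cong_left) (auto intro: gr_closed)
  thus ?thesis using assms(1) finite_subset[OF sub assms(2)] by (auto simp: decomposes_def)
qed

lemma component_gr: "v \<in> carrier V \<Longrightarrow> component V gr v n \<in> gr n"
  and finite_comp_supp: "v \<in> carrier V \<Longrightarrow> finite (comp_supp V gr v)"
  and component_sum: "v \<in> carrier V \<Longrightarrow> v = (\<Oplus>\<^bsub>V\<^esub>n\<in>comp_supp V gr v. component V gr v n)"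
  using decomposes_component[of v] by (auto simp: decomposes_def comp_supp_def)

lemma component_superset:
  assumes "v \<in> carrier V" "finite K" "comp_supp V gr v \<subseteq> K"
  shows "v = (\<Oplus>\<^bsub>V\<^esub>n\<in>K. component V gr v n)"
  by (subst component_sum[OF assms(1)], rule add.finprod_mono_neutral_cong_left)
     (use assms in \<open>auto simp: comp_supp_def intro: gr_closed[OF component_gr]\<close>)

lemma component_homogeneous:
  assumes "v \<in> gr m"
  shows "component V gr v = (\<lambda>n. if n = m then v else \<zero>\<^bsub>V\<^esub>)"
  by (rule component_eqI[OF gr_closed[OF assms]], rule decomposesI[where K = "{m}"])
     (use assms gr_closed[OF assms] in \<open>auto simp: gr_ops\<close>)

lemma k_linear_component: "k_linear V V (\<lambda>v. component V gr v n)"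
proof (rule k_linearI)
  fix v w assume vw: "v \<in> carrier V" "w \<in> carrier V"
  note cl = component_gr[OF vw(1), THEN gr_closed] component_gr[OF vw(2), THEN gr_closed]
  let ?K = "comp_supp V gr v \<union> comp_supp V gr w"
  have K: "finite ?K" using vw by (simp add: finite_comp_supp)
  have "decomposes V gr (v \<oplus>\<^bsub>V\<^esub> w) (\<lambda>n. component V gr v n \<oplus>\<^bsub>V\<^esub> component V gr w n)"
  proof (rule decomposesI[OF _ K])
    show "v \<oplus>\<^bsub>V\<^esub> w = (\<Oplus>\<^bsub>V\<^esub>n\<in>?K. component V gr v n \<oplus>\<^bsub>V\<^esub> component V gr w n)"
      by (subst finsum_addf) (use component_superset[OF vw(1) K] component_superset[OF vw(2) K] cl in auto)
  qed (use vw component_gr gr_ops in \<open>auto simp: comp_supp_def\<close>)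
  from component_eqI[OF _ this]
  show "component V gr (v \<oplus>\<^bsub>V\<^esub> w) n = component V gr v n \<oplus>\<^bsub>V\<^esub> component V gr w n"
    using vw by simp
next
  fix c v assume v: "v \<in> carrier V"
  note cl = component_gr[OF v, THEN gr_closed]
  have "decomposes V gr (c \<odot>\<^bsub>V\<^esub> v) (\<lambda>n. c \<odot>\<^bsub>V\<^esub> component V gr v n)"
  proof (rule decomposesI[OF _ finite_comp_supp[OF v]])
    show "c \<odot>\<^bsub>V\<^esub> v = (\<Oplus>\<^bsub>V\<^esub>n\<in>comp_supp V gr v. c \<odot>\<^bsub>V\<^esub> component V gr v n)"
      by (subst finsum_smult_ldistr[symmetric])
         (use component_sum[OF v] finite_comp_supp[OF v] cl in auto)
  qed (use v component_gr gr_ops smult_r_null in \<open>auto simp: comp_supp_def\<close>)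
  from component_eqI[OF _ this]
  show "component V gr (c \<odot>\<^bsub>V\<^esub> v) n = c \<odot>\<^bsub>V\<^esub> component V gr v n"
    using v by simp
qed (use component_gr gr_closed in blast)

lemma hsum_superset:
  assumes "kmodule U" "\<And>n. k_linear V U (\<phi> n)" "v \<in> carrier V" "finite K" "comp_supp V gr v \<subseteq> K"
  shows "(\<Oplus>\<^bsub>U\<^esub>n\<in>comp_supp V gr v. \<phi> n (component V gr v n)) = (\<Oplus>\<^bsub>U\<^esub>n\<in>K. \<phi> n (component V gr v n))"
proof -
  interpret U: Module.module "ring_of_type_algebra :: 'k ring" U by fact
  show ?thesis
    using assms(3-) k_linear_zero[OF assms(2) kmodule assms(1)]
    by (intro U.add.finprod_mono_neutral_cong_left)
       (auto simp: comp_supp_def intro: k_linearD(1)[OF assms(2)] gr_closed[OF component_gr])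
qed

text \<open>
  Operations with Koszul signs are sums over the support of an element, which varies with the element.
  Linearity is seen by enlarging the supports of two elements and of their sum to a common finite set.
\<close>

lemma k_linear_hsum:
  assumes "kmodule U" "\<And>n. k_linear V U (\<phi> n)"
  shows "k_linear V U (\<lambda>v. \<Oplus>\<^bsub>U\<^esub>n\<in>comp_supp V gr v. \<phi> n (component V gr v n))"
proof -
  interpret U: Module.module "ring_of_type_algebra :: 'k ring" U by fact
  note lin = k_linearD[OF k_linear_comp[OF k_linear_component assms(2)]]
  define h where "h K v = (\<Oplus>\<^bsub>U\<^esub>n\<in>K. \<phi> n (component V gr v n))" for K v
  have h: "k_linear V U (h K)" if "finite K" for K
    unfolding h_def using that
    by (intro k_linear_finsum assms k_linear_comp[OF k_linear_component assms(2)])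
  show ?thesis unfolding h_def[symmetric]
  proof (rule k_linearI)
    fix v w assume vw: "v \<in> carrier V" "w \<in> carrier V"
    let ?K = "comp_supp V gr v \<union> comp_supp V gr w \<union> comp_supp V gr (v \<oplus>\<^bsub>V\<^esub> w)"
    have K: "finite ?K" using vw by (simp add: finite_comp_supp)
    have "h (comp_supp V gr u) u = h ?K u" if "u \<in> insert v {w, v \<oplus>\<^bsub>V\<^esub> w}" for u
      unfolding h_def using that vw K by (intro hsum_superset assms) auto
    thus "h (comp_supp V gr (v \<oplus>\<^bsub>V\<^esub> w)) (v \<oplus>\<^bsub>V\<^esub> w)
        = h (comp_supp V gr v) v \<oplus>\<^bsub>U\<^esub> h (comp_supp V gr w) w"
      using k_linearD(2)[OF h[OF K] vw] by simp
  next
    fix c v assume v: "v \<in> carrier V"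
    let ?K = "comp_supp V gr v \<union> comp_supp V gr (c \<odot>\<^bsub>V\<^esub> v)"
    have K: "finite ?K" using v by (simp add: finite_comp_supp)
    have "h (comp_supp V gr u) u = h ?K u" if "u \<in> insert v {c \<odot>\<^bsub>V\<^esub> v}" for u
      unfolding h_def using that v K by (intro hsum_superset assms) auto
    thus "h (comp_supp V gr (c \<odot>\<^bsub>V\<^esub> v)) (c \<odot>\<^bsub>V\<^esub> v) = c \<odot>\<^bsub>U\<^esub> h (comp_supp V gr v) v"
      using k_linearD(3)[OF h[OF K] v] by simp
  next
    fix v assume v: "v \<in> carrier V"
    show "h (comp_supp V gr v) v \<in> carrier U"
      using k_linearD(1)[OF h v] finite_comp_supp[OF v] by blast
  qed
qed

lemma hsum_homogeneous:
  assumes "kmodule U" "\<And>n. k_linear V U (\<phi> n)" "v \<in> gr m"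
  shows "(\<Oplus>\<^bsub>U\<^esub>n\<in>comp_supp V gr v. \<phi> n (component V gr v n)) = \<phi> m v"
proof -
  interpret U: Module.module "ring_of_type_algebra :: 'k ring" U by fact
  note v = gr_closed[OF assms(3)]
  have "(\<Oplus>\<^bsub>U\<^esub>n\<in>comp_supp V gr v. \<phi> n (component V gr v n)) = (\<Oplus>\<^bsub>U\<^esub>n\<in>{m}. \<phi> n (component V gr v n))"
    by (rule hsum_superset[OF assms(1,2) v])
       (auto simp: comp_supp_def component_homogeneous[OF assms(3)])
  also have "\<dots> = \<phi> m v"
    using v k_linearD(1)[OF assms(2)] by (simp add: component_homogeneous[OF assms(3)])
  finally show ?thesis .
qed

end

section \<open>Product and differential on a tensor square\<close>

context graded_space
begin

sublocale VV: two_modules V V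
  by (rule two_modulesI) (rule kmodule)+

abbreviation "TT \<equiv> tensor V V"

lemmas pure_linear = k_bilinearD(1,2)[OF VV.k_bilinear_pure_tensor]

context
  assumes mult: "k_bilinear V V V (\<lambda>a b. a \<otimes>\<^bsub>V\<^esub> b)"
begin

lemmas mult_linear = k_bilinearD(1,2)[OF mult]
lemmas mult_closed = k_bilinearD(3)[OF mult]

text \<open>
  The summand of \<^const>\<open>tensor_mult\<close> at the degrees \<open>i\<close> and \<open>j\<close>. The sums over \<open>j\<close> and then over \<open>i\<close> are
  taken one at a time, so that each is an instance of the sums over supports above.
\<close>

definition koszul :: "int \<Rightarrow> int \<Rightarrow> 'v \<Rightarrow> 'v \<Rightarrow> 'v \<Rightarrow> 'v \<Rightarrow> ('v \<times> 'v \<Rightarrow>\<^sub>0 'k) set"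
  where "koszul i j a b c e = ((-1) powi (i * j)) \<odot>\<^bsub>TT\<^esub> pure_tensor V V (a \<otimes>\<^bsub>V\<^esub> c) (b \<otimes>\<^bsub>V\<^esub> e)"

definition koszul_right :: "int \<Rightarrow> 'v \<Rightarrow> 'v \<Rightarrow> 'v \<Rightarrow> 'v \<Rightarrow> ('v \<times> 'v \<Rightarrow>\<^sub>0 'k) set"
  where "koszul_right i a b c e =
    (\<Oplus>\<^bsub>TT\<^esub>j\<in>comp_supp V gr c. koszul i j a b (component V gr c j) e)"

definition koszul_mult :: "'v \<Rightarrow> 'v \<Rightarrow> 'v \<Rightarrow> 'v \<Rightarrow> ('v \<times> 'v \<Rightarrow>\<^sub>0 'k) set"
  where "koszul_mult a b c e =
    (\<Oplus>\<^bsub>TT\<^esub>i\<in>comp_supp V gr b. koszul_right i a (component V gr b i) c e)"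

lemma koszul_linear:
  assumes "a \<in> carrier V" "b \<in> carrier V" "c \<in> carrier V" "e \<in> carrier V"
  shows "k_linear V TT (\<lambda>a. koszul i j a b c e)" "k_linear V TT (\<lambda>b. koszul i j a b c e)"
    "k_linear V TT (\<lambda>c. koszul i j a b c e)" "k_linear V TT (\<lambda>e. koszul i j a b c e)"
proof -
  have ac: "a \<otimes>\<^bsub>V\<^esub> c \<in> carrier V" and be: "b \<otimes>\<^bsub>V\<^esub> e \<in> carrier V" using assms mult_closed by auto
  note s = k_linear_smult[OF VV.tens.kmodule]
  show "k_linear V TT (\<lambda>a. koszul i j a b c e)"
    unfolding koszul_def by (rule s[OF k_linear_comp[OF mult_linear(1)[OF assms(3)] pure_linear(1)[OF be]]])
  show "k_linear V TT (\<lambda>b. koszul i j a b c e)"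
    unfolding koszul_def by (rule s[OF k_linear_comp[OF mult_linear(1)[OF assms(4)] pure_linear(2)[OF ac]]])
  show "k_linear V TT (\<lambda>c. koszul i j a b c e)"
    unfolding koszul_def by (rule s[OF k_linear_comp[OF mult_linear(2)[OF assms(1)] pure_linear(1)[OF be]]])
  show "k_linear V TT (\<lambda>e. koszul i j a b c e)"
    unfolding koszul_def by (rule s[OF k_linear_comp[OF mult_linear(2)[OF assms(2)] pure_linear(2)[OF ac]]])
qed

lemmas comp_carrier = gr_closed[OF component_gr]

lemma koszul_right_linear:
  assumes "a \<in> carrier V" "b \<in> carrier V" "c \<in> carrier V" "e \<in> carrier V"
  shows "k_linear V TT (\<lambda>a. koszul_right i a b c e)" "k_linear V TT (\<lambda>b. koszul_right i a b c e)"
    "k_linear V TT (\<lambda>c. koszul_right i a b c e)" "k_linear V TT (\<lambda>e. koszul_right i a b c e)"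
  unfolding koszul_right_def
  by (intro k_linear_finsum k_linear_hsum VV.tens.kmodule finite_comp_supp comp_carrier
      koszul_linear(1)[where a = a] koszul_linear(2)[where b = b] koszul_linear(3)[where c = c]
      koszul_linear(4)[where e = e] assms)+

lemma koszul_mult_linear:
  assumes "a \<in> carrier V" "b \<in> carrier V" "c \<in> carrier V" "e \<in> carrier V"
  shows "k_linear V TT (\<lambda>a. koszul_mult a b c e)" "k_linear V TT (\<lambda>b. koszul_mult a b c e)"
    "k_linear V TT (\<lambda>c. koszul_mult a b c e)" "k_linear V TT (\<lambda>e. koszul_mult a b c e)"
  unfolding koszul_mult_def
  by (intro k_linear_finsum k_linear_hsum VV.tens.kmodule finite_comp_supp comp_carrier
      koszul_right_linear(1)[where a = a] koszul_right_linear(2)[where b = b]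
      koszul_right_linear(3)[where c = c] koszul_right_linear(4)[where e = e] assms)+

lemma koszul_mult_bilinear:
  assumes "a \<in> carrier V" "b \<in> carrier V"
  shows "k_bilinear V V TT (koszul_mult a b)"
  by (rule k_bilinearI) (rule koszul_mult_linear(3)[OF assms(1,2) assms(1)] koszul_mult_linear(4)[OF assms(1,2) _ assms(1)], assumption)+

lemma koszul_lift_bilinear:
  assumes "\<eta> \<in> carrier TT"
  shows "k_bilinear V V TT (\<lambda>a b. tensor_lift TT (koszul_mult a b) \<eta>)"
proof (rule k_bilinearI)
  fix b assume b: "b \<in> carrier V"
  show "k_linear V TT (\<lambda>a. tensor_lift TT (koszul_mult a b) \<eta>)"
    by (intro VV.k_linear_tensor_lift_param VV.tens.kmodule koszul_mult_bilinear kmodule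
        koszul_mult_linear(1)[where a = b] assms b)
next
  fix a assume a: "a \<in> carrier V"
  show "k_linear V TT (\<lambda>b. tensor_lift TT (koszul_mult a b) \<eta>)"
    by (intro VV.k_linear_tensor_lift_param VV.tens.kmodule koszul_mult_bilinear kmodule
        koszul_mult_linear(2)[where b = a] assms a)
qed

lemma tensor_mult_eq: "tensor_mult V gr \<xi> \<eta> = tensor_lift TT (\<lambda>a b. tensor_lift TT (koszul_mult a b) \<eta>) \<xi>"
  unfolding tensor_mult_def Let_def koszul_mult_def[abs_def] koszul_right_def koszul_def ..

lemma tensor_mult_linear:
  shows "\<eta> \<in> carrier TT \<Longrightarrow> k_linear TT TT (\<lambda>\<xi>. tensor_mult V gr \<xi> \<eta>)"
    and "\<xi> \<in> carrier TT \<Longrightarrow> k_linear TT TT (\<lambda>\<eta>. tensor_mult V gr \<xi> \<eta>)"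
proof -
  show "\<eta> \<in> carrier TT \<Longrightarrow> k_linear TT TT (\<lambda>\<xi>. tensor_mult V gr \<xi> \<eta>)"
    unfolding tensor_mult_eq by (rule VV.k_linear_tensor_lift[OF VV.tens.kmodule koszul_lift_bilinear])
  assume "\<xi> \<in> carrier TT"
  thus "k_linear TT TT (\<lambda>\<eta>. tensor_mult V gr \<xi> \<eta>)"
    unfolding tensor_mult_eq
    by (intro VV.k_linear_tensor_lift_param VV.tens.kmodule koszul_lift_bilinear
        VV.k_linear_tensor_lift koszul_mult_bilinear)
qed

lemma tensor_mult_pure:
  assumes "a \<in> carrier V" "b \<in> gr i" "c \<in> gr j" "e \<in> carrier V"
  shows "tensor_mult V gr (pure_tensor V V a b) (pure_tensor V V c e)
    = ((-1) powi (i * j)) \<odot>\<^bsub>TT\<^esub> pure_tensor V V (a \<otimes>\<^bsub>V\<^esub> c) (b \<otimes>\<^bsub>V\<^esub> e)"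
proof -
  have b: "b \<in> carrier V" and c: "c \<in> carrier V" using assms gr_closed by auto
  have "tensor_mult V gr (pure_tensor V V a b) (pure_tensor V V c e) = koszul_mult a b c e"
    unfolding tensor_mult_eq
    by (simp add: VV.tensor_lift_pure[OF VV.tens.kmodule koszul_lift_bilinear] VV.pure_tensor_closed
        VV.tensor_lift_pure[OF VV.tens.kmodule koszul_mult_bilinear] assms b c)
  also have "\<dots> = koszul_right i a b c e"
    unfolding koszul_mult_def
    by (rule hsum_homogeneous[OF VV.tens.kmodule koszul_right_linear(2) assms(2)]) (fact assms b c)+
  also have "\<dots> = koszul i j a b c e"
    unfolding koszul_right_def
    by (rule hsum_homogeneous[OF VV.tens.kmodule koszul_linear(3) assms(3)]) (fact assms b c)+
  finally show ?thesis by (simp add: koszul_def)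
qed

end

context
  fixes D :: "'v \<Rightarrow> 'v"
  assumes D: "k_linear V V D"
begin

lemma tensor_diff_bilinear:
  "k_bilinear V V TT (\<lambda>a b. pure_tensor V V (D a) b \<oplus>\<^bsub>TT\<^esub>
     (\<Oplus>\<^bsub>TT\<^esub>i\<in>comp_supp V gr a. ((-1) powi i) \<odot>\<^bsub>TT\<^esub> pure_tensor V V (component V gr a i) (D b)))"
proof (rule k_bilinearI)
  fix b assume b: "b \<in> carrier V"
  show "k_linear V TT (\<lambda>a. pure_tensor V V (D a) b \<oplus>\<^bsub>TT\<^esub>
     (\<Oplus>\<^bsub>TT\<^esub>i\<in>comp_supp V gr a. ((-1) powi i) \<odot>\<^bsub>TT\<^esub> pure_tensor V V (component V gr a i) (D b)))"
    by (intro k_linear_add k_linear_hsum k_linear_smult VV.tens.kmodule k_linear_comp[OF D]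
        pure_linear(1) k_linearD(1)[OF D] b)
next
  fix a assume a: "a \<in> carrier V"
  show "k_linear V TT (\<lambda>b. pure_tensor V V (D a) b \<oplus>\<^bsub>TT\<^esub>
     (\<Oplus>\<^bsub>TT\<^esub>i\<in>comp_supp V gr a. ((-1) powi i) \<odot>\<^bsub>TT\<^esub> pure_tensor V V (component V gr a i) (D b)))"
    by (intro k_linear_add k_linear_finsum k_linear_smult VV.tens.kmodule k_linear_comp[OF D]
        pure_linear(2) k_linearD(1)[OF D] finite_comp_supp gr_closed[OF component_gr] a)
qed

lemma tensor_diff_linear: "k_linear TT TT (tensor_diff V gr D)"
  unfolding tensor_diff_def Let_def
  by (rule VV.k_linear_tensor_lift[OF VV.tens.kmodule tensor_diff_bilinear])

lemma tensor_diff_pure: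
  assumes "a \<in> gr i" "b \<in> carrier V"
  shows "tensor_diff V gr D (pure_tensor V V a b)
    = pure_tensor V V (D a) b \<oplus>\<^bsub>TT\<^esub> ((-1) powi i) \<odot>\<^bsub>TT\<^esub> pure_tensor V V a (D b)"
proof -
  have lin: "k_linear V TT (\<lambda>a. ((-1) powi n) \<odot>\<^bsub>TT\<^esub> pure_tensor V V a (D b))" for n :: int
    by (intro k_linear_smult VV.tens.kmodule pure_linear(1) k_linearD(1)[OF D] assms)
  show ?thesis
    unfolding tensor_diff_def Let_def
    by (simp add: VV.tensor_lift_pure[OF VV.tens.kmodule tensor_diff_bilinear] gr_closed[OF assms(1)]
        assms(2) hsum_homogeneous[OF VV.tens.kmodule lin assms(1)])
qed

end

end

section \<open>Homogeneous bases\<close>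

context tate_phi_dg_algebra
begin

abbreviation sg :: "int \<Rightarrow> 'k"
  where "sg n \<equiv> (- 1) powi n"

lemma sg_parity: "sg n = (if even n then 1 else - 1)"
  using power_int_minus_left[of "1 :: 'k" n] by simp

lemma sg_add: "sg (a + b) = sg a * sg b"
  by (simp add: power_int_add)

lemma sg_square [simp]: "sg n * sg n = 1" "sg n * (sg n * z) = z"
  by (simp_all add: sg_parity)

lemmas sg_simps = distrib_right[of "_ :: int"] distrib_left[of "_ :: int"] sg_add

text \<open>
  Uniqueness of bigraded decompositions, for families with a common finite bound on the support
  instead of the exact support.
\<close>

lemma decomposition_unique:
  assumes "\<And>n m. c (n, m) \<in> G n m" "finite K" "\<And>p. p \<notin> K \<Longrightarrow> c p = 0" "x = (\<Sum>p\<in>K. c p)"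
    and "\<And>n m. c' (n, m) \<in> G n m" "finite K'" "\<And>p. p \<notin> K' \<Longrightarrow> c' p = 0" "x = (\<Sum>p\<in>K'. c' p)"
  shows "c = c'"
proof -
  have decomp: "(\<forall>n m. e (n, m) \<in> G n m) \<and> finite {p. e p \<noteq> 0} \<and> x = (\<Sum>p | e p \<noteq> 0. e p)"
    if "\<And>n m. e (n, m) \<in> G n m" "finite J" "\<And>p. p \<notin> J \<Longrightarrow> e p = 0" "x = (\<Sum>p\<in>J. e p)" for e J
  proof -
    have "{p. e p \<noteq> 0} \<subseteq> J" using that(3) by blast
    thus ?thesis using that(1,2,4) by (auto intro: finite_subset sum.mono_neutral_right)
  qed
  show ?thesis
    using G_direct_sum[of x] decomp[OF assms(1-4)] decomp[OF assms(5-8)] by blast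
qed

lemma G_zero [simp]: "0 \<in> G n m"
  by (rule subspace_0[OF G_subspace])

lemma homogeneous_unique:
  assumes "x \<in> G n m" "x \<in> G n' m'" "x \<noteq> 0"
  shows "n = n' \<and> m = m'"
proof -
  have "(\<lambda>p. if p = (n, m) then x else 0) = (\<lambda>p. if p = (n', m') then x else 0)"
    by (rule decomposition_unique[where K = "{(n, m)}" and K' = "{(n', m')}" and x = x])
       (use assms in auto)
  from fun_cong[OF this, of "(n, m)"] show ?thesis using assms(3) by (auto split: if_splits)
qed

lemma deg_eq: "\<lbrakk>x \<in> G n 1; x \<noteq> 0\<rbrakk> \<Longrightarrow> deg x = n"
  unfolding deg_def by (rule the_equality) (auto dest: homogeneous_unique)

lemma comp1_eq:
  assumes "\<And>n m. c (n, m) \<in> G n m" "finite K" "\<And>p. p \<notin> K \<Longrightarrow> c p = 0" "x = (\<Sum>p\<in>K. c p)"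
  shows "comp1 x n = c (n, 1)"
proof -
  have sub: "{p. c p \<noteq> 0} \<subseteq> K" using assms(3) by blast
  have "(THE c. (\<forall>n m. c (n, m) \<in> G n m) \<and> finite {p. c p \<noteq> 0} \<and> x = (\<Sum>p | c p \<noteq> 0. c p)) = c"
  proof (rule the1_equality[OF G_direct_sum], intro conjI allI)
    show "finite {p. c p \<noteq> 0}" using sub assms(2) by (rule finite_subset)
    show "x = (\<Sum>p | c p \<noteq> 0. c p)"
      unfolding assms(4) using sub assms(2) by (intro sum.mono_neutral_right) auto
  qed (rule assms)
  thus ?thesis by (simp add: comp1_def)
qed

lemma comp1_homogeneous:
  assumes "x \<in> G m 1"
  shows "comp1 x n = (if n = m then x else 0)"
  by (subst comp1_eq[where c = "\<lambda>p. if p = (m, 1) then x else 0" and K = "{(m, 1)}"])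
     (use assms in auto)

lemma G1_R1: "x \<in> G n 1 \<Longrightarrow> x \<in> R1"
  unfolding R1_def by (auto intro: span_base)

lemma R1_closed [simp, intro]:
  "0 \<in> R1" "x \<in> R1 \<Longrightarrow> y \<in> R1 \<Longrightarrow> x + y \<in> R1" "x \<in> R1 \<Longrightarrow> scale c x \<in> R1"
  by (auto simp: R1_def span_zero span_add span_scale)

lemma d_simps: "d (x + y) = d x + d y" "d (scale c x) = scale c (d x)" "d 0 = 0"
proof -
  show "d (x + y) = d x + d y" and "d (scale c x) = scale c (d x)" for x y c
    using d_linear by (auto simp: Vector_Spaces.linear_iff)
  from this(2)[of 0 0] show "d 0 = 0" by simp
qed

lemma d_one: "d 1 = 0"
  using d_leibniz[OF G_one, of 1] by simp

end

text \<open>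
  A basis of \<open>R\<^sub>1\<close> that consists of homogeneous elements and contains the chosen generator \<open>t\<close> of
  the Tate line turns \<open>T(R\<^sub>1)\<close> into the free vector space on the words in this basis, and the
  quotient \<open>A\<close> into the free vector space on the words that do not begin with \<open>t\<close>.
\<close>

locale tate_basis = tate_phi_dg_algebra scale G d L
  for scale :: "'k::field \<Rightarrow> 'r::ring_1 \<Rightarrow> 'r" and G :: "int \<Rightarrow> int \<Rightarrow> 'r set"
    and d :: "'r \<Rightarrow> 'r" and L :: "'r set" +
  fixes t :: 'r and B :: "'r set"
  assumes t_L: "t \<in> L" and t_nz: "t \<noteq> 0" and t_B: "t \<in> B"
    and B_homogeneous: "B \<subseteq> (\<Union>n. G n 1)" and B_independent: "independent B"
    and R1_le_span: "R1 \<subseteq> span B"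

text \<open>
  The set of homogeneous elements of \<open>R\<^sub>1\<close> is not a subspace, but a maximal independent subset of it
  that extends \<open>{t}\<close> spans it, and so is a homogeneous basis of \<open>R\<^sub>1\<close>.
\<close>

lemma (in tate_phi_dg_algebra) tate_basis_exists:
  assumes "t \<in> L" "t \<noteq> 0"
  obtains B where "tate_basis scale G d L t B"
proof -
  have "{t} \<subseteq> (\<Union>n. G n 1)" using assms L_degree by auto
  from maximal_independent_subset_extend[OF this]
  obtain B where B: "{t} \<subseteq> B" "B \<subseteq> (\<Union>n. G n 1)" "independent B" "(\<Union>n. G n 1) \<subseteq> span B"
    using assms by auto
  have "R1 \<subseteq> span B" unfolding R1_def using B(4) by (rule span_minimal) simp
  with B assms show ?thesis
    by (intro that[of B] tate_basis.intro tate_basis_axioms.intro tate_phi_dg_algebra_axioms) auto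
qed

context tate_basis
begin

lemma B_nz: "b \<in> B \<Longrightarrow> b \<noteq> 0"
  using B_independent dependent_zero by blast

lemma B_deg: "b \<in> B \<Longrightarrow> b \<in> G (deg b) 1"
  using B_homogeneous B_nz deg_eq by blast

lemma B_R1: "b \<in> B \<Longrightarrow> b \<in> R1"
  using B_deg G1_R1 by blast

lemma R1_eq: "R1 = span B"
proof (rule equalityI[OF R1_le_span])
  have "subspace R1" by (simp add: R1_def)
  thus "span B \<subseteq> R1" using B_R1 by (intro span_minimal) auto
qed

text \<open>
  Grouping the expansion of \<open>x\<close> in the basis by degrees gives a homogeneous decomposition of \<open>x\<close>, which
  is the only one.
\<close>

lemma comp1_R1:
  assumes "x \<in> R1"
  shows "comp1 x n = (\<Sum>b | representation B x b \<noteq> 0 \<and> deg b = n. scale (representation B x b) b)"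
proof -
  let ?S = "{b. representation B x b \<noteq> 0}"
  let ?f = "\<lambda>b. (deg b, 1 :: int)"
  define c where "c = (\<lambda>p. \<Sum>b\<in>{b \<in> ?S. ?f b = p}. scale (representation B x b) b)"
  have fin: "finite ?S" by (rule finite_representation)
  have "comp1 x n = c (n, 1)"
  proof (rule comp1_eq[where K = "?f ` ?S"])
    show "c (n, m) \<in> G n m" for n m
      unfolding c_def
      by (rule subspace_sum[OF G_subspace])
         (auto intro!: subspace_scale[OF G_subspace] B_deg dest: representation_ne_zero)
    have "x = (\<Sum>b\<in>?S. scale (representation B x b) b)"
      using assms by (subst sum_nonzero_representation_eq) (auto simp: B_independent R1_eq)
    also have "\<dots> = (\<Sum>p\<in>?f ` ?S. c p)"
      unfolding c_def by (rule sum.image_gen[OF fin])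
    finally show "x = (\<Sum>p\<in>?f ` ?S. c p)" .
    show "c p = 0" if "p \<notin> ?f ` ?S" for p
      using that unfolding c_def by (intro sum.neutral) auto
  qed (use fin in auto)
  thus ?thesis by (simp add: c_def)
qed

lemma comp1_G: "x \<in> R1 \<Longrightarrow> comp1 x n \<in> G n 1"
  by (subst comp1_R1)
     (auto intro!: subspace_sum[OF G_subspace] subspace_scale[OF G_subspace] B_deg
       dest: representation_ne_zero)

lemma comp1_sum:
  assumes "x \<in> R1"
  shows "finite {n. comp1 x n \<noteq> 0}" "x = (\<Sum>n | comp1 x n \<noteq> 0. comp1 x n)"
proof -
  let ?S = "{b. representation B x b \<noteq> 0}"
  have fin: "finite ?S" by (rule finite_representation)
  have eq: "comp1 x n = (\<Sum>b\<in>{b \<in> ?S. deg b = n}. scale (representation B x b) b)" for n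
    by (simp add: comp1_R1[OF assms])
  have sub: "{n. comp1 x n \<noteq> 0} \<subseteq> deg ` ?S"
  proof
    fix n assume "n \<in> {n. comp1 x n \<noteq> 0}"
    hence nz: "comp1 x n \<noteq> 0" by simp
    have "{b \<in> ?S. deg b = n} \<noteq> {}"
    proof
      assume "{b \<in> ?S. deg b = n} = {}"
      with eq[of n] have "comp1 x n = 0" by (simp only: sum.empty)
      with nz show False by simp
    qed
    thus "n \<in> deg ` ?S" by blast
  qed
  show "finite {n. comp1 x n \<noteq> 0}" using sub fin by (meson finite_imageI finite_subset)
  have "x = (\<Sum>b\<in>?S. scale (representation B x b) b)"
    using assms by (subst sum_nonzero_representation_eq) (auto simp: B_independent R1_eq)
  also have "\<dots> = (\<Sum>n\<in>deg ` ?S. comp1 x n)"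
    unfolding eq by (rule sum.image_gen[OF fin])
  also have "\<dots> = (\<Sum>n | comp1 x n \<noteq> 0. comp1 x n)"
    using sub fin by (intro sum.mono_neutral_right) auto
  finally show "x = (\<Sum>n | comp1 x n \<noteq> 0. comp1 x n)" .
qed

text \<open>
  A homogeneous element is a combination of basis elements of its own degree. This allows identities
  with signs that depend on the degree of a letter to be checked on the basis.
\<close>

lemma G1_induct [consumes 1, case_names zero add scale basis]:
  assumes "x \<in> G n 1" and "P 0"
    and "\<And>x y. \<lbrakk>x \<in> G n 1; y \<in> G n 1; P x; P y\<rbrakk> \<Longrightarrow> P (x + y)"
    and "\<And>c x. \<lbrakk>x \<in> G n 1; P x\<rbrakk> \<Longrightarrow> P (scale c x)"
    and "\<And>b. \<lbrakk>b \<in> B; b \<in> G n 1; deg b = n\<rbrakk> \<Longrightarrow> P b"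
  shows "P x"
proof -
  have x: "x \<in> span {b \<in> B. deg b = n}"
  proof -
    have "x = (\<Sum>b | representation B x b \<noteq> 0 \<and> deg b = n. scale (representation B x b) b)"
      using comp1_R1[OF G1_R1[OF assms(1)], of n] comp1_homogeneous[OF assms(1), of n] by simp
    also have "\<dots> \<in> span {b \<in> B. deg b = n}"
      by (intro span_sum span_scale span_base) (auto dest: representation_ne_zero)
    finally show ?thesis .
  qed
  have sub: "subspace {x \<in> G n 1. P x}"
    using assms(2-4) G_subspace by (auto intro!: subspaceI simp: subspace_add subspace_scale)
  show ?thesis using span_induct[OF x sub] assms(5) B_deg by blast
qed

lemma R1_induct [consumes 1, case_names zero add scale basis]:
  assumes "x \<in> R1" and "P 0"
    and "\<And>x y. \<lbrakk>x \<in> R1; y \<in> R1; P x; P y\<rbrakk> \<Longrightarrow> P (x + y)"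
    and "\<And>c x. \<lbrakk>x \<in> R1; P x\<rbrakk> \<Longrightarrow> P (scale c x)"
    and "\<And>b. b \<in> B \<Longrightarrow> P b"
  shows "P x"
proof -
  have sub: "subspace {x \<in> R1. P x}" using assms(2-4) by (auto intro!: subspaceI)
  show ?thesis using span_induct[OF assms(1)[unfolded R1_eq] sub] assms(5) B_R1 by blast
qed

subsection \<open>The inverse of the generator\<close>

lemma t_G: "t \<in> G 0 1"
  using t_L L_degree by blast

lemma deg_t [simp]: "deg t = 0"
  by (rule deg_eq[OF t_G t_nz])

lemma t_central: "t * x = x * t"
  by (rule L_central[OF t_L])

lemma tinv_inverse: "t * tinv t = 1" "tinv t * t = 1"
proof -
  obtain u where u: "t * u = 1 \<and> u * t = 1" using L_invertible[OF t_L t_nz] by blast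
  have "t * tinv t = 1 \<and> tinv t * t = 1"
    unfolding tinv_def
  proof (rule theI)
    fix v assume v: "t * v = 1 \<and> v * t = 1"
    have "v = (u * t) * v" using u by simp
    also have "\<dots> = u" using v by (simp add: mult.assoc)
    finally show "v = u" .
  qed (rule u)
  thus "t * tinv t = 1" "tinv t * t = 1" by auto
qed

lemma t_cancel [simp]: "x * tinv t * t = x" "x * t * tinv t = x"
  by (simp_all add: mult.assoc tinv_inverse)

lemma tinv_central: "tinv t * x = x * tinv t"
proof -
  have "tinv t * x = tinv t * (t * x) * tinv t"
    by (simp add: t_central mult.assoc tinv_inverse)
  also have "\<dots> = x * tinv t"
    by (simp add: tinv_inverse flip: mult.assoc)
  finally show ?thesis .
qed

lemma t_conj [simp]: "t * x * tinv t = x"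
  by (simp add: t_central mult.assoc tinv_inverse)

text \<open>
  The component of \<open>t\<^sup>-\<^sup>1\<close> of bidegree \<open>(0, -1)\<close> is already an inverse of \<open>t\<close>, since \<open>1\<close> has bidegree \<open>(0, 0)\<close>.
\<close>

lemma tinv_G: "tinv t \<in> G 0 (- 1)"
proof -
  obtain c where c: "\<And>n m. c (n, m) \<in> G n m" "finite {p. c p \<noteq> 0}"
      "tinv t = (\<Sum>p | c p \<noteq> 0. c p)"
    using G_direct_sum[of "tinv t"] by blast
  let ?K = "{p. c p \<noteq> 0}" and ?s = "\<lambda>(n, m). (n, m + 1 :: int)"
  \<comment> \<open>The components of \<open>t t\<^sup>-\<^sup>1 = 1\<close>.\<close>
  define c' where "c' = (\<lambda>(n, m). t * c (n, m - 1))"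
  have "c' = (\<lambda>p. if p = (0, 0) then 1 else 0)"
  proof (rule decomposition_unique[where x = 1 and K = "?s ` ?K" and K' = "{(0, 0)}"])
    show "c' (n, m) \<in> G n m" for n m
      using G_mult[OF t_G c(1)[of n "m - 1"]] by (simp add: c'_def)
    show "c' p = 0" if "p \<notin> ?s ` ?K" for p
    proof -
      have "c (fst p, snd p - 1) = 0"
      proof (rule ccontr)
        assume "c (fst p, snd p - 1) \<noteq> 0"
        hence "?s (fst p, snd p - 1) \<in> ?s ` ?K" by blast
        with that show False by simp
      qed
      thus ?thesis by (simp add: c'_def case_prod_beta)
    qed
    have "1 = t * (\<Sum>p\<in>?K. c p)" using tinv_inverse c(3) by simp
    also have "\<dots> = (\<Sum>p\<in>?K. c' (?s p))" by (simp add: sum_distrib_left c'_def case_prod_beta)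
    also have "\<dots> = (\<Sum>p\<in>?s ` ?K. c' p)"
      by (subst sum.reindex) (auto simp: inj_on_def)
    finally show "1 = (\<Sum>p\<in>?s ` ?K. c' p)" .
  qed (use c(2) G_one in auto)
  from fun_cong[OF this, of "(0, 0)"] have "t * c (0, - 1) = 1" by (simp add: c'_def)
  hence "tinv t * (t * c (0, - 1)) = tinv t" by simp
  hence "tinv t = c (0, - 1)" by (simp add: tinv_inverse flip: mult.assoc)
  thus ?thesis using c(1)[of 0 "-1"] by simp
qed

lemma d_t [simp]: "d t = 0"
  by (rule d_L[OF t_L])

lemma d_tinv: "d (tinv t) = 0"
proof -
  have "t * d (tinv t) = 0"
    using d_leibniz[OF t_G, of "tinv t"] by (simp add: tinv_inverse d_one)
  hence "tinv t * (t * d (tinv t)) = 0" by simp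
  thus ?thesis by (simp add: tinv_inverse flip: mult.assoc)
qed

lemma contraction_G: "\<lbrakk>x \<in> G i 1; y \<in> G j 1\<rbrakk> \<Longrightarrow> x * y * tinv t \<in> G (i + j) 1"
  using G_mult[OF G_mult tinv_G, of x i 1 y j 1] by simp

lemma d_contraction:
  assumes "x \<in> G i 1" "y \<in> G j 1"
  shows "d (x * y * tinv t) = d x * y * tinv t + scale (sg i) (x * d y * tinv t)"
  using d_leibniz[OF G_mult[OF assms], of "tinv t"] d_leibniz[OF assms(1), of y]
  by (simp add: d_tinv distrib_right scale_mult_left)

section \<open>Words in the basis\<close>

definition coords :: "'r \<Rightarrow> ('r \<Rightarrow>\<^sub>0 'k)"
  where "coords x = Abs_poly_mapping (representation B x)"

lemma lookup_coords: "Poly_Mapping.lookup (coords x) b = representation B x b"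
  by (simp add: coords_def finite_representation)

lemma coords_basis: "b \<in> B \<Longrightarrow> coords b = gen b"
  by (rule poly_mapping_eqI)
     (simp add: lookup_coords representation_basis B_independent lookup_single when_def)

lemma coords_closed: "coords x \<in> free_on B"
  by (auto simp: free_on_iff_lookup lookup_coords dest: representation_ne_zero)

lemma coords_simps [simp]:
  "coords 0 = 0"
  "x \<in> R1 \<Longrightarrow> y \<in> R1 \<Longrightarrow> coords (x + y) = coords x + coords y"
  "x \<in> R1 \<Longrightarrow> coords (scale c x) = fscale c (coords x)"
  by (auto intro!: poly_mapping_eqI simp: lookup_coords lookup_add R1_eq representation_add
      representation_scale representation_zero B_independent)

text \<open>
  The tensor \<open>x \<otimes> P\<close> for an arbitrary letter \<open>x \<in> R\<^sub>1\<close>, as a combination of words in the basis. It is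
  bilinear in \<open>x\<close> and \<open>P\<close>.
\<close>

definition cons :: "'r \<Rightarrow> ('r list \<Rightarrow>\<^sub>0 'k) \<Rightarrow> ('r list \<Rightarrow>\<^sub>0 'k)"
  where "cons x P = lin_ext (\<lambda>b. lin_ext (\<lambda>w. gen (b # w)) P) (coords x)"

lemma flinear_cons: "flinear g \<Longrightarrow> flinear (\<lambda>P. cons x (g P))"
  unfolding cons_def by (intro flinear_intros)

lemmas cons_vec [simp] = flinear_simps[OF flinear_cons[OF flinear_id]]

lemma cons_letter [simp]:
  "cons 0 P = 0"
  "x \<in> R1 \<Longrightarrow> y \<in> R1 \<Longrightarrow> cons (x + y) P = cons x P + cons y P"
  "x \<in> R1 \<Longrightarrow> cons (scale c x) P = fscale c (cons x P)"
  by (simp_all add: cons_def)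

lemma cons_basis: "b \<in> B \<Longrightarrow> cons b (gen w) = gen (b # w)"
  by (simp add: cons_def coords_basis)

abbreviation T :: "('r list \<Rightarrow>\<^sub>0 'k) set"
  where "T \<equiv> free_on (lists B)"

definition Th :: "int \<Rightarrow> ('r list \<Rightarrow>\<^sub>0 'k) set"
  where "Th p = free_on {w \<in> lists B. degs w = p}"

lemma degs_simps [simp]: "degs [] = 0" "degs (x # w) = deg x + degs w" "degs (w @ w') = degs w + degs w'"
  by (simp_all add: degs_def)

lemma Th_T: "P \<in> Th p \<Longrightarrow> P \<in> T"
  unfolding Th_def by (rule free_on_mono[rotated]) auto

lemma Th_gen: "w \<in> lists B \<Longrightarrow> gen w \<in> Th (degs w)"
  by (simp add: Th_def)

lemma Th_closed [intro]:
  "0 \<in> Th p" "P \<in> Th p \<Longrightarrow> Q \<in> Th p \<Longrightarrow> P + Q \<in> Th p" "P \<in> Th p \<Longrightarrow> Q \<in> Th p \<Longrightarrow> P - Q \<in> Th p"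
  "P \<in> Th p \<Longrightarrow> fscale c P \<in> Th p" "P \<in> Th p \<Longrightarrow> - P \<in> Th p"
  "(\<And>i. i \<in> I \<Longrightarrow> F i \<in> Th p) \<Longrightarrow> (\<Sum>i\<in>I. F i) \<in> Th p"
  unfolding Th_def by auto

lemma cons_T: "P \<in> T \<Longrightarrow> cons x P \<in> T"
  unfolding cons_def by (intro lin_ext_closed[OF _ coords_closed] lin_ext_closed[where S = "lists B"]) auto

lemma cons_Th:
  assumes "x \<in> G i 1" "P \<in> Th p"
  shows "cons x P \<in> Th (i + p)"
  using assms(1)
proof (induction rule: G1_induct)
  case (basis b)
  show ?case
    using assms(2) unfolding Th_def
    by (rule flinear_closed[OF flinear_cons[OF flinear_id], rotated])
       (use basis in \<open>auto simp: cons_basis\<close>)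
qed (auto simp: G1_R1)

subsection \<open>Normal forms\<close>

text \<open>
  The image of a word in arbitrary letters under the isomorphism of \<open>T(R\<^sub>1)\<close> with the free space on the
  words in the basis.
\<close>

definition nf :: "('r list \<Rightarrow>\<^sub>0 'k) \<Rightarrow> ('r list \<Rightarrow>\<^sub>0 'k)"
  where "nf = lin_ext (\<lambda>xs. foldr cons xs (gen []))"

lemma flinear_nf: "flinear g \<Longrightarrow> flinear (\<lambda>P. nf (g P))"
  unfolding nf_def by (intro flinear_intros)

lemmas nf_vec [simp] = flinear_simps[OF flinear_nf[OF flinear_id]]

lemma flinear_prepend: "flinear g \<Longrightarrow> flinear (\<lambda>P. prepend x (g P))"
  unfolding prepend_def by (intro flinear_intros)

lemmas prepend_vec [simp] = flinear_simps[OF flinear_prepend[OF flinear_id]]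

lemma prepend_gen [simp]: "prepend x (gen w) = gen (x # w)"
  by (simp add: prepend_def)

lemma nf_gen [simp]: "nf (gen []) = gen []" "nf (gen (x # xs)) = cons x (nf (gen xs))"
  by (simp_all add: nf_def)

lemma nf_prepend [simp]: "nf (prepend x f) = cons x (nf f)"
  by (rule flinear_eqI[where f = "\<lambda>f. nf (prepend x f)" and g = "\<lambda>f. cons x (nf f)" and S = UNIV])
     (intro flinear_nf flinear_prepend flinear_cons flinear_id | simp)+

lemma nf_word: "w \<in> lists B \<Longrightarrow> nf (gen w) = gen w"
  by (induction w) (auto simp: cons_basis)

lemma nf_T: "P \<in> T \<Longrightarrow> nf P = P"
  by (rule flinear_eqI[OF flinear_nf[OF flinear_id] flinear_id, where S = "lists B"]) (simp_all add: nf_word)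

lemma nf_closed: "nf f \<in> T"
proof (rule flinear_closed[OF flinear_nf[OF flinear_id], where S = UNIV])
  show "nf (gen xs) \<in> T" for xs by (induction xs) (simp_all add: cons_T)
qed (rule free_on_UNIV)

lemma nf_Th: "list_all2 (\<lambda>x i. x \<in> G i 1) xs ns \<Longrightarrow> nf (gen xs) \<in> Th (sum_list ns)"
  by (induction rule: list_all2_induct) (simp_all add: cons_Th Th_gen[of "[]", simplified])

section \<open>The quasi-shuffle product on words\<close>

text \<open>
  The product \<open>m'\<close> of \<open>T(R\<^sub>1)\<close>, transported to combinations of basis words.
\<close>

definition msh :: "('r list \<Rightarrow>\<^sub>0 'k) \<Rightarrow> ('r list \<Rightarrow>\<^sub>0 'k) \<Rightarrow> ('r list \<Rightarrow>\<^sub>0 'k)"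
  where "msh P Q = lin_ext (\<lambda>u. lin_ext (\<lambda>v. nf (shuffle_hom t u v)) Q) P"

lemma flinear_msh_left: "flinear g \<Longrightarrow> flinear (\<lambda>P. msh (g P) Q)"
  and flinear_msh_right: "flinear g \<Longrightarrow> flinear (\<lambda>Q. msh P (g Q))"
  unfolding msh_def by (intro flinear_intros; assumption)+

lemmas flinears = flinear_intros flinear_cons flinear_nf flinear_prepend flinear_msh_left flinear_msh_right

lemmas msh_vec [simp] =
  flinear_simps[OF flinear_msh_left[OF flinear_id]] flinear_simps[OF flinear_msh_right[OF flinear_id]]

lemma msh_gen: "msh (gen u) (gen v) = nf (shuffle_hom t u v)"
  by (simp add: msh_def)

lemma msh_Nil_left: "Q \<in> T \<Longrightarrow> msh (gen []) Q = Q"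
  by (rule flinear_eqI[OF flinear_msh_right[OF flinear_id] flinear_id, where S = "lists B"])
     (simp_all add: msh_gen nf_word)

lemma msh_Nil_right: "P \<in> T \<Longrightarrow> msh P (gen []) = P"
proof (rule flinear_eqI[OF flinear_msh_left[OF flinear_id] flinear_id, where S = "lists B"])
  show "msh (gen w) (gen []) = gen w" if "w \<in> lists B" for w
    using that by (cases w) (simp_all add: msh_gen cons_basis nf_word)
qed

text \<open>
  The defining recursion of the product holds for arbitrary homogeneous first letters, because all
  basis elements in the expansion of a homogeneous letter have its degree.
\<close>

lemma msh_cons:
  assumes x: "x \<in> G i 1" and y: "y \<in> G j 1" and P: "P \<in> Th p" and Q: "Q \<in> T"
  shows "msh (cons x P) (cons y Q) =
    cons x (msh P (cons y Q))
    + fscale (sg ((i + p) * j)) (cons y (msh (cons x P) Q))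
    - fscale (sg (p * j)) (cons (x * y * tinv t) (cons t (msh P Q)))" (is "?l x y P Q = ?r x y P Q")
proof -
  have basis: "?l b c (gen u) (gen v) = ?r b c (gen u) (gen v)"
    if "b \<in> B" "deg b = i" "c \<in> B" "deg c = j" "degs u = p" for b c u v
    using that by (simp add: cons_basis msh_gen)
  have words: "?l b c P Q = ?r b c P Q" if "b \<in> B" "deg b = i" "c \<in> B" "deg c = j" for b c
  proof (rule fbilinear_eqI[where f = "?l b c" and g = "?r b c", OF _ _ _ _ _ P[unfolded Th_def] Q])
    show "?l b c (gen u) (gen v) = ?r b c (gen u) (gen v)" if "u \<in> {w \<in> lists B. degs w = p}" for u v
      by (rule basis) (use \<open>b \<in> B\<close> \<open>deg b = i\<close> \<open>c \<in> B\<close> \<open>deg c = j\<close> that in auto)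
  qed (intro flinears)+
  have "?l b y P Q = ?r b y P Q" if b: "b \<in> B" "deg b = i" for b
    using y
  proof (induction rule: G1_induct)
    case (add y y')
    have "b * y * tinv t \<in> R1" "b * y' * tinv t \<in> R1"
      using b add(1,2) by (auto intro: G1_R1 contraction_G B_deg)
    thus ?case using add(3,4) G1_R1[OF add(1)] G1_R1[OF add(2)]
      by (simp add: distrib_left distrib_right fs.scale_right_distrib)
  next
    case (scale c y)
    have "b * y * tinv t \<in> R1" using b scale(1) by (auto intro: G1_R1 contraction_G B_deg)
    thus ?case using scale(2) G1_R1[OF scale(1)]
      by (simp add: scale_mult_left scale_mult_right fs.scale_right_distrib
          fs.scale_right_diff_distrib mult.commute)
  qed (use words b in auto)
  with x show ?thesis
  proof (induction rule: G1_induct)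
    case (add x x')
    have "x * y * tinv t \<in> R1" "x' * y * tinv t \<in> R1"
      using y add(1,2) by (auto intro: G1_R1 contraction_G)
    thus ?case using add G1_R1[OF add(1)] G1_R1[OF add(2)]
      by (simp add: distrib_left distrib_right fs.scale_right_distrib)
  next
    case (scale c x)
    have "x * y * tinv t \<in> R1" using y scale(1) by (auto intro: G1_R1 contraction_G)
    thus ?case using scale(2,3) G1_R1[OF scale(1)]
      by (simp add: scale_mult_left scale_mult_right fs.scale_right_distrib
          fs.scale_right_diff_distrib mult.commute)
  qed auto
qed

lemma msh_word:
  assumes "x \<in> B" "y \<in> B" "u \<in> lists B" "v \<in> lists B"
  shows "msh (gen (x # u)) (gen (y # v)) =
    cons x (msh (gen u) (gen (y # v)))
    + fscale (sg ((deg x + degs u) * deg y)) (cons y (msh (gen (x # u)) (gen v)))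
    - fscale (sg (degs u * deg y)) (cons (x * y * tinv t) (cons t (msh (gen u) (gen v))))"
  using msh_cons[OF B_deg[OF assms(1)] B_deg[OF assms(2)] Th_gen[OF assms(3)], of "gen v"] assms
  by (simp add: cons_basis)

text \<open>
  Prepending \<open>t\<close> commutes with multiplication, so \<open>T(R\<^sub>1)\<close> is an algebra over \<open>k[t]\<close>: in the recursion for
  \<open>t P\<close> and \<open>y Q\<close> the letter of the third term is \<open>t y t\<^sup>-\<^sup>1 = y\<close>, so by induction this term cancels the second
  one.
\<close>

lemma msh_cons_t_left: "\<lbrakk>P \<in> T; Q \<in> T\<rbrakk> \<Longrightarrow> msh (cons t P) Q = cons t (msh P Q)"
proof (rule fbilinear_eqI[where f = "\<lambda>P Q. msh (cons t P) Q" and g = "\<lambda>P Q. cons t (msh P Q)"])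
  show "msh (cons t (gen u)) (gen v) = cons t (msh (gen u) (gen v))"
    if "u \<in> lists B" "v \<in> lists B" for u v
    using that(2)
  proof (induction v)
    case Nil
    thus ?case using that t_B by (simp add: msh_Nil_right cons_basis)
  next
    case (Cons y v)
    thus ?case using that t_B by (simp add: msh_word cons_basis)
  qed
qed (intro flinears | assumption)+

lemma msh_cons_t_right: "\<lbrakk>P \<in> T; Q \<in> T\<rbrakk> \<Longrightarrow> msh P (cons t Q) = cons t (msh P Q)"
proof (rule fbilinear_eqI[where f = "\<lambda>P Q. msh P (cons t Q)" and g = "\<lambda>P Q. cons t (msh P Q)"])
  show "msh (gen u) (cons t (gen v)) = cons t (msh (gen u) (gen v))"
    if "u \<in> lists B" "v \<in> lists B" for u v
    using that(1)
  proof (induction u)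
    case Nil
    thus ?case using that t_B by (simp add: msh_Nil_left cons_basis)
  next
    case (Cons x u)
    thus ?case using that t_B by (simp add: msh_word cons_basis)
  qed
qed (intro flinears | assumption)+

lemma msh_word_Th: "\<lbrakk>u \<in> lists B; v \<in> lists B\<rbrakk> \<Longrightarrow> msh (gen u) (gen v) \<in> Th (degs u + degs v)"
proof (induction "length u + length v" arbitrary: u v rule: less_induct)
  case less
  show ?case
  proof (cases "u = [] \<or> v = []")
    case True
    thus ?thesis using less.prems
      by (elim disjE) (simp_all add: msh_Nil_left msh_Nil_right Th_gen del: in_lists_conv_set)
  next
    case False
    then obtain x u' y v' where uv: "u = x # u'" "v = y # v'" by (meson list.exhaust)
    have mem: "x \<in> B" "u' \<in> lists B" "y \<in> B" "v' \<in> lists B" using less.prems uv by auto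
    have "msh (gen u') (gen v) \<in> Th (degs u' + degs v)" "msh (gen u) (gen v') \<in> Th (degs u + degs v')"
        "msh (gen u') (gen v') \<in> Th (degs u' + degs v')"
      by (rule less.hyps; use mem less.prems uv in auto)+
    hence "cons x (msh (gen u') (gen v)) \<in> Th (deg x + (degs u' + degs v))"
        "cons y (msh (gen u) (gen v')) \<in> Th (deg y + (degs u + degs v'))"
        "cons (x * y * tinv t) (cons t (msh (gen u') (gen v'))) \<in> Th ((deg x + deg y) + (0 + (degs u' + degs v')))"
      using mem by - (intro cons_Th contraction_G t_G B_deg; assumption)+
    thus ?thesis unfolding uv msh_word[OF mem(1,3,2,4)]
      by (intro Th_closed) (simp_all add: uv algebra_simps)
  qed
qed

lemma msh_T: "\<lbrakk>P \<in> T; Q \<in> T\<rbrakk> \<Longrightarrow> msh P Q \<in> T"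
  unfolding msh_def
  by (intro lin_ext_closed[where S = "lists B"] lin_ext_closed[where S = "lists B" and S' = "lists B"])
     (auto simp: nf_closed)

lemma msh_Th: "\<lbrakk>P \<in> Th p; Q \<in> Th q\<rbrakk> \<Longrightarrow> msh P Q \<in> Th (p + q)"
  unfolding msh_def Th_def
  by (intro lin_ext_closed[where S = "{w \<in> lists B. degs w = p}"] lin_ext_closed[where S = "{w \<in> lists B. degs w = q}"])
     (use msh_word_Th in \<open>auto simp: msh_gen Th_def\<close>)

text \<open>
  Both sides are expanded by the recursion into seven terms, which begin with the letters \<open>x\<close>, \<open>y\<close>, \<open>z\<close>,
  \<open>x y t\<^sup>-\<^sup>1\<close>, \<open>x z t\<^sup>-\<^sup>1\<close>, \<open>y z t\<^sup>-\<^sup>1\<close> and \<open>x y z t\<^sup>-\<^sup>2\<close>. Linearity over \<open>k[t]\<close> moves the letters \<open>t\<close> that come from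
  one product out of the other, and the terms agree in pairs by induction.
\<close>

lemma msh_assoc_word:
  "\<lbrakk>a \<in> lists B; b \<in> lists B; c \<in> lists B\<rbrakk> \<Longrightarrow>
    msh (msh (gen a) (gen b)) (gen c) = msh (gen a) (msh (gen b) (gen c))"
proof (induction "length a + length b + length c" arbitrary: a b c rule: less_induct)
  case less
  show ?case
  proof (cases "a = [] \<or> b = [] \<or> c = []")
    case True
    thus ?thesis using less.prems
      by (elim disjE) (simp_all add: msh_Nil_left msh_Nil_right msh_T del: in_lists_conv_set)
  next
    case False
    then obtain x u y v z w where abc: "a = x # u" "b = y # v" "c = z # w"
      by (meson list.exhaust)
    have mem: "x \<in> B" "y \<in> B" "z \<in> B" "u \<in> lists B" "v \<in> lists B" "w \<in> lists B"
      using less.prems abc by auto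
    note G = B_deg[OF mem(1)] B_deg[OF mem(2)] B_deg[OF mem(3)]
    define i j k p q r where deg: "i = deg x" "j = deg y" "k = deg z" "p = degs u" "q = degs v" "r = degs w"
    note xG = G[folded deg]
    have A: "gen a = cons x (gen u)" "gen b = cons y (gen v)" "gen c = cons z (gen w)"
      using mem by (simp_all add: abc cons_basis)
    have Tm: "gen u \<in> T" "gen v \<in> T" "gen w \<in> T" "gen a \<in> T" "gen b \<in> T" "gen c \<in> T"
      using mem less.prems by auto
    have H: "gen u \<in> Th p" "gen v \<in> Th q" "gen a \<in> Th (i + p)" "gen b \<in> Th (j + q)"
      using Th_gen[OF mem(4)] Th_gen[OF mem(5)] Th_gen[OF less.prems(1)] Th_gen[OF less.prems(2)]
      by (simp_all add: deg abc)
    \<comment> \<open>The products that occur in the expansions of \<open>a b\<close> and of \<open>b c\<close>.\<close>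
    define M1 M2 M3 where M: "M1 = msh (gen u) (gen b)" "M2 = msh (gen a) (gen v)" "M3 = msh (gen u) (gen v)"
    define N1 N2 N3 where N: "N1 = msh (gen v) (gen c)" "N2 = msh (gen b) (gen w)" "N3 = msh (gen v) (gen w)"
    have ab: "msh (gen a) (gen b) = cons x M1 + fscale (sg ((i + p) * j)) (cons y M2)
        - fscale (sg (p * j)) (cons (x * y * tinv t) (cons t M3))"
      using msh_cons[OF xG(1,2) H(1) Tm(2)] by (simp add: M A)
    have bc: "msh (gen b) (gen c) = cons y N1 + fscale (sg ((j + q) * k)) (cons z N2)
        - fscale (sg (q * k)) (cons (y * z * tinv t) (cons t N3))"
      using msh_cons[OF xG(2,3) H(2) Tm(3)] by (simp add: N A)
    have M_Th: "M1 \<in> Th (p + (j + q))" "M2 \<in> Th (i + p + q)" "cons t M3 \<in> Th (0 + (p + q))"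
      unfolding M by (intro cons_Th t_G msh_Th H)+
    have N_T: "N1 \<in> T" "N2 \<in> T" "N3 \<in> T" "cons t N3 \<in> T" "M3 \<in> T"
      unfolding N M by (intro cons_T msh_T Tm)+
    have IH1: "msh M1 (gen c) = msh (gen u) (msh (gen b) (gen c))"
      unfolding M by (rule less.hyps) (use mem less.prems abc in auto)
    have IH2: "msh M2 (gen c) = msh (gen a) N1"
      unfolding M N by (rule less.hyps) (use mem less.prems abc in auto)
    have IH3: "msh M3 (gen c) = msh (gen u) N1"
      unfolding M N by (rule less.hyps) (use mem less.prems abc in auto)
    have IH4: "msh (msh (gen a) (gen b)) (gen w) = msh (gen a) N2"
      unfolding M N by (rule less.hyps) (use mem less.prems abc in auto)
    have IH5: "msh M1 (gen w) = msh (gen u) N2"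
      unfolding M N by (rule less.hyps) (use mem less.prems abc in auto)
    have IH6: "msh M2 (gen w) = msh (gen a) N3"
      unfolding M N by (rule less.hyps) (use mem less.prems abc in auto)
    have IH7: "msh M3 (gen w) = msh (gen u) N3"
      unfolding M N by (rule less.hyps) (use mem less.prems abc in auto)
    have el: "x * (y * z * tinv t) * tinv t = x * y * tinv t * z * tinv t"
      by (metis mult.assoc tinv_central)
    \<comment> \<open>The three terms that begin with \<open>z\<close> are collected into the product of \<open>a b\<close> and \<open>w\<close>.\<close>
    have L: "msh (msh (gen a) (gen b)) (gen c)
        = cons x (msh M1 (gen c)) + fscale (sg ((i + p) * j)) (cons y (msh M2 (gen c)))
          - fscale (sg (p * j)) (cons (x * y * tinv t) (cons t (msh M3 (gen c))))
          + fscale (sg ((i + j + p + q) * k)) (cons z (msh (msh (gen a) (gen b)) (gen w)))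
          - fscale (sg ((p + j + q) * k)) (cons (x * z * tinv t) (cons t (msh M1 (gen w))))
          - fscale (sg ((i + p) * j) * sg ((i + p + q) * k)) (cons (y * z * tinv t) (cons t (msh M2 (gen w))))
          + fscale (sg (p * j) * sg ((p + q) * k))
              (cons (x * y * tinv t * z * tinv t) (cons t (cons t (msh M3 (gen w)))))"
      unfolding A(3) ab
      by (simp only: msh_vec msh_cons[OF xG(1,3) M_Th(1) Tm(3)] msh_cons[OF xG(2,3) M_Th(2) Tm(3)]
            msh_cons[OF contraction_G[OF xG(1,2)] xG(3) M_Th(3) Tm(3)]
            msh_cons_t_left[OF N_T(5) Tm(3)] msh_cons_t_left[OF N_T(5) Tm(6)[unfolded A(3)]])
         (simp add: fs.scale_right_distrib fs.scale_right_diff_distrib sg_simps algebra_simps)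
    have R: "msh (gen a) (msh (gen b) (gen c))
        = cons x (msh (gen u) (msh (gen b) (gen c))) + fscale (sg ((i + p) * j)) (cons y (msh (gen a) N1))
          - fscale (sg (p * j)) (cons (x * y * tinv t) (cons t (msh (gen u) N1)))
          + fscale (sg ((i + j + p + q) * k)) (cons z (msh (gen a) N2))
          - fscale (sg ((p + j + q) * k)) (cons (x * z * tinv t) (cons t (msh (gen u) N2)))
          - fscale (sg ((i + p) * j) * sg ((i + p + q) * k)) (cons (y * z * tinv t) (cons t (msh (gen a) N3)))
          + fscale (sg (p * j) * sg ((p + q) * k))
              (cons (x * y * tinv t * z * tinv t) (cons t (cons t (msh (gen u) N3))))"
      unfolding A(1) bc
      by (simp only: msh_vec msh_cons[OF xG(1,2) H(1) N_T(1)] msh_cons[OF xG(1,3) H(1) N_T(2)]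
            msh_cons[OF xG(1) contraction_G[OF xG(2,3)] H(1) N_T(4)]
            msh_cons_t_right[OF Tm(1) N_T(3)] msh_cons_t_right[OF Tm(4)[unfolded A(1)] N_T(3)] el)
         (simp add: fs.scale_right_distrib fs.scale_right_diff_distrib sg_simps algebra_simps)
    show ?thesis unfolding L R IH1 IH2 IH3 IH4 IH5 IH6 IH7 ..
  qed
qed

lemma msh_assoc:
  assumes "P \<in> T" "Q \<in> T" "Z \<in> T"
  shows "msh (msh P Q) Z = msh P (msh Q Z)" (is "?f P = ?g P")
proof (rule flinear_eqI[where f = ?f and g = ?g, OF _ _ _ assms(1)])
  fix a assume a: "a \<in> lists B"
  show "msh (msh (gen a) Q) Z = msh (gen a) (msh Q Z)" (is "?f Q Z = ?g Q Z")
    by (rule fbilinear_eqI[where f = ?f and g = ?g,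
          OF _ _ _ _ _ assms(2,3)])
       (intro flinears | rule msh_assoc_word a | assumption)+
qed (intro flinears)+

text \<open>
  The product is defined by expansion into arbitrary homogeneous letters. This lemma identifies the
  normal form of the result with the product of the normal forms.
\<close>

lemma msh_homogeneous:
  assumes "\<forall>x\<in>set xs. x \<noteq> 0 \<and> (\<exists>n. x \<in> G n 1)" "\<forall>y\<in>set ys. y \<noteq> 0 \<and> (\<exists>n. y \<in> G n 1)"
  shows "nf (shuffle_hom t xs ys) = msh (nf (gen xs)) (nf (gen ys))"
proof -
  have Th: "nf (gen zs) \<in> Th (degs zs)" if "\<forall>x\<in>set zs. x \<noteq> 0 \<and> (\<exists>n. x \<in> G n 1)" for zs
  proof -
    have "list_all2 (\<lambda>x i. x \<in> G i 1) zs (map deg zs)"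
      using that deg_eq by (fastforce simp: list.rel_map intro: list.rel_refl_strong)
    from nf_Th[OF this] show ?thesis by (simp add: degs_def)
  qed
  have "nf (shuffle_hom t' xs ys) = msh (nf (gen xs)) (nf (gen ys))" if "t' = t" for t'
    using that assms
  proof (induction t' xs ys rule: shuffle_hom.induct)
    case (1 t' ys)
    thus ?case by (simp add: msh_Nil_left nf_closed)
  next
    case (2 t' x xs)
    thus ?case by (simp add: msh_Nil_right cons_T nf_closed)
  next
    case (3 t' x xs y ys)
    have G: "x \<in> G (deg x) 1" "y \<in> G (deg y) 1"
      using "3.prems" deg_eq by auto
    have "nf (gen xs) \<in> Th (degs xs)" using "3.prems" by (intro Th) auto
    from msh_cons[OF G this nf_closed[of "gen ys"]] show ?case
      using "3.prems" "3.IH" by simp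
  qed
  thus ?thesis by simp
qed

section \<open>The differential on words\<close>

definition mdf :: "('r list \<Rightarrow>\<^sub>0 'k) \<Rightarrow> ('r list \<Rightarrow>\<^sub>0 'k)"
  where "mdf = lin_ext (\<lambda>w. nf (diff_hom w))"

text \<open>
  Multiplication of the first letter by \<open>a \<in> R\<^sub>0\<close>. With \<open>a = dx\<close> this is the part of the differential of
  \<open>x \<otimes> P\<close> that changes \<open>x\<close>. Tensors of length 0 are sent to 0, because the differential vanishes in
  length 1.
\<close>

definition lmul :: "'r \<Rightarrow> ('r list \<Rightarrow>\<^sub>0 'k) \<Rightarrow> ('r list \<Rightarrow>\<^sub>0 'k)"
  where "lmul a = lin_ext (\<lambda>w. case w of [] \<Rightarrow> 0 | b # w' \<Rightarrow> cons (a * b) (gen w'))"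

lemma flinear_mdf: "flinear g \<Longrightarrow> flinear (\<lambda>P. mdf (g P))"
  and flinear_lmul: "flinear g \<Longrightarrow> flinear (\<lambda>P. lmul a (g P))"
  unfolding mdf_def lmul_def by (intro flinear_intros; assumption)+

lemmas mdf_vec [simp] =
  flinear_simps[OF flinear_mdf[OF flinear_id]] flinear_simps[OF flinear_lmul[OF flinear_id]]

lemma lmul_Nil [simp]: "lmul a (gen []) = 0"
  by (simp add: lmul_def)

lemma lmul_gen: "lmul a (gen (b # w)) = cons (a * b) (gen w)"
  by (simp add: lmul_def)

lemma G0_mult: "\<lbrakk>a \<in> G n 0; x \<in> G i 1\<rbrakk> \<Longrightarrow> a * x \<in> G (n + i) 1"
  using G_mult[of a n 0 x i 1] by simp

lemma d_G0: "x \<in> G i 1 \<Longrightarrow> d x \<in> G (i + 1) 0"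
  using d_degree[of x i 1] by simp

lemma lmul_cons:
  assumes "a \<in> G n 0" "x \<in> G i 1"
  shows "lmul a (cons x P) = cons (a * x) P"
  using assms(2)
proof (induction rule: G1_induct)
  case (add x y)
  thus ?case using G1_R1[OF G0_mult[OF assms(1) add(1)]] G1_R1[OF G0_mult[OF assms(1) add(2)]]
    by (simp add: G1_R1 distrib_left)
next
  case (scale c x)
  thus ?case using G1_R1[OF G0_mult[OF assms(1) scale(1)]] by (simp add: G1_R1 scale_mult_right)
next
  case (basis b)
  show ?case
    by (rule flinear_eqI[where f = "\<lambda>P. lmul a (cons b P)" and g = "cons (a * b)" and S = UNIV])
       (intro flinear_lmul flinear_cons[OF flinear_id] | simp add: cons_basis basis lmul_gen)+
qed simp

lemma lmul_add:
  assumes "a \<in> G n 0" "a' \<in> G n 0" "P \<in> T"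
  shows "lmul (a + a') P = lmul a P + lmul a' P"
proof (rule flinear_eqI[where f = "lmul (a + a')" and g = "\<lambda>P. lmul a P + lmul a' P", OF _ _ _ assms(3)])
  fix w assume "w \<in> lists B"
  thus "lmul (a + a') (gen w) = lmul a (gen w) + lmul a' (gen w)"
    using G1_R1[OF G0_mult[OF assms(1) B_deg]] G1_R1[OF G0_mult[OF assms(2) B_deg]]
    by (cases w) (auto simp: lmul_gen distrib_right)
qed (intro flinear_lmul[OF flinear_id] flinear_plus)+

lemma lmul_scale:
  assumes "a \<in> G n 0" "P \<in> T"
  shows "lmul (scale c a) P = fscale c (lmul a P)"
proof (rule flinear_eqI[where f = "lmul (scale c a)" and g = "\<lambda>P. fscale c (lmul a P)", OF _ _ _ assms(2)])
  fix w assume "w \<in> lists B"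
  thus "lmul (scale c a) (gen w) = fscale c (lmul a (gen w))"
    using G1_R1[OF G0_mult[OF assms(1) B_deg]]
    by (cases w) (auto simp: lmul_gen scale_mult_left)
qed (intro flinear_lmul[OF flinear_id] flinear_fscale)+

lemma lmul_lmul:
  assumes "a \<in> G n 0" "a' \<in> G n' 0" "P \<in> T"
  shows "lmul a (lmul a' P) = lmul (a * a') P"
proof (rule flinear_eqI[where f = "\<lambda>P. lmul a (lmul a' P)" and g = "lmul (a * a')", OF _ _ _ assms(3)])
  fix w assume "w \<in> lists B"
  thus "lmul a (lmul a' (gen w)) = lmul (a * a') (gen w)"
    using lmul_cons[OF assms(1) G0_mult[OF assms(2) B_deg]]
    by (cases w) (auto simp: lmul_gen mult.assoc)
qed (intro flinear_lmul flinear_id)+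

lemma lmul_zero: "P \<in> T \<Longrightarrow> lmul 0 P = 0"
  using lmul_scale[OF G_zero, of P 0] by simp

text \<open>In this form the differential needs no distinction of cases according to the length.\<close>

lemma mdf_cons:
  assumes "x \<in> G i 1" "P \<in> T"
  shows "mdf (cons x P) = lmul (d x) P + fscale (sg i) (cons x (mdf P))"
  using assms(1)
proof (induction rule: G1_induct)
  case (add x y)
  thus ?case using lmul_add[OF d_G0[OF add(1)] d_G0[OF add(2)] assms(2)]
    by (simp add: G1_R1 d_simps fs.scale_right_distrib)
next
  case (scale c x)
  thus ?case using lmul_scale[OF d_G0[OF scale(1)] assms(2)]
    by (simp add: G1_R1 d_simps fs.scale_right_distrib mult.commute)
next
  case (basis b)
  show ?case
  proof (rule flinear_eqI[where f = "\<lambda>P. mdf (cons b P)"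
        and g = "\<lambda>P. lmul (d b) P + fscale (sg i) (cons b (mdf P))", OF _ _ _ assms(2)])
    fix w assume w: "w \<in> lists B"
    show "mdf (cons b (gen w)) = lmul (d b) (gen w) + fscale (sg i) (cons b (mdf (gen w)))"
      using w basis by (cases w) (simp_all add: mdf_def cons_basis lmul_gen nf_word)
  qed (intro flinear_lmul[OF flinear_id] flinear_plus flinear_fscale flinear_cons flinear_mdf flinear_id)+
qed (simp add: d_simps lmul_zero assms(2))

lemma mdf_Nil [simp]: "mdf (gen []) = 0"
  by (simp add: mdf_def)

lemma lmul_Th:
  assumes "a \<in> G n 0" "P \<in> Th p"
  shows "lmul a P \<in> Th (n + p)"
proof -
  have "lmul a (gen w) \<in> Th (n + p)" if w: "w \<in> {w \<in> lists B. degs w = p}" for w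
  proof (cases w)
    case (Cons b w')
    with w have "cons (a * b) (gen w') \<in> Th ((n + deg b) + degs w')"
      by (intro cons_Th G0_mult assms(1) Th_gen B_deg) auto
    thus ?thesis using w Cons by (auto simp: lmul_gen algebra_simps)
  qed auto
  from flinear_closed[OF flinear_lmul[OF flinear_id] this[unfolded Th_def] assms(2)[unfolded Th_def]]
  show ?thesis by (simp only: Th_def)
qed

lemma mdf_word_Th: "w \<in> lists B \<Longrightarrow> mdf (gen w) \<in> Th (degs w + 1)"
proof (induction w)
  case (Cons b w)
  hence b: "b \<in> B" "w \<in> lists B" by auto
  have "lmul (d b) (gen w) \<in> Th ((deg b + 1) + degs w)" "cons b (mdf (gen w)) \<in> Th (deg b + (degs w + 1))"
    using b Cons.IH by (auto intro!: lmul_Th cons_Th d_G0 B_deg Th_gen simp del: in_lists_conv_set)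
  thus ?case using mdf_cons[OF B_deg[OF b(1)], of "gen w"] b
    by (auto simp: cons_basis algebra_simps)
qed auto

lemma mdf_Th: "P \<in> Th p \<Longrightarrow> mdf P \<in> Th (p + 1)"
proof -
  assume P: "P \<in> Th p"
  have "mdf (gen w) \<in> Th (p + 1)" if "w \<in> {w \<in> lists B. degs w = p}" for w
    using mdf_word_Th[of w] that by auto
  from flinear_closed[OF flinear_mdf[OF flinear_id] this[unfolded Th_def] P[unfolded Th_def]]
  show ?thesis by (simp only: Th_def)
qed

lemma mdf_T: "P \<in> T \<Longrightarrow> mdf P \<in> T"
  by (rule flinear_closed[OF flinear_mdf[OF flinear_id]]) (auto intro: mdf_word_Th[THEN Th_T])

text \<open>
  Applied to the cycle \<open>a = dx\<close>, this is the cancellation behind \<open>D D = 0\<close>.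
\<close>

lemma mdf_lmul_closed:
  assumes a: "a \<in> G n 0" "d a = 0" and P: "P \<in> T"
  shows "mdf (lmul a P) = fscale (sg n) (lmul a (mdf P))" (is "?f P = ?g P")
proof (rule flinear_eqI[where f = ?f and g = ?g, OF _ _ _ P])
  fix w assume w: "w \<in> lists B"
  show "mdf (lmul a (gen w)) = fscale (sg n) (lmul a (mdf (gen w)))"
  proof (cases w)
    case (Cons b w')
    with w have b: "b \<in> B" "w' \<in> lists B" by auto
    note bG = B_deg[OF b(1)]
    have wT: "gen w' \<in> T" using b by simp
    have dab: "d (a * b) = scale (sg n) (a * d b)" using d_leibniz[OF a(1), of b] a(2) by simp
    have adb: "a * d b \<in> G (n + (deg b + 1)) 0" using G_mult[OF a(1) d_G0[OF bG]] by simp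
    have "mdf (lmul a (gen w)) = lmul (d (a * b)) (gen w') + fscale (sg (n + deg b)) (cons (a * b) (mdf (gen w')))"
      using mdf_cons[OF G0_mult[OF a(1) bG] wT] by (simp add: Cons lmul_gen)
    also have "\<dots> = fscale (sg n) (lmul a (lmul (d b) (gen w') + fscale (sg (deg b)) (cons b (mdf (gen w')))))"
      by (simp add: dab lmul_scale[OF adb wT] lmul_lmul[OF a(1) d_G0[OF bG] wT] lmul_cons[OF a(1) bG]
          sg_add fs.scale_right_distrib)
    also have "\<dots> = fscale (sg n) (lmul a (mdf (gen w)))"
      using mdf_cons[OF bG wT] b by (simp add: Cons cons_basis)
    finally show ?thesis .
  qed simp
qed (intro flinear_mdf flinear_lmul flinear_fscale flinear_id)+

lemma mdf_mdf:
  assumes "P \<in> T"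
  shows "mdf (mdf P) = 0"
proof (rule flinear_eqI[where f = "\<lambda>P. mdf (mdf P)" and g = "\<lambda>_. 0", OF _ _ _ assms])
  show "mdf (mdf (gen w)) = 0" if "w \<in> lists B" for w
    using that
  proof (induction w)
    case (Cons x w)
    hence x: "x \<in> B" "w \<in> lists B" and IH: "mdf (mdf (gen w)) = 0" by auto
    note xG = B_deg[OF x(1)]
    have wT: "gen w \<in> T" using x by simp
    have "mdf (gen (x # w)) = lmul (d x) (gen w) + fscale (sg (deg x)) (cons x (mdf (gen w)))"
      using mdf_cons[OF xG wT] x by (simp add: cons_basis)
    thus ?case
      by (simp add: mdf_lmul_closed[OF d_G0[OF xG] d_squared wT] mdf_cons[OF xG mdf_T[OF wT]] IH
          sg_add fs.scale_right_distrib)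
  qed simp
qed (intro flinear_mdf flinear_zero flinear_id)+

subsection \<open>The Leibniz rule\<close>

text \<open>
  In the product of \<open>P = x P'\<close> and \<open>y Q\<close> the letters in front are \<open>x\<close>, \<open>y\<close> and \<open>x y t\<^sup>-\<^sup>1\<close>. Multiplying \<open>x\<close> and
  \<open>x y t\<^sup>-\<^sup>1\<close> by \<open>a\<close> amounts to replacing \<open>P\<close> by \<open>a . P\<close>. The words with \<open>y\<close> in front have to be exchanged:
  \<open>y\<close> followed by the product of \<open>a . P\<close> and \<open>Q\<close> is subtracted, and \<open>a y\<close> followed by the product of \<open>P\<close> and
  \<open>Q\<close> is added.
\<close>

lemma lmul_msh_left:
  assumes a: "a \<in> G n 0" and y: "y \<in> G j 1" and P: "P \<in> Th p" and Q: "Q \<in> T"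
  shows "lmul a (msh P (cons y Q)) = msh (lmul a P) (cons y Q)
    - fscale (sg ((n + p) * j)) (cons y (msh (lmul a P) Q)) + fscale (sg (p * j)) (cons (a * y) (msh P Q))" (is "?f P = ?g P")
proof (rule flinear_eqI[where f = ?f and g = ?g,
    OF _ _ _ P[unfolded Th_def]])
  fix u assume u: "u \<in> {w \<in> lists B. degs w = p}"
  show "lmul a (msh (gen u) (cons y Q)) = msh (lmul a (gen u)) (cons y Q)
    - fscale (sg ((n + p) * j)) (cons y (msh (lmul a (gen u)) Q)) + fscale (sg (p * j)) (cons (a * y) (msh (gen u) Q))"
  proof (cases u)
    case Nil
    thus ?thesis using u Q by (auto simp: msh_Nil_left cons_T lmul_cons[OF a y])
  next
    case (Cons x u')
    hence x: "x \<in> B" "u' \<in> lists B" and p: "p = deg x + degs u'" using u by auto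
    note xG = B_deg[OF x(1)]
    have E: "gen u = cons x (gen u')" using x Cons by (simp add: cons_basis)
    show ?thesis unfolding E
      by (simp only: msh_cons[OF xG y Th_gen[OF x(2)] Q] msh_cons[OF G0_mult[OF a xG] y Th_gen[OF x(2)] Q]
          mdf_vec lmul_cons[OF a xG] lmul_cons[OF a y] lmul_cons[OF a contraction_G[OF xG y]] p)
         (simp add: algebra_simps)
  qed
qed (intro flinears flinear_lmul)+

text \<open>
  The counterpart for the second factor. Multiplying the letters in front of the product gives \<open>b x\<close> and
  \<open>b x y t\<^sup>-\<^sup>1\<close>, whereas multiplying the second factor gives \<open>x b y t\<^sup>-\<^sup>1\<close>; graded commutativity moves \<open>b\<close>
  past \<open>x\<close>.
\<close>

lemma lmul_msh_right:
  assumes comm: "graded_commutative"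
    and b: "b \<in> G n 0" and x: "x \<in> G i 1" and P: "P \<in> Th p" and Q: "Q \<in> T"
  shows "fscale (sg ((i + p) * n)) (lmul b (msh (cons x P) Q)) = msh (cons x P) (lmul b Q)
    - cons x (msh P (lmul b Q)) + fscale (sg (p * n)) (cons (x * b) (msh P Q))"
proof (rule flinear_eqI[where f = "\<lambda>Q. fscale (sg ((i + p) * n)) (lmul b (msh (cons x P) Q))"
    and g = "\<lambda>Q. msh (cons x P) (lmul b Q) - cons x (msh P (lmul b Q)) + fscale (sg (p * n)) (cons (x * b) (msh P Q))",
    OF _ _ _ Q])
  fix v assume v: "v \<in> lists B"
  have xb: "b * z = scale (sg (k * n)) (z * b)" if "z \<in> G k 1" for z k
    using comm b that unfolding graded_commutative_def by (metis mult.commute)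
  have xbR: "x * b \<in> G (i + n) 1" using G_mult[OF x b] by simp
  note xbR1 = G1_R1[OF xbR]
  show "fscale (sg ((i + p) * n)) (lmul b (msh (cons x P) (gen v))) = msh (cons x P) (lmul b (gen v))
    - cons x (msh P (lmul b (gen v))) + fscale (sg (p * n)) (cons (x * b) (msh P (gen v)))"
  proof (cases v)
    case Nil
    thus ?thesis
      using Th_T[OF P] xbR1 by (simp add: msh_Nil_right cons_T lmul_cons[OF b x] xb[OF x] sg_simps mult.commute)
  next
    case (Cons y v')
    hence y: "y \<in> B" "v' \<in> lists B" using v by auto
    note yG = B_deg[OF y(1)]
    have E: "gen v = cons y (gen v')" using y Cons by (simp add: cons_basis)
    have vT: "gen v' \<in> T" using y by simp
    have R: "x * b * y * tinv t \<in> R1" using contraction_G[OF xbR _, of y] G_mult[OF xbR G_mult[OF yG tinv_G]]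
      by (intro G1_R1[of _ "i + n + deg y"]) (simp add: mult.assoc)
    have e: "b * (x * y * tinv t) = scale (sg (i * n)) (x * b * y * tinv t)"
      by (simp add: xb[OF x] scale_mult_left flip: mult.assoc)
    have e': "x * (b * y) * tinv t = x * b * y * tinv t" by (simp add: mult.assoc)
    show ?thesis unfolding E
      by (simp only: msh_cons[OF x yG P vT] msh_cons[OF x G0_mult[OF b yG] P vT] mdf_vec
          lmul_cons[OF b x] lmul_cons[OF b yG] lmul_cons[OF b contraction_G[OF x yG]] e e' xb[OF x]
          cons_letter(3)[OF R] cons_letter(3)[OF xbR1])
         (simp add: fs.scale_right_distrib fs.scale_right_diff_distrib sg_simps algebra_simps)
  qed
qed (intro flinears flinear_lmul)+

text \<open>
  The terms \<open>dx y\<close> and \<open>x dy\<close> that are left over when \<open>dx\<close> and \<open>dy\<close> are moved into the factors cancel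
  against \<open>d (x y t\<^sup>-\<^sup>1) t\<close>; the other terms agree by induction.
\<close>

lemma mdf_msh_word:
  assumes comm: "graded_commutative"
  shows "\<lbrakk>a \<in> lists B; b \<in> lists B\<rbrakk> \<Longrightarrow> mdf (msh (gen a) (gen b)) =
    msh (mdf (gen a)) (gen b) + fscale (sg (degs a)) (msh (gen a) (mdf (gen b)))"
proof (induction "length a + length b" arbitrary: a b rule: less_induct)
  case less
  show ?case
  proof (cases "a = [] \<or> b = []")
    case True
    thus ?thesis using less.prems
      by (elim disjE) (simp_all add: msh_Nil_left msh_Nil_right mdf_T del: in_lists_conv_set)
  next
    case False
    then obtain x u y v where ab: "a = x # u" "b = y # v" by (meson list.exhaust)
    have mem: "x \<in> B" "y \<in> B" "u \<in> lists B" "v \<in> lists B" using less.prems ab by auto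
    define i j p where deg: "i = deg x" "j = deg y" "p = degs u"
    note xG = B_deg[OF mem(1), folded deg] and yG = B_deg[OF mem(2), folded deg]
    have A: "gen a = cons x (gen u)" "gen b = cons y (gen v)" using mem by (simp_all add: ab cons_basis)
    have Tm: "gen u \<in> T" "gen v \<in> T" "gen a \<in> T" "gen b \<in> T" using mem less.prems by auto
    have H: "gen u \<in> Th p" using Th_gen[OF mem(3)] by (simp add: deg)
    define M1 M2 M3 where M: "M1 = msh (gen u) (gen b)" "M2 = msh (gen a) (gen v)" "M3 = msh (gen u) (gen v)"
    have MT: "M1 \<in> T" "M2 \<in> T" "M3 \<in> T" "cons t M3 \<in> T" unfolding M by (intro cons_T msh_T Tm)+
    have IH1: "mdf M1 = msh (mdf (gen u)) (gen b) + fscale (sg p) (msh (gen u) (mdf (gen b)))"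
      unfolding M deg by (rule less.hyps) (use mem less.prems ab in auto)
    have IH2: "mdf M2 = msh (mdf (gen a)) (gen v) + fscale (sg (i + p)) (msh (gen a) (mdf (gen v)))"
      using less.hyps[of a v] mem less.prems by (simp add: M deg ab)
    have IH3: "mdf M3 = msh (mdf (gen u)) (gen v) + fscale (sg p) (msh (gen u) (mdf (gen v)))"
      unfolding M deg by (rule less.hyps) (use mem less.prems ab in auto)
    have msh_ab: "msh (gen a) (gen b) = cons x M1 + fscale (sg ((i + p) * j)) (cons y M2)
        - fscale (sg (p * j)) (cons (x * y * tinv t) (cons t M3))"
      using msh_cons[OF xG yG H Tm(2)] by (simp add: M A)
    have da: "mdf (gen a) = lmul (d x) (gen u) + fscale (sg i) (cons x (mdf (gen u)))"
      unfolding A by (rule mdf_cons[OF xG Tm(1)])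
    have db: "mdf (gen b) = lmul (d y) (gen v) + fscale (sg j) (cons y (mdf (gen v)))"
      unfolding A by (rule mdf_cons[OF yG Tm(2)])
    have dxy: "d x * y \<in> G (i + j + 1) 1" "x * d y \<in> G (i + j + 1) 1"
      using G_mult[OF d_G0[OF xG] yG] G_mult[OF xG d_G0[OF yG]] by (simp_all add: algebra_simps)
    have dt: "mdf (cons t M3) = cons t (mdf M3)"
      using mdf_cons[OF t_G MT(3)] lmul_zero[OF MT(3)] by simp
    have dc: "lmul (d (x * y * tinv t)) (cons t M3) = cons (d x * y) M3 + fscale (sg i) (cons (x * d y) M3)"
      using lmul_cons[OF d_G0[OF contraction_G[OF xG yG]] t_G, of M3] G1_R1[OF dxy(1)] G1_R1[OF dxy(2)]
      by (simp add: d_contraction[OF xG yG] distrib_right scale_mult_left)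
    have LA: "lmul (d x) M1 = msh (lmul (d x) (gen u)) (gen b)
        - fscale (sg ((i + 1 + p) * j)) (cons y (msh (lmul (d x) (gen u)) (gen v)))
        + fscale (sg (p * j)) (cons (d x * y) M3)"
      using lmul_msh_left[OF d_G0[OF xG] yG H Tm(2)] by (simp add: M A)
    \<comment> \<open>The sign on the left of the rule is its own inverse.\<close>
    have "fscale (sg ((i + p) * (j + 1))) (lmul (d y) M2) = msh (gen a) (lmul (d y) (gen v))
        - cons x (msh (gen u) (lmul (d y) (gen v))) + fscale (sg (p * (j + 1))) (cons (x * d y) M3)"
      using lmul_msh_right[OF comm d_G0[OF yG] xG H Tm(2)] by (simp add: M A)
    from arg_cong[OF this, of "fscale (sg ((i + p) * (j + 1)))"]
    have LB: "lmul (d y) M2 = fscale (sg ((i + p) * (j + 1))) (msh (gen a) (lmul (d y) (gen v))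
        - cons x (msh (gen u) (lmul (d y) (gen v))) + fscale (sg (p * (j + 1))) (cons (x * d y) M3))"
      by simp
    have L: "mdf (msh (gen a) (gen b)) = lmul (d x) M1 + fscale (sg i) (cons x (mdf M1))
        + fscale (sg ((i + p) * j)) (lmul (d y) M2 + fscale (sg j) (cons y (mdf M2)))
        - fscale (sg (p * j)) (cons (d x * y) M3 + fscale (sg i) (cons (x * d y) M3)
            + fscale (sg (i + j)) (cons (x * y * tinv t) (cons t (mdf M3))))"
      unfolding msh_ab
      by (simp only: mdf_vec mdf_cons[OF xG MT(1)] mdf_cons[OF yG MT(2)]
          mdf_cons[OF contraction_G[OF xG yG] MT(4)] dt dc)
    have R1: "msh (mdf (gen a)) (gen b) = msh (lmul (d x) (gen u)) (gen b)
        + fscale (sg i) (cons x (msh (mdf (gen u)) (gen b))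
          + fscale (sg ((i + (p + 1)) * j)) (cons y (msh (cons x (mdf (gen u))) (gen v)))
          - fscale (sg ((p + 1) * j)) (cons (x * y * tinv t) (cons t (msh (mdf (gen u)) (gen v)))))"
      unfolding da using msh_cons[OF xG yG mdf_Th[OF H] Tm(2)] by (simp add: A)
    have R2: "msh (gen a) (mdf (gen b)) = msh (gen a) (lmul (d y) (gen v))
        + fscale (sg j) (cons x (msh (gen u) (cons y (mdf (gen v))))
          + fscale (sg ((i + p) * j)) (cons y (msh (gen a) (mdf (gen v))))
          - fscale (sg (p * j)) (cons (x * y * tinv t) (cons t (msh (gen u) (mdf (gen v))))))"
      unfolding db using msh_cons[OF xG yG H mdf_T[OF Tm(2)]] by (simp add: A)
    have "degs a = i + p" by (simp add: ab deg)
    thus ?thesis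
      unfolding L R1 R2
      unfolding LA LB IH1 IH2 IH3 da db
      by (simp add: fs.scale_right_distrib fs.scale_right_diff_distrib sg_simps algebra_simps)
  qed
qed

lemma mdf_msh:
  assumes comm: "graded_commutative" and P: "P \<in> Th p" and Q: "Q \<in> T"
  shows "mdf (msh P Q) = msh (mdf P) Q + fscale (sg p) (msh P (mdf Q))"
proof (rule fbilinear_eqI[where f = "\<lambda>P Q. mdf (msh P Q)"
      and g = "\<lambda>P Q. msh (mdf P) Q + fscale (sg p) (msh P (mdf Q))", OF _ _ _ _ _ P[unfolded Th_def] Q])
  show "mdf (msh (gen a) (gen b)) = msh (mdf (gen a)) (gen b) + fscale (sg p) (msh (gen a) (mdf (gen b)))"
    if "a \<in> {w \<in> lists B. degs w = p}" "b \<in> lists B" for a b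
    using mdf_msh_word[OF comm, of a b] that by auto
qed (intro flinears flinear_mdf)+

section \<open>Deconcatenation\<close>

definition dec :: "('r list \<Rightarrow>\<^sub>0 'k) \<Rightarrow> ('r list \<times> 'r list \<Rightarrow>\<^sub>0 'k)"
  where "dec = lin_ext (\<lambda>w. \<Sum>j\<le>length w. gen (take j w, drop j w))"

definition T2h :: "int \<Rightarrow> ('r list \<times> 'r list \<Rightarrow>\<^sub>0 'k) set"
  where "T2h p = free_on {z \<in> lists B \<times> lists B. degs (fst z) + degs (snd z) = p}"

abbreviation T2 :: "('r list \<times> 'r list \<Rightarrow>\<^sub>0 'k) set"
  where "T2 \<equiv> free_on (lists B \<times> lists B)"

lemma T2h_T2: "Z \<in> T2h p \<Longrightarrow> Z \<in> T2"
  unfolding T2h_def by (rule free_on_mono[rotated]) auto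

lemma flinear_dec: "flinear g \<Longrightarrow> flinear (\<lambda>P. dec (g P))"
  unfolding dec_def by (intro flinear_intros)

lemmas dec_vec [simp] = flinear_simps[OF flinear_dec[OF flinear_id]]

lemma dec_gen: "dec (gen w) = (\<Sum>j\<le>length w. gen (take j w, drop j w))"
  by (simp add: dec_def)

lemma dec_Nil [simp]: "dec (gen []) = gen ([], [])"
  by (simp add: dec_gen)

lemma dec_word_T2h: "w \<in> lists B \<Longrightarrow> dec (gen w) \<in> T2h (degs w)"
proof -
  assume w: "w \<in> lists B"
  have "degs (take j w) + degs (drop j w) = degs w" for j
    by (metis append_take_drop_id degs_simps(3))
  thus ?thesis using w unfolding dec_gen T2h_def
    by (intro free_on_closed) (auto dest: in_set_takeD in_set_dropD)
qed

lemma dec_T2h: "P \<in> Th p \<Longrightarrow> dec P \<in> T2h p"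
proof -
  assume P: "P \<in> Th p"
  have "dec (gen w) \<in> T2h p" if "w \<in> {w \<in> lists B. degs w = p}" for w
    using dec_word_T2h[of w] that by auto
  from flinear_closed[OF flinear_dec[OF flinear_id] this[unfolded T2h_def] P[unfolded Th_def]]
  show ?thesis by (simp only: T2h_def)
qed

lemma dec_T2: "P \<in> T \<Longrightarrow> dec P \<in> T2"
  by (rule flinear_closed[OF flinear_dec[OF flinear_id]]) (auto intro: dec_word_T2h[THEN T2h_T2])

lemma dec_cons_R1:
  assumes "x \<in> R1"
  shows "dec (cons x P) = ftensor (gen []) (cons x P) + map_left (cons x) (dec P)"
  using assms
proof (induction rule: R1_induct)
  case (add x y)
  have eq: "map_left (cons (x + y)) Z = map_left (\<lambda>P. cons x P + cons y P) Z" for Z :: "'r list \<times> 'r list \<Rightarrow>\<^sub>0 'k"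
    by (rule map_left_cong[where S = UNIV and S' = UNIV]) (simp_all add: add(1,2))
  show ?case using add by (simp add: eq map_left_add)
next
  case (scale c x)
  have eq: "map_left (cons (scale c x)) Z = map_left (\<lambda>P. fscale c (cons x P)) Z" for Z :: "'r list \<times> 'r list \<Rightarrow>\<^sub>0 'k"
    by (rule map_left_cong[where S = UNIV and S' = UNIV]) (simp_all add: scale(1))
  show ?case using scale by (simp add: eq map_left_fscale fs.scale_right_distrib)
next
  case (basis b)
  show ?case
  proof (rule flinear_eqI[where f = "\<lambda>P. dec (cons b P)"
        and g = "\<lambda>P. ftensor (gen []) (cons b P) + map_left (cons b) (dec P)" and S = UNIV])
    fix w
    show "dec (cons b (gen w)) = ftensor (gen []) (cons b (gen w)) + map_left (cons b) (dec (gen w))"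
      unfolding cons_basis[OF basis(1)] dec_gen
      by (simp del: sum.atMost_Suc add: sum.atMost_Suc_shift map_left_gen cons_basis basis)
  qed (intro flinear_dec flinear_plus flinear_ftensor_right flinear_map_left flinear_cons flinear_id | simp)+
qed (simp add: map_left_def lin_ext_def)

lemmas dec_cons = dec_cons_R1[OF G1_R1]

text \<open>
  The projection onto the words that do not begin with \<open>t\<close>; its kernel consists of the elements of
  \<open>T(R\<^sub>1)\<close> that vanish in \<open>A\<close>.
\<close>

definition killt :: "('r list \<Rightarrow>\<^sub>0 'k) \<Rightarrow> ('r list \<Rightarrow>\<^sub>0 'k)"
  where "killt = lin_ext (\<lambda>w. if w \<noteq> [] \<and> hd w = t then 0 else gen w)"

lemma flinear_killt: "flinear g \<Longrightarrow> flinear (\<lambda>P. killt (g P))"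
  unfolding killt_def by (intro flinear_intros)

lemmas killt_vec [simp] = flinear_simps[OF flinear_killt[OF flinear_id]]

lemma killt_cons_t [simp]: "killt (cons t P) = 0"
proof (rule flinear_eqI[where f = "\<lambda>P. killt (cons t P)" and g = "\<lambda>_. 0" and S = UNIV])
  show "killt (cons t (gen w)) = 0" for w
    by (simp only: cons_basis[OF t_B]) (simp add: killt_def)
qed (intro flinear_killt flinear_cons flinear_zero flinear_id | simp)+

text \<open>
  The product of \<open>T(R\<^sub>1) \<otimes> T(R\<^sub>1)\<close> according to the Koszul sign rule.
\<close>

definition tmul ::
  "('r list \<times> 'r list \<Rightarrow>\<^sub>0 'k) \<Rightarrow> ('r list \<times> 'r list \<Rightarrow>\<^sub>0 'k) \<Rightarrow> ('r list \<times> 'r list \<Rightarrow>\<^sub>0 'k)"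
  where "tmul Z W = lin_ext (\<lambda>p. lin_ext (\<lambda>q. fscale (sg (degs (snd p) * degs (fst q)))
    (ftensor (msh (gen (fst p)) (gen (fst q))) (msh (gen (snd p)) (gen (snd q))))) W) Z"

lemma flinear_tmul_left: "flinear g \<Longrightarrow> flinear (\<lambda>Z. tmul (g Z) W)"
  and flinear_tmul_right: "flinear g \<Longrightarrow> flinear (\<lambda>W. tmul Z (g W))"
  unfolding tmul_def by (intro flinear_intros; assumption)+

lemmas tmul_vec [simp] =
  flinear_simps[OF flinear_tmul_left[OF flinear_id]] flinear_simps[OF flinear_tmul_right[OF flinear_id]]

lemmas flinears2 = flinears flinear_mdf flinear_lmul flinear_map_left flinear_map_right flinear_ftensor_left
  flinear_ftensor_right flinear_dec flinear_killt flinear_tmul_left flinear_tmul_right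

lemma tmul_gen: "tmul (gen (u1, u2)) (gen (v1, v2)) = fscale (sg (degs u2 * degs v1))
    (ftensor (msh (gen u1) (gen v1)) (msh (gen u2) (gen v2)))"
  by (simp add: tmul_def)

lemma tmul_ftensor:
  assumes "P2 \<in> Th p" "Q1 \<in> Th q"
  shows "tmul (ftensor P1 P2) (ftensor Q1 Q2) = fscale (sg (p * q)) (ftensor (msh P1 Q1) (msh P2 Q2))" (is "?f P1 Q2 = ?g P1 Q2")
proof (rule fbilinear_eqI[where f = ?f and g = ?g and S = UNIV and S' = UNIV])
  fix u1 v2
  show "tmul (ftensor (gen u1) P2) (ftensor Q1 (gen v2))
      = fscale (sg (p * q)) (ftensor (msh (gen u1) Q1) (msh P2 (gen v2)))"
  proof (rule fbilinear_eqI[where f = "\<lambda>P2 Q1. tmul (ftensor (gen u1) P2) (ftensor Q1 (gen v2))"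
      and g = "\<lambda>P2 Q1. fscale (sg (p * q)) (ftensor (msh (gen u1) Q1) (msh P2 (gen v2)))",
      OF _ _ _ _ _ assms[unfolded Th_def]])
    fix u2 v1 assume "u2 \<in> {w \<in> lists B. degs w = p}" "v1 \<in> {w \<in> lists B. degs w = q}"
    thus "tmul (ftensor (gen u1) (gen u2)) (ftensor (gen v1) (gen v2))
        = fscale (sg (p * q)) (ftensor (msh (gen u1) (gen v1)) (msh (gen u2) (gen v2)))"
      by (simp add: tmul_gen)
  qed (intro flinears2)+
qed (intro flinears2 | simp)+

lemma tmul_Nil_left:
  assumes "W \<in> T2"
  shows "tmul (gen ([], [])) W = W" (is "?f W = ?g W")
proof (rule flinear_eqI[where f = ?f and g = ?g, OF _ _ _ assms])
  fix q assume "q \<in> lists B \<times> lists B"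
  thus "tmul (gen ([], [])) (gen q) = gen q"
    by (cases q) (simp add: tmul_gen msh_Nil_left)
qed (intro flinears2)+

lemma tmul_Nil_right:
  assumes "W \<in> T2"
  shows "tmul W (gen ([], [])) = W"
proof (rule flinear_eqI[where f = "\<lambda>W. tmul W (gen ([], []))" and g = "\<lambda>W. W", OF _ _ _ assms])
  fix q assume "q \<in> lists B \<times> lists B"
  thus "tmul (gen q) (gen ([], [])) = gen q"
    by (cases q) (simp add: tmul_gen msh_Nil_right)
qed (intro flinears2)+

text \<open>
  Prepending letters to the left factors leaves the right factors alone, so the product of pairs obeys
  the recursion of the product of words. The degree in the signs is the total degree, because the
  right factor of \<open>Z\<close> also moves past \<open>y\<close>.
\<close>

lemma tmul_map_left:
  assumes x: "x \<in> G i 1" and y: "y \<in> G j 1" and Z: "Z \<in> T2h p" and W: "W \<in> T2"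
  shows "tmul (map_left (cons x) Z) (map_left (cons y) W) =
    map_left (cons x) (tmul Z (map_left (cons y) W))
    + fscale (sg ((i + p) * j)) (map_left (cons y) (tmul (map_left (cons x) Z) W))
    - fscale (sg (p * j)) (map_left (cons (x * y * tinv t)) (map_left (cons t) (tmul Z W)))" (is "?l Z W = ?r Z W")
proof (rule fbilinear_eqI[where f = ?l and g = ?r, OF _ _ _ _ _ Z[unfolded T2h_def] W])
  fix z w assume z: "z \<in> {z \<in> lists B \<times> lists B. degs (fst z) + degs (snd z) = p}" and w: "w \<in> lists B \<times> lists B"
  obtain u1 u2 v1 v2 where zw: "z = (u1, u2)" "w = (v1, v2)" by (cases z, cases w) blast
  have mem: "u1 \<in> lists B" "u2 \<in> lists B" "v1 \<in> lists B" "v2 \<in> lists B" and p: "p = degs u1 + degs u2"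
    using z w zw by auto
  have v1: "gen v1 \<in> T" using mem by simp
  note th = Th_gen[OF mem(1)] Th_gen[OF mem(2)] Th_gen[OF mem(3)]
  note lin = flinear_cons[OF flinear_id]
  have c: "tmul (ftensor P (gen u2)) (ftensor Q1 (gen v2))
      = fscale (sg (degs u2 * q)) (ftensor (msh P Q1) (msh (gen u2) (gen v2)))" if "Q1 \<in> Th q" for P Q1 q
    by (rule tmul_ftensor[OF th(2) that])
  have e: "gen (u1, u2) = ftensor (gen u1) (gen u2)" "gen (v1, v2) = ftensor (gen v1) (gen v2)" by simp_all
  show "?l (gen z) (gen w) = ?r (gen z) (gen w)"
    unfolding zw e
    by (simp only: map_left_ftensor[OF lin] c[OF cons_Th[OF y th(3)]] c[OF th(3)] map_left2_vec
          msh_cons[OF x y th(1) v1] ftensor_vec)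
       (simp add: p fs.scale_right_distrib fs.scale_right_diff_distrib sg_simps algebra_simps)
qed (intro flinears2)+

lemma tmul_T2: "Z \<in> T2 \<Longrightarrow> W \<in> T2 \<Longrightarrow> tmul Z W \<in> T2"
  unfolding tmul_def
  by (intro lin_ext_closed[where S = "lists B \<times> lists B"]
      lin_ext_closed[where S = "lists B \<times> lists B" and S' = "lists B \<times> lists B"])
     (auto intro!: free_on_closed(3) ftensor_closed msh_T)

text \<open>
  Cutting the words of a product in front gives the first term on each side, and the cuts behind
  the first letter are compared by induction. The only cut without a counterpart is that of
  \<open>(x y t\<^sup>-\<^sup>1) t P\<close> between \<open>x y t\<^sup>-\<^sup>1\<close> and \<open>t\<close>; its right factor begins with \<open>t\<close> and is killed.
\<close>

lemma dec_msh_word: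
  "\<lbrakk>a \<in> lists B; b \<in> lists B\<rbrakk> \<Longrightarrow>
    map_right killt (dec (msh (gen a) (gen b))) = map_right killt (tmul (dec (gen a)) (dec (gen b)))"
proof (induction "length a + length b" arbitrary: a b rule: less_induct)
  case less
  show ?case
  proof (cases "a = [] \<or> b = []")
    case True
    thus ?thesis using less.prems
      by (elim disjE) (simp_all add: msh_Nil_left msh_Nil_right tmul_Nil_left tmul_Nil_right dec_T2
          del: in_lists_conv_set)
  next
    case False
    then obtain x u y v where ab: "a = x # u" "b = y # v" by (meson list.exhaust)
    have mem: "x \<in> B" "y \<in> B" "u \<in> lists B" "v \<in> lists B" using less.prems ab by auto
    define i j p where deg: "i = deg x" "j = deg y" "p = degs u"
    note xG = B_deg[OF mem(1), folded deg] and yG = B_deg[OF mem(2), folded deg]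
    have A: "gen a = cons x (gen u)" "gen b = cons y (gen v)" using mem by (simp_all add: ab cons_basis)
    have Tm: "gen u \<in> T" "gen v \<in> T" "gen a \<in> T" "gen b \<in> T" using mem less.prems by auto
    have H: "gen u \<in> Th p" using Th_gen[OF mem(3)] by (simp add: deg)
    have Ha: "gen a \<in> Th (i + p)" using Th_gen[OF less.prems(1)] by (simp add: deg ab)
    note lin = flinear_cons[OF flinear_id] and klin = flinear_killt[OF flinear_id]
    let ?K = "map_right killt" and ?a = "gen a" and ?b = "gen b" and ?u = "gen u" and ?v = "gen v"
    have IH1: "?K (dec (msh ?u ?b)) = ?K (tmul (dec ?u) (dec ?b))"
      by (rule less.hyps) (use mem less.prems ab in auto)
    have IH2: "?K (dec (msh ?a ?v)) = ?K (tmul (dec ?a) (dec ?v))"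
      by (rule less.hyps) (use mem less.prems ab in auto)
    have IH3: "?K (dec (msh ?u ?v)) = ?K (tmul (dec ?u) (dec ?v))"
      by (rule less.hyps) (use mem less.prems ab in auto)
    have msh_ab: "msh ?a ?b = cons x (msh ?u ?b) + fscale (sg ((i + p) * j)) (cons y (msh ?a ?v))
        - fscale (sg (p * j)) (cons (x * y * tinv t) (cons t (msh ?u ?v)))"
      using msh_cons[OF xG yG H Tm(2)] by (simp add: A)
    have da: "dec ?a = ftensor (gen []) ?a + map_left (cons x) (dec ?u)"
      using dec_cons[OF xG] by (simp add: A)
    have db: "dec ?b = ftensor (gen []) ?b + map_left (cons y) (dec ?v)"
      using dec_cons[OF yG] by (simp add: A)
    have Kt: "?K (ftensor P (cons t Q)) = 0" for P Q
      by (simp add: map_right_ftensor[OF klin])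
    have "dec (msh ?a ?b) = ftensor (gen []) (msh ?a ?b) + map_left (cons x) (dec (msh ?u ?b))
        + fscale (sg ((i + p) * j)) (map_left (cons y) (dec (msh ?a ?v)))
        - fscale (sg (p * j)) (map_left (cons (x * y * tinv t))
            (ftensor (gen []) (cons t (msh ?u ?v)) + map_left (cons t) (dec (msh ?u ?v))))"
      unfolding msh_ab
      by (simp only: dec_vec dec_cons[OF xG] dec_cons[OF yG] dec_cons[OF contraction_G[OF xG yG]]
            dec_cons[OF t_G])
         (simp add: fs.scale_right_distrib fs.scale_right_diff_distrib algebra_simps)
    hence L: "?K (dec (msh ?a ?b)) = ?K (ftensor (gen []) (msh ?a ?b))
        + map_left (cons x) (?K (dec (msh ?u ?b)))
        + fscale (sg ((i + p) * j)) (map_left (cons y) (?K (dec (msh ?a ?v))))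
        - fscale (sg (p * j)) (map_left (cons (x * y * tinv t)) (map_left (cons t) (?K (dec (msh ?u ?v)))))"
      by (simp add: map_right_map_left[OF lin klin] Kt)
    have t1: "tmul (ftensor (gen []) ?a) (ftensor (gen []) ?b) = ftensor (gen []) (msh ?a ?b)"
      using tmul_ftensor[OF Ha Th_gen[of "[]"], of "gen []" ?b] by (simp add: msh_Nil_left)
    have t2: "tmul (ftensor (gen []) ?a) (map_left (cons y) W)
        = fscale (sg ((i + p) * j)) (map_left (cons y) (tmul (ftensor (gen []) ?a) W))" if "W \<in> T2" for W
    proof (rule flinear_eqI[where f = "\<lambda>W. tmul (ftensor (gen []) ?a) (map_left (cons y) W)"
        and g = "\<lambda>W. fscale (sg ((i + p) * j)) (map_left (cons y) (tmul (ftensor (gen []) ?a) W))", OF _ _ _ that])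
      fix w assume "w \<in> lists B \<times> lists B"
      then obtain v1 v2 where w: "w = (v1, v2)" "v1 \<in> lists B" "v2 \<in> lists B" by auto
      have "cons y (gen v1) \<in> T" "gen v1 \<in> T" using w by (auto intro: cons_T)
      thus "tmul (ftensor (gen []) ?a) (map_left (cons y) (gen w))
          = fscale (sg ((i + p) * j)) (map_left (cons y) (tmul (ftensor (gen []) ?a) (gen w)))"
        using tmul_ftensor[OF Ha cons_Th[OF yG Th_gen[OF w(2)]], of "gen []" "gen v2"]
          tmul_ftensor[OF Ha Th_gen[OF w(2)], of "gen []" "gen v2"]
        by (simp add: w(1) map_left_gen map_left_ftensor[OF lin] msh_Nil_left sg_simps)
    qed (intro flinears2)+
    have t3: "tmul (map_left (cons x) Z) (ftensor (gen []) ?b)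
        = map_left (cons x) (tmul Z (ftensor (gen []) ?b))" if "Z \<in> T2" for Z
    proof (rule flinear_eqI[where f = "\<lambda>Z. tmul (map_left (cons x) Z) (ftensor (gen []) ?b)"
        and g = "\<lambda>Z. map_left (cons x) (tmul Z (ftensor (gen []) ?b))", OF _ _ _ that])
      fix w assume "w \<in> lists B \<times> lists B"
      then obtain u1 u2 where w: "w = (u1, u2)" "u1 \<in> lists B" "u2 \<in> lists B" by auto
      have "cons x (gen u1) \<in> T" "gen u1 \<in> T" using w by (auto intro: cons_T)
      thus "tmul (map_left (cons x) (gen w)) (ftensor (gen []) ?b)
          = map_left (cons x) (tmul (gen w) (ftensor (gen []) ?b))"
        using tmul_ftensor[OF Th_gen[OF w(3)] Th_gen[of "[]"], of "cons x (gen u1)" ?b]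
          tmul_ftensor[OF Th_gen[OF w(3)] Th_gen[of "[]"], of "gen u1" ?b]
        by (simp add: w(1) map_left_gen map_left_ftensor[OF lin] msh_Nil_right)
    qed (intro flinears2)+
    note t4 = tmul_map_left[OF xG yG dec_T2h[OF H] dec_T2[OF Tm(2)]]
    have R: "tmul (dec ?a) (dec ?b) = ftensor (gen []) (msh ?a ?b)
        + map_left (cons x) (tmul (dec ?u) (dec ?b))
        + fscale (sg ((i + p) * j)) (map_left (cons y) (tmul (dec ?a) (dec ?v)))
        - fscale (sg (p * j)) (map_left (cons (x * y * tinv t)) (map_left (cons t) (tmul (dec ?u) (dec ?v))))"
      unfolding da db
      by (simp only: tmul_vec t1 t2[OF dec_T2[OF Tm(2)]] t3[OF dec_T2[OF Tm(1)]] t4 map_left2_vec)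
         (simp add: fs.scale_right_distrib algebra_simps)
    show ?thesis unfolding L R IH1 IH2 IH3
      by (simp add: map_right_map_left[OF lin klin])
  qed
qed

lemma dec_msh:
  assumes "P \<in> T" "Q \<in> T"
  shows "map_right killt (dec (msh P Q)) = map_right killt (tmul (dec P) (dec Q))"
  by (rule fbilinear_eqI[where f = "\<lambda>P Q. map_right killt (dec (msh P Q))"
        and g = "\<lambda>P Q. map_right killt (tmul (dec P) (dec Q))", OF _ _ _ _ _ assms])
     (intro flinears2 | rule dec_msh_word | assumption)+

subsection \<open>The differential is a coderivation\<close>

text \<open>
  The map \<open>id \<otimes> D\<close>, with the sign that arises when \<open>D\<close> moves past the left factor.
\<close>

definition signed_mdf2 :: "('r list \<times> 'r list \<Rightarrow>\<^sub>0 'k) \<Rightarrow> ('r list \<times> 'r list \<Rightarrow>\<^sub>0 'k)"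
  where "signed_mdf2 = lin_ext (\<lambda>p. fscale (sg (degs (fst p))) (ftensor (gen (fst p)) (mdf (gen (snd p)))))"

lemma flinear_signed_mdf2: "flinear g \<Longrightarrow> flinear (\<lambda>Z. signed_mdf2 (g Z))"
  unfolding signed_mdf2_def by (intro flinear_intros)

lemmas signed_mdf2_vec [simp] = flinear_simps[OF flinear_signed_mdf2[OF flinear_id]]

lemma signed_mdf2_ftensor:
  assumes "P \<in> Th p"
  shows "signed_mdf2 (ftensor P Q) = fscale (sg p) (ftensor P (mdf Q))"
  by (rule fbilinear_eqI[where f = "\<lambda>P Q. signed_mdf2 (ftensor P Q)"
        and g = "\<lambda>P Q. fscale (sg p) (ftensor P (mdf Q))" and S' = UNIV, OF _ _ _ _ _ assms[unfolded Th_def]])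
     (intro flinears2 flinear_signed_mdf2 | simp add: signed_mdf2_def)+

text \<open>
  The first letter is multiplied by \<open>a\<close> in the left factor of each cut, except for the cut in front,
  where the left factor is empty.
\<close>

lemma dec_lmul:
  assumes "a \<in> G n 0" "P \<in> T"
  shows "dec (lmul a P) = ftensor (gen []) (lmul a P) + map_left (lmul a) (dec P)" (is "?f P = ?g P")
proof (rule flinear_eqI[where f = ?f and g = ?g, OF _ _ _ assms(2)])
  fix w assume w: "w \<in> lists B"
  show "dec (lmul a (gen w)) = ftensor (gen []) (lmul a (gen w)) + map_left (lmul a) (dec (gen w))"
  proof (cases w)
    case (Cons b w')
    with w have b: "b \<in> B" by auto
    note bG = B_deg[OF b]
    have E: "gen w = cons b (gen w')" using b Cons by (simp add: cons_basis)
    have "map_left (lmul a) (map_left (cons b) Z) = map_left (cons (a * b)) Z" for Z :: "'r list \<times> 'r list \<Rightarrow>\<^sub>0 'k"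
      by (simp add: map_left_map_left[OF flinear_lmul[OF flinear_id]] lmul_cons[OF assms(1) bG])
    thus ?thesis unfolding E
      by (simp add: lmul_cons[OF assms(1) bG] dec_cons[OF bG] dec_cons[OF G0_mult[OF assms(1) bG]]
          map_left_ftensor[OF flinear_lmul[OF flinear_id]] del: ftensor_gen)
  qed (simp add: map_left_gen)
qed (intro flinears2)+

text \<open>No cut separates two letters that the differential has multiplied.\<close>

lemma dec_mdf:
  assumes "P \<in> T"
  shows "dec (mdf P) = map_left mdf (dec P) + signed_mdf2 (dec P)" (is "?f P = ?g P")
proof (rule flinear_eqI[where f = ?f and g = ?g, OF _ _ _ assms])
  show "dec (mdf (gen w)) = map_left mdf (dec (gen w)) + signed_mdf2 (dec (gen w))" if "w \<in> lists B" for w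
    using that
  proof (induction w)
    case (Cons x w)
    hence x: "x \<in> B" "w \<in> lists B"
      and IH: "dec (mdf (gen w)) = map_left mdf (dec (gen w)) + signed_mdf2 (dec (gen w))" by auto
    note xG = B_deg[OF x(1)]
    have wT: "gen w \<in> T" using x by simp
    have E: "gen (x # w) = cons x (gen w)" using x by (simp add: cons_basis)
    have m: "map_left mdf (map_left (cons x) Z) = map_left (lmul (d x)) Z + fscale (sg (deg x)) (map_left (cons x) (map_left mdf Z))"
      if "Z \<in> T2" for Z
    proof -
      have "map_left mdf (map_left (cons x) Z) = map_left (\<lambda>P. lmul (d x) P + fscale (sg (deg x)) (cons x (mdf P))) Z"
        unfolding map_left_map_left[OF flinear_mdf[OF flinear_id]]
        by (rule map_left_cong[OF that]) (simp add: mdf_cons[OF xG])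
      thus ?thesis by (simp add: map_left_add map_left_fscale map_left_map_left[OF flinear_cons[OF flinear_id]])
    qed
    have s: "signed_mdf2 (map_left (cons x) Z) = fscale (sg (deg x)) (map_left (cons x) (signed_mdf2 Z))" (is "?f Z = ?g Z")
      if "Z \<in> T2" for Z
    proof (rule flinear_eqI[where f = ?f and g = ?g, OF _ _ _ that])
      fix z assume "z \<in> lists B \<times> lists B"
      then obtain u v where z: "z = (u, v)" "u \<in> lists B" by auto
      show "signed_mdf2 (map_left (cons x) (gen z)) = fscale (sg (deg x)) (map_left (cons x) (signed_mdf2 (gen z)))"
        using signed_mdf2_ftensor[OF cons_Th[OF xG Th_gen[OF z(2)]], of "gen v"]
          signed_mdf2_ftensor[OF Th_gen[OF z(2)], of "gen v"]
        by (simp add: z(1) map_left_gen map_left_ftensor[OF flinear_cons[OF flinear_id]] sg_simps)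
    qed (intro flinears2 flinear_signed_mdf2)+
    show ?case unfolding E
      by (simp add: mdf_cons[OF xG wT] dec_lmul[OF d_G0[OF xG] wT] dec_cons[OF xG] IH
          map_left_ftensor[OF flinear_mdf[OF flinear_id]] m[OF dec_T2[OF wT]] s[OF dec_T2[OF wT]]
          signed_mdf2_ftensor[OF Th_gen[of "[]"], simplified] fs.scale_right_distrib algebra_simps
          del: ftensor_gen)
  qed (simp add: map_left_gen signed_mdf2_def)
qed (intro flinears2 flinear_signed_mdf2)+

section \<open>The antipode on words\<close>

text \<open>
  Product and coproduct respect tensor length, and the part of length 0 is spanned by the unit, so the
  antipode is determined by recursion on the length.
\<close>

function antipode_word :: "'r list \<Rightarrow> ('r list \<Rightarrow>\<^sub>0 'k)" where
  "antipode_word w = (if w = [] then gen [] else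
    - (\<Sum>j<length w. msh (antipode_word (take j w)) (gen (drop j w))))"
  by auto
termination by (relation "measure length") auto

declare antipode_word.simps [simp del]

lemma antipode_word_Nil [simp]: "antipode_word [] = gen []"
  by (simp add: antipode_word.simps)

definition antip :: "('r list \<Rightarrow>\<^sub>0 'k) \<Rightarrow> ('r list \<Rightarrow>\<^sub>0 'k)"
  where "antip = lin_ext antipode_word"

lemma flinear_antip: "flinear g \<Longrightarrow> flinear (\<lambda>P. antip (g P))"
  unfolding antip_def by (intro flinear_intros)

lemmas antip_vec [simp] = flinear_simps[OF flinear_antip[OF flinear_id]]

lemma antip_gen [simp]: "antip (gen w) = antipode_word w"
  by (simp add: antip_def)

lemma take_drop_lists: "w \<in> lists B \<Longrightarrow> take j w \<in> lists B \<and> drop j w \<in> lists B"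
  by (auto dest: in_set_takeD in_set_dropD)

lemma antipode_word_Th: "w \<in> lists B \<Longrightarrow> antipode_word w \<in> Th (degs w)"
proof (induction w rule: length_induct)
  case (1 w)
  have "msh (antipode_word (take j w)) (gen (drop j w)) \<in> Th (degs w)" if "j < length w" for j
  proof -
    have "msh (antipode_word (take j w)) (gen (drop j w)) \<in> Th (degs (take j w) + degs (drop j w))"
      using 1 that take_drop_lists[of w j] by (intro msh_Th Th_gen) auto
    thus ?thesis by (metis append_take_drop_id degs_simps(3))
  qed
  moreover have "gen [] \<in> Th 0" using Th_gen[of "[]"] by simp
  ultimately show ?case by (subst antipode_word.simps) auto
qed

lemma antip_Th: "P \<in> Th p \<Longrightarrow> antip P \<in> Th p"
proof -
  assume P: "P \<in> Th p"
  have "antip (gen w) \<in> Th p" if "w \<in> {w \<in> lists B. degs w = p}" for w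
    using antipode_word_Th[of w] that by auto
  from flinear_closed[OF flinear_antip[OF flinear_id] this[unfolded Th_def] P[unfolded Th_def]]
  show ?thesis by (simp only: Th_def)
qed

lemma antipode_word_T: "w \<in> lists B \<Longrightarrow> antipode_word w \<in> T"
  by (rule Th_T[OF antipode_word_Th])

lemma antip_T: "P \<in> T \<Longrightarrow> antip P \<in> T"
  by (rule flinear_closed[OF flinear_antip[OF flinear_id]]) (auto intro: antipode_word_T)

lemma antipode_word_left:
  assumes "w \<in> lists B"
  shows "(\<Sum>j\<le>length w. msh (antipode_word (take j w)) (gen (drop j w))) = (if w = [] then gen [] else 0)"
proof (cases "w = []")
  case False
  have "(\<Sum>j\<le>length w. msh (antipode_word (take j w)) (gen (drop j w)))
      = (\<Sum>j<length w. msh (antipode_word (take j w)) (gen (drop j w))) + antipode_word w"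
    using antipode_word_T[OF assms] by (simp add: msh_Nil_right flip: lessThan_Suc_atMost)
  also have "\<dots> = 0" using False by (subst (2) antipode_word.simps) simp
  finally show ?thesis using False by simp
qed (simp add: msh_Nil_left)

text \<open>
  The left inverse \<open>S\<close> of the identity under convolution is also a right inverse: the defect \<open>r\<close> of
  \<open>id * S\<close> satisfies \<open>S * r = S * id * S = S\<close>, which determines it by recursion on the length.
\<close>

lemma antipode_word_right:
  "w \<in> lists B \<Longrightarrow>
    (\<Sum>j\<le>length w. msh (gen (take j w)) (antipode_word (drop j w))) = (if w = [] then gen [] else 0)"
proof (induction w rule: length_induct)
  case (1 w)
  define S where "S = antipode_word"
  define r where "r v = (\<Sum>j\<le>length v. msh (gen (take j v)) (S (drop j v)))" for v
  note td = take_drop_lists[OF 1(2)]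
  have tT: "gen (take j w) \<in> T" "gen (drop j w) \<in> T" "S (take j w) \<in> T" "S (drop j w) \<in> T" for j
    using td[of j] unfolding S_def by (auto intro: antipode_word_T simp del: in_lists_conv_set)
  show ?case
  proof (cases "w = []")
    case True
    thus ?thesis by (simp add: msh_Nil_left)
  next
    case False
    let ?n = "length w"
    let ?F = "\<lambda>j i. msh (S (take j w)) (msh (gen (take i (drop j w))) (S (drop (j + i) w)))"
    let ?H = "\<lambda>m j. msh (msh (S (take j (take m w))) (gen (drop j (take m w)))) (S (drop m w))"
    have r0: "r (drop j w) = 0" if "0 < j" "j < ?n" for j
    proof -
      have "r (drop j w) = (if drop j w = [] then gen [] else 0)"
        unfolding r_def S_def by (rule 1(1)[rule_format]) (use that td[of j] in auto)
      thus ?thesis using that by simp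
    qed
    \<comment> \<open>By induction \<open>S * r\<close> reduces to the two extreme cuts.\<close>
    have "(\<Sum>j\<le>?n. msh (S (take j w)) (r (drop j w)))
        = (\<Sum>j\<in>{0, ?n}. msh (S (take j w)) (r (drop j w)))"
      by (rule sum.mono_neutral_right) (use r0 in \<open>auto intro!: r0\<close>)
    also have "\<dots> = r w + S w"
    proof -
      have "r w \<in> T" "S w \<in> T"
        unfolding r_def using tT tT(3)[of ?n] by (auto intro!: msh_T free_on_closed(6))
      moreover have "r [] = gen []" by (simp add: r_def S_def msh_Nil_left)
      moreover have "S [] = gen []" by (simp add: S_def)
      ultimately show ?thesis using False by (simp add: msh_Nil_left msh_Nil_right)
    qed
    finally have lhs: "(\<Sum>j\<le>?n. msh (S (take j w)) (r (drop j w))) = r w + S w" .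
    \<comment> \<open>On the other hand \<open>S * (id * S) = (S * id) * S = S\<close>, where \<open>m\<close> is the position of the second cut.\<close>
    have "(\<Sum>j\<le>?n. msh (S (take j w)) (r (drop j w))) = (\<Sum>j\<le>?n. \<Sum>i\<le>?n - j. ?F j i)"
      by (simp add: r_def add.commute)
    also have "\<dots> = (\<Sum>(j, i)\<in>{(j, i). j + i \<le> ?n}. ?F j i)"
      by (subst sum.Sigma) (auto intro!: sum.cong)
    also have "\<dots> = (\<Sum>m\<le>?n. \<Sum>j\<le>m. ?F j (m - j))"
      by (rule sum.triangle_reindex_eq)
    also have "\<dots> = (\<Sum>m\<le>?n. \<Sum>j\<le>m. ?H m j)"
    proof (intro sum.cong refl)
      fix m j assume "m \<in> {..?n}" "j \<in> {..m}"
      hence "take j w = take j (take m w)" "take (m - j) (drop j w) = drop j (take m w)" "j + (m - j) = m"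
        by (simp_all add: drop_take min_def)
      moreover have "S (take j (take m w)) \<in> T" "gen (drop j (take m w)) \<in> T"
        using td[of m] take_drop_lists[of "take m w" j] unfolding S_def
        by (auto intro: antipode_word_T simp del: in_lists_conv_set)
      ultimately show "?F j (m - j) = ?H m j"
        using tT(4)[of m] by (simp add: msh_assoc)
    qed
    also have "\<dots> = (\<Sum>m\<le>?n. msh (\<Sum>j\<le>length (take m w). msh (S (take j (take m w))) (gen (drop j (take m w)))) (S (drop m w)))"
      by (intro sum.cong refl) (simp add: min_def)
    also have "\<dots> = (\<Sum>m\<le>?n. if m = 0 then S w else 0)"
    proof (intro sum.cong refl)
      fix m assume "m \<in> {..?n}"
      show "msh (\<Sum>j\<le>length (take m w). msh (S (take j (take m w))) (gen (drop j (take m w)))) (S (drop m w))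
          = (if m = 0 then S w else 0)"
        unfolding S_def using td[of m] False antipode_word_T[OF 1(2)]
        by (subst antipode_word_left) (auto simp: msh_Nil_left)
    qed
    also have "\<dots> = S w" by simp
    finally have "r w = 0" using lhs by simp
    thus ?thesis using False by (simp add: r_def S_def)
  qed
qed

text \<open>
  Words that begin with \<open>t\<close> span an ideal, so the recursion stays inside it and the antipode descends
  to \<open>A\<close>.
\<close>

lemma antipode_word_t: "w \<in> lists B \<Longrightarrow> \<exists>Q\<in>T. antipode_word (t # w) = cons t Q"
proof (induction w rule: length_induct)
  case (1 w)
  have "\<exists>Q\<in>T. msh (antipode_word (take j (t # w))) (gen (drop j (t # w))) = cons t Q" if j: "j < length (t # w)" for j
  proof (cases j)
    case 0
    have "msh (gen []) (gen (t # w)) = cons t (gen w)"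
      using 1(2) t_B by (simp add: msh_Nil_left cons_basis)
    thus ?thesis using 0 1(2) by (intro bexI[of _ "gen w"]) auto
  next
    case (Suc i)
    have "\<exists>Q\<in>T. antipode_word (t # take i w) = cons t Q"
      using 1 Suc j take_drop_lists[OF 1(2), of i] by auto
    then obtain Q where Q: "Q \<in> T" "antipode_word (t # take i w) = cons t Q" by blast
    have "gen (drop i w) \<in> T" using take_drop_lists[OF 1(2), of i] by simp
    with Q Suc show ?thesis
      by (intro bexI[of _ "msh Q (gen (drop i w))"]) (simp_all add: msh_cons_t_left msh_T)
  qed
  then obtain Q where Q: "\<And>j. j < length (t # w) \<Longrightarrow> Q j \<in> T"
      "\<And>j. j < length (t # w) \<Longrightarrow> msh (antipode_word (take j (t # w))) (gen (drop j (t # w))) = cons t (Q j)"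
    by metis
  have "antipode_word (t # w) = - (\<Sum>j<length (t # w). cons t (Q j))"
    by (subst antipode_word.simps) (simp only: list.distinct if_False, intro arg_cong[where f = uminus] sum.cong refl Q(2), simp)
  thus ?case using Q(1) by (intro bexI[of _ "- (\<Sum>j<length (t # w). Q j)"]) (auto simp del: sum.lessThan_Suc)
qed

text \<open>
  If \<open>*\<close> denotes convolution, then \<open>conv_id h (dec P)\<close> is \<open>(h * id) P\<close>.
\<close>

definition conv_id :: "(('r list \<Rightarrow>\<^sub>0 'k) \<Rightarrow> ('r list \<Rightarrow>\<^sub>0 'k)) \<Rightarrow> ('r list \<times> 'r list \<Rightarrow>\<^sub>0 'k) \<Rightarrow> ('r list \<Rightarrow>\<^sub>0 'k)"
  where "conv_id h = lin_ext (\<lambda>p. msh (h (gen (fst p))) (gen (snd p)))"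

lemma flinear_conv_id: "flinear g \<Longrightarrow> flinear (\<lambda>Z. conv_id h (g Z))"
  unfolding conv_id_def by (intro flinear_intros)

lemmas conv_id_vec [simp] = flinear_simps[OF flinear_conv_id[OF flinear_id]]

lemma conv_id_ftensor:
  assumes "flinear h"
  shows "conv_id h (ftensor P Q) = msh (h P) Q" (is "?f P Q = ?g P Q")
  by (rule fbilinear_eqI[where f = ?f and g = ?g
        and S = UNIV and S' = UNIV])
     (intro flinears2 flinear_conv_id assms | simp add: conv_id_def)+

lemma conv_id_dec: "conv_id h (dec (gen w)) = (\<Sum>j\<le>length w. msh (h (gen (take j w))) (gen (drop j w)))"
  by (simp add: dec_gen conv_id_def)

lemma lookup_cons_Nil: "Poly_Mapping.lookup (cons x P) [] = 0"
proof -
  have "cons x P \<in> free_on (- {[]})"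
    unfolding cons_def
    by (intro lin_ext_closed[where S = UNIV] lin_ext_closed[where S = UNIV and S' = "- {[]}"]) auto
  thus ?thesis by (auto simp: free_on_iff_lookup)
qed

lemma conv_id_antip:
  assumes "P \<in> T"
  shows "conv_id antip (dec P) = fscale (Poly_Mapping.lookup P []) (gen [])" (is "?f P = ?g P")
proof (rule flinear_eqI[where f = ?f and g = ?g, OF _ _ _ assms])
  show "flinear (\<lambda>P :: 'r list \<Rightarrow>\<^sub>0 'k. fscale (Poly_Mapping.lookup P []) (gen [] :: 'r list \<Rightarrow>\<^sub>0 'k))"
    by (rule flinearI) (simp_all add: lookup_add fs.scale_left_distrib)
  show "conv_id antip (dec (gen w)) = fscale (Poly_Mapping.lookup (gen w) []) (gen [])" if "w \<in> lists B" for w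
    using antipode_word_left[OF that] by (auto simp: conv_id_dec lookup_single)
qed (intro flinears2 flinear_conv_id)

lemma lookup_mdf_Nil: "P \<in> T \<Longrightarrow> Poly_Mapping.lookup (mdf P) [] = 0"
proof -
  assume P: "P \<in> T"
  have "mdf (gen w) \<in> free_on (- {[]})" if "w \<in> lists B" for w
  proof (cases w)
    case (Cons x w')
    hence x: "x \<in> B" "w' \<in> lists B" using that by auto
    have c: "cons y Q \<in> free_on (- {[]})" for y Q
      unfolding cons_def
      by (intro lin_ext_closed[where S = UNIV] lin_ext_closed[where S = UNIV and S' = "- {[]}"]) auto
    have "lmul (d x) (gen w') \<in> free_on (- {[]})"
      by (cases w') (auto simp: lmul_gen c)
    thus ?thesis using mdf_cons[OF B_deg[OF x(1)], of "gen w'"] x Cons c by (auto simp: cons_basis)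
  qed simp
  from flinear_closed[OF flinear_mdf[OF flinear_id] this P] show ?thesis
    by (auto simp: free_on_iff_lookup)
qed

text \<open>
  The commutator \<open>E\<close> of the differential and the antipode satisfies \<open>E * id = 0\<close>, since both
  \<open>S * id\<close> and \<open>id\<close> commute with the differential; hence \<open>E = 0\<close>, by induction on the length.
\<close>

lemma mdf_antipode_word:
  assumes comm: "graded_commutative"
  shows "w \<in> lists B \<Longrightarrow> mdf (antipode_word w) = antip (mdf (gen w))"
proof (induction w rule: length_induct)
  case (1 w)
  define E where "E P = mdf (antip P) - antip (mdf P)" for P
  have E_lin: "flinear E" unfolding E_def by (intro flinears2 flinear_antip)
  have wT: "gen w \<in> T" using 1 by simp
  \<comment> \<open>The contribution in which \<open>D\<close> acts on the second factor of the convolution; it is the same on both sides.\<close>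
  define X1 where "X1 = lin_ext (\<lambda>p. fscale (sg (degs (fst p))) (msh (antip (gen (fst p))) (mdf (gen (snd p)))))"
  have X1_lin: "flinear (\<lambda>Z. X1 (g Z))" if "flinear g" for g :: "('r list \<times> 'r list \<Rightarrow>\<^sub>0 'k) \<Rightarrow> _"
    unfolding X1_def by (intro flinears2 that)
  have a: "mdf (conv_id antip Z) = conv_id (\<lambda>P. mdf (antip P)) Z + X1 Z" (is "?f Z = ?g Z") if "Z \<in> T2" for Z
  proof (rule flinear_eqI[where f = ?f and g = ?g, OF _ _ _ that])
    fix z assume "z \<in> lists B \<times> lists B"
    then obtain u v where z: "z = (u, v)" "u \<in> lists B" "v \<in> lists B" by auto
    show "mdf (conv_id antip (gen z)) = conv_id (\<lambda>P. mdf (antip P)) (gen z) + X1 (gen z)"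
      using mdf_msh[OF comm antipode_word_Th[OF z(2)], of "gen v"] z
      by (simp add: conv_id_def X1_def)
  qed (intro flinears2 flinear_conv_id X1_lin)+
  have b: "conv_id antip (map_left mdf Z + signed_mdf2 Z) = conv_id (\<lambda>P. antip (mdf P)) Z + X1 Z" (is "?f Z = ?g Z") for Z
  proof (rule flinear_eqI[where f = ?f and g = ?g and S = UNIV])
    fix z :: "'r list \<times> 'r list"
    obtain u v where z: "z = (u, v)" by (cases z)
    show "conv_id antip (map_left mdf (gen z) + signed_mdf2 (gen z)) = conv_id (\<lambda>P. antip (mdf P)) (gen z) + X1 (gen z)"
      by (simp add: z map_left_gen signed_mdf2_def conv_id_ftensor[OF flinear_antip[OF flinear_id]] X1_def)
         (simp add: conv_id_def)
  qed (intro flinears2 flinear_conv_id flinear_signed_mdf2 X1_lin | simp)+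
  have c: "conv_id E Z = conv_id (\<lambda>P. mdf (antip P)) Z - conv_id (\<lambda>P. antip (mdf P)) Z" for Z
    by (simp add: conv_id_def E_def lin_ext_def fs.scale_right_diff_distrib sum_subtractf)
  have "mdf (conv_id antip (dec (gen w))) = 0"
    by (simp add: conv_id_antip[OF wT])
  moreover have "conv_id antip (dec (mdf (gen w))) = 0"
    by (simp add: conv_id_antip[OF mdf_T[OF wT]] lookup_mdf_Nil[OF wT])
  ultimately have "conv_id (\<lambda>P. mdf (antip P)) (dec (gen w)) + X1 (dec (gen w))
      = conv_id (\<lambda>P. antip (mdf P)) (dec (gen w)) + X1 (dec (gen w))"
    unfolding a[OF dec_T2[OF wT], symmetric] b[of "dec (gen w)", symmetric] dec_mdf[OF wT, symmetric]
    by simp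
  hence "conv_id E (dec (gen w)) = 0" by (simp add: c)
  hence "(\<Sum>j\<le>length w. msh (E (gen (take j w))) (gen (drop j w))) = 0"
    by (simp add: conv_id_dec)
  moreover have "(\<Sum>j\<le>length w. msh (E (gen (take j w))) (gen (drop j w)))
      = (\<Sum>j\<in>{length w}. msh (E (gen (take j w))) (gen (drop j w)))"
  proof (rule sum.mono_neutral_right)
    show "\<forall>j\<in>{..length w} - {length w}. msh (E (gen (take j w))) (gen (drop j w)) = 0"
    proof
      fix j assume "j \<in> {..length w} - {length w}"
      hence "E (gen (take j w)) = 0"
        unfolding E_def using 1 take_drop_lists[OF 1(2), of j] by auto
      thus "msh (E (gen (take j w))) (gen (drop j w)) = 0" by simp
    qed
  qed auto
  moreover have "E (gen w) \<in> T"
    unfolding E_def by (intro free_on_closed mdf_T antip_T wT)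
  ultimately have "E (gen w) = 0" by (simp add: msh_Nil_right)
  thus ?case by (simp add: E_def)
qed

lemma mdf_antip:
  assumes "graded_commutative" "P \<in> T"
  shows "mdf (antip P) = antip (mdf P)"
  by (rule flinear_eqI[where f = "\<lambda>P. mdf (antip P)" and g = "\<lambda>P. antip (mdf P)", OF _ _ _ assms(2)])
     (intro flinears2 flinear_antip | simp add: mdf_antipode_word[OF assms(1)])+

section \<open>The quotient in terms of words\<close>

abbreviation F1 :: "('r list \<Rightarrow>\<^sub>0 'k) set"
  where "F1 \<equiv> free_on (lists R1)"

lemma T_F1: "P \<in> T \<Longrightarrow> P \<in> F1"
  by (rule free_on_mono[rotated]) (auto intro: B_R1)

subsection \<open>The relations\<close>

definition additive_gens :: "('r list \<Rightarrow>\<^sub>0 'k) set"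
  where "additive_gens =
    {gen (xs @ (x + y) # zs) - gen (xs @ x # zs) - gen (xs @ y # zs) | xs x y zs.
       set xs \<subseteq> R1 \<and> x \<in> R1 \<and> y \<in> R1 \<and> set zs \<subseteq> R1}"

definition scaling_gens :: "('r list \<Rightarrow>\<^sub>0 'k) set"
  where "scaling_gens =
    {gen (xs @ scale c x # zs) - fscale c (gen (xs @ x # zs)) | c xs x zs.
       set xs \<subseteq> R1 \<and> x \<in> R1 \<and> set zs \<subseteq> R1}"

definition line_gens :: "('r list \<Rightarrow>\<^sub>0 'k) set"
  where "line_gens =
    {gen (x # zs) - gen (y # zs) | x y zs. x \<in> R1 \<and> y \<in> R1 \<and> x - y \<in> L \<and> set zs \<subseteq> R1}"

lemma additive_gensI:
  "\<lbrakk>set xs \<subseteq> R1; x \<in> R1; y \<in> R1; set zs \<subseteq> R1\<rbrakk> \<Longrightarrow>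
    gen (xs @ (x + y) # zs) - gen (xs @ x # zs) - gen (xs @ y # zs) \<in> additive_gens"
  unfolding additive_gens_def by blast

lemma scaling_gensI:
  "\<lbrakk>set xs \<subseteq> R1; x \<in> R1; set zs \<subseteq> R1\<rbrakk> \<Longrightarrow>
    gen (xs @ scale c x # zs) - fscale c (gen (xs @ x # zs)) \<in> scaling_gens"
  unfolding scaling_gens_def by blast

lemma line_gensI:
  "\<lbrakk>x \<in> R1; y \<in> R1; x - y \<in> L; set zs \<subseteq> R1\<rbrakk> \<Longrightarrow> gen (x # zs) - gen (y # zs) \<in> line_gens"
  unfolding line_gens_def by blast

lemma Aphi_rel_eq: "Aphi_rel = fspan (additive_gens \<union> scaling_gens \<union> line_gens)"
  unfolding Aphi_rel_def additive_gens_def scaling_gens_def line_gens_def ..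

text \<open>
  The defining relations of the tensor algebra. Unlike the relation for the Tate line, which concerns
  the first letter only, they are preserved by prepending a letter.
\<close>

definition multilin_rel :: "('r list \<Rightarrow>\<^sub>0 'k) set"
  where "multilin_rel = fspan (additive_gens \<union> scaling_gens)"

lemma multilin_le_Aphi_rel: "multilin_rel \<subseteq> Aphi_rel"
  unfolding multilin_rel_def Aphi_rel_eq fspan_def by (intro fs.span_mono) blast

lemma subspace_Aphi_rel: "fs.subspace Aphi_rel"
  by (simp add: Aphi_rel_def subspace_fspan)

lemma subspace_multilin_rel: "fs.subspace multilin_rel"
  by (simp add: multilin_rel_def subspace_fspan)

text \<open>The Tate line is one-dimensional and contains \<open>t\<close>.\<close>

lemma L_span: "x \<in> L \<Longrightarrow> \<exists>c. x = scale c t"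
proof -
  assume x: "x \<in> L"
  obtain C where C: "C \<subseteq> L" "L \<subseteq> span C" "card C = dim L"
    by (rule basis_exists[of L]) blast
  then obtain b where "C = {b}" using L_dim by (metis card_1_singletonE)
  hence "x \<in> range (\<lambda>k. scale k b)" "t \<in> range (\<lambda>k. scale k b)"
    using C(2) x t_L by (auto simp: span_singleton)
  then obtain c c' where c: "x = scale c b" "t = scale c' b" by blast
  hence "c' \<noteq> 0" using t_nz by auto
  hence "x = scale (c / c') t" using c by simp
  thus ?thesis by blast
qed

lemma nf_append: "nf (gen (xs @ zs)) = foldr cons xs (nf (gen zs))"
  by (induction xs) simp_all

lemma foldr_cons_flinear: "flinear (foldr cons xs)"
proof (induction xs)
  case (Cons x xs)
  from flinear_cons[OF this] show ?case by simp
qed (simp add: flinear_id id_def)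

text \<open>
  The coordinates in the basis are multilinear, and replacing the first letter \<open>x\<close> by \<open>x + c t\<close> adds
  words that begin with \<open>t\<close>.
\<close>

lemma Aphi_rel_killt:
  assumes "f \<in> Aphi_rel"
  shows "f \<in> F1 \<and> killt (nf f) = 0"
proof -
  have sub: "fs.subspace {f \<in> F1. killt (nf f) = 0}"
    by (rule fs.subspaceI) auto
  note vec = flinear_simps[OF foldr_cons_flinear]
  show ?thesis
    using assms unfolding Aphi_rel_eq fspan_def
  proof (rule fs.span_induct[OF _ sub])
    fix g assume "g \<in> additive_gens \<union> scaling_gens \<union> line_gens"
    thus "g \<in> F1 \<and> killt (nf g) = 0"
    proof (elim UnE)
      assume "g \<in> additive_gens"
      then obtain xs x y zs where "set xs \<subseteq> R1" "x \<in> R1" "y \<in> R1" "set zs \<subseteq> R1"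
          "g = gen (xs @ (x + y) # zs) - gen (xs @ x # zs) - gen (xs @ y # zs)"
        unfolding additive_gens_def by blast
      thus ?thesis by (auto simp: nf_append vec intro!: free_on_closed)
    next
      assume "g \<in> scaling_gens"
      then obtain xs x c zs where "set xs \<subseteq> R1" "x \<in> R1" "set zs \<subseteq> R1"
          "g = gen (xs @ scale c x # zs) - fscale c (gen (xs @ x # zs))"
        unfolding scaling_gens_def by blast
      thus ?thesis by (auto simp: nf_append vec intro!: free_on_closed)
    next
      assume "g \<in> line_gens"
      then obtain x y zs where line: "x \<in> R1" "y \<in> R1" "x - y \<in> L" "set zs \<subseteq> R1"
          "g = gen (x # zs) - gen (y # zs)"
        unfolding line_gens_def by blast
      obtain c where c: "x - y = scale c t" using L_span[OF line(3)] by blast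
      hence "x = y + scale c t" by (simp add: algebra_simps)
      hence "cons x (nf (gen zs)) = cons y (nf (gen zs)) + fscale c (cons t (nf (gen zs)))"
        using line(2) B_R1[OF t_B] by simp
      thus ?thesis using line by (auto intro!: free_on_closed)
    qed
  qed
qed

lemma prepend_multilin_rel:
  assumes "x \<in> R1" "f \<in> multilin_rel"
  shows "prepend x f \<in> multilin_rel"
proof -
  have sub: "fs.subspace {f. prepend x f \<in> multilin_rel}"
    by (rule fs.subspaceI)
       (auto intro: fs.subspace_0 fs.subspace_add fs.subspace_scale subspace_multilin_rel)
  show ?thesis
    using assms(2) unfolding multilin_rel_def fspan_def
  proof (rule fs.span_induct[OF _ sub[unfolded multilin_rel_def fspan_def]])
    fix g assume "g \<in> additive_gens \<union> scaling_gens"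
    hence "prepend x g \<in> additive_gens \<union> scaling_gens"
    proof (elim UnE)
      assume "g \<in> additive_gens"
      then obtain xs y z zs where g: "set xs \<subseteq> R1" "y \<in> R1" "z \<in> R1" "set zs \<subseteq> R1"
          "g = gen (xs @ (y + z) # zs) - gen (xs @ y # zs) - gen (xs @ z # zs)"
        unfolding additive_gens_def by blast
      thus ?thesis using additive_gensI[of "x # xs" y z zs] assms(1) by simp
    next
      assume "g \<in> scaling_gens"
      then obtain xs y c zs where "set xs \<subseteq> R1" "y \<in> R1" "set zs \<subseteq> R1"
          "g = gen (xs @ scale c y # zs) - fscale c (gen (xs @ y # zs))"
        unfolding scaling_gens_def by blast
      thus ?thesis using scaling_gensI[of "x # xs" y zs c] assms(1) by simp
    qed
    thus "prepend x g \<in> fs.span (additive_gens \<union> scaling_gens)" by (rule fs.span_base)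
  qed
qed

lemma multilin_cons:
  assumes "x \<in> R1" "P \<in> T"
  shows "prepend x P - cons x P \<in> multilin_rel"
  using assms(2)
proof (induction rule: free_on_induct)
  case (add f g)
  thus ?case using fs.subspace_add[OF subspace_multilin_rel add(3,4)] by (simp add: algebra_simps)
next
  case (scale c f)
  thus ?case using fs.subspace_scale[OF subspace_multilin_rel scale(2), of c]
    by (simp add: fs.scale_right_diff_distrib)
next
  case (gen w)
  hence w: "set w \<subseteq> R1" using B_R1 by auto
  have rel: "g \<in> multilin_rel" if "g \<in> additive_gens \<union> scaling_gens" for g
    using that unfolding multilin_rel_def fspan_def by (rule fs.span_base)
  have radd: "gen ((y + z) # w) - gen (y # w) - gen (z # w) \<in> multilin_rel" if "y \<in> R1" "z \<in> R1" for y z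
    using additive_gensI[of "[]" y z w] w that by (intro rel) simp
  have rscale: "gen (scale c y # w) - fscale c (gen (y # w)) \<in> multilin_rel" if "y \<in> R1" for c y
    using scaling_gensI[of "[]" y w c] w that by (intro rel) simp
  have sub: "subspace {x \<in> R1. gen (x # w) - cons x (gen w) \<in> multilin_rel}"
  proof (rule subspaceI)
    have "gen (scale 0 0 # w) - fscale 0 (gen (0 # w)) \<in> multilin_rel" by (rule rscale) simp
    thus "0 \<in> {x \<in> R1. gen (x # w) - cons x (gen w) \<in> multilin_rel}" by simp
  next
    fix y z assume "y \<in> {x \<in> R1. gen (x # w) - cons x (gen w) \<in> multilin_rel}"
      "z \<in> {x \<in> R1. gen (x # w) - cons x (gen w) \<in> multilin_rel}"
    hence yz: "y \<in> R1" "z \<in> R1" "gen (y # w) - cons y (gen w) \<in> multilin_rel"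
      "gen (z # w) - cons z (gen w) \<in> multilin_rel" by auto
    from fs.subspace_add[OF subspace_multilin_rel radd[OF yz(1,2)]
        fs.subspace_add[OF subspace_multilin_rel yz(3,4)]]
    show "y + z \<in> {x \<in> R1. gen (x # w) - cons x (gen w) \<in> multilin_rel}"
      using yz(1,2) by (simp add: algebra_simps)
  next
    fix c y assume "y \<in> {x \<in> R1. gen (x # w) - cons x (gen w) \<in> multilin_rel}"
    hence y: "y \<in> R1" "gen (y # w) - cons y (gen w) \<in> multilin_rel" by auto
    from fs.subspace_add[OF subspace_multilin_rel rscale[OF y(1), of c]
        fs.subspace_scale[OF subspace_multilin_rel y(2), of c]]
    show "scale c y \<in> {x \<in> R1. gen (x # w) - cons x (gen w) \<in> multilin_rel}"
      using y(1) by (simp add: fs.scale_right_diff_distrib)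
  qed
  have "x \<in> R1 \<and> gen (x # w) - cons x (gen w) \<in> multilin_rel"
    using assms(1)[unfolded R1_eq] sub
    by (rule span_induct) (simp add: B_R1 cons_basis fs.subspace_0[OF subspace_multilin_rel])
  thus ?case by simp
qed (simp add: fs.subspace_0[OF subspace_multilin_rel])

text \<open>
  Expanding the letters of a word in the basis one after the other uses only multilinearity.
\<close>

lemma nf_multilin:
  assumes "f \<in> F1"
  shows "f - nf f \<in> multilin_rel"
  using assms
proof (induction rule: free_on_induct)
  case (add f g)
  thus ?case using fs.subspace_add[OF subspace_multilin_rel add(3,4)] by (simp add: algebra_simps)
next
  case (scale c f)
  thus ?case using fs.subspace_scale[OF subspace_multilin_rel scale(2), of c]
    by (simp add: fs.scale_right_diff_distrib)
next
  case (gen xs)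
  thus ?case
  proof (induction xs)
    case (Cons x xs)
    hence x: "x \<in> R1" and IH: "gen xs - nf (gen xs) \<in> multilin_rel" by auto
    from fs.subspace_add[OF subspace_multilin_rel prepend_multilin_rel[OF x IH] multilin_cons[OF x nf_closed[of "gen xs"]]]
    show ?case by simp
  qed (simp add: fs.subspace_0[OF subspace_multilin_rel])
qed (simp add: fs.subspace_0[OF subspace_multilin_rel])

lemma killt_gen: "killt (gen w) = (if w \<noteq> [] \<and> hd w = t then 0 else gen w)"
  by (simp add: killt_def)

lemma killt_T: "P \<in> T \<Longrightarrow> killt P \<in> T"
  by (rule flinear_closed[OF flinear_killt[OF flinear_id]]) (auto simp: killt_gen)

lemma killt_decomp:
  assumes "P \<in> T"
  obtains Q where "Q \<in> T" "P = killt P + cons t Q"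
proof -
  have "\<exists>Q\<in>T. P = killt P + cons t Q"
    using assms
  proof (induction rule: free_on_induct)
    case (add f g)
    then obtain Q Q' where Q: "Q \<in> T" "Q' \<in> T" "f = killt f + cons t Q" "g = killt g + cons t Q'" by blast
    have "f + g = killt (f + g) + cons t (Q + Q')"
      by (subst Q(3), subst Q(4)) (simp add: algebra_simps)
    thus ?case using Q(1,2) by blast
  next
    case (scale c f)
    then obtain Q where Q: "Q \<in> T" "f = killt f + cons t Q" by blast
    have "fscale c f = killt (fscale c f) + cons t (fscale c Q)"
      by (subst Q(2)) (simp add: fs.scale_right_distrib)
    thus ?case using Q(1) by blast
  next
    case (gen w)
    show ?case
    proof (cases "w \<noteq> [] \<and> hd w = t")
      case True
      then obtain w' where "w = t # w'" by (cases w) auto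
      with gen t_B True show ?thesis by (intro bexI[of _ "gen w'"]) (auto simp: killt_gen cons_basis)
    next
      case False
      thus ?thesis by (intro bexI[of _ 0]) (auto simp: killt_gen)
    qed
  qed (auto intro: bexI[of _ 0])
  thus ?thesis using that by blast
qed

text \<open>
  As \<open>t\<close> and \<open>0\<close> agree modulo \<open>k(1)\<close>, the letter \<open>t\<close> in front may be replaced by \<open>0\<close>, and a
  word with the letter \<open>0\<close> is zero by multilinearity.
\<close>

lemma cons_t_Aphi_rel:
  assumes "P \<in> T"
  shows "cons t P \<in> Aphi_rel"
  using assms
proof (induction rule: free_on_induct)
  case (gen w)
  hence w: "set w \<subseteq> R1" using B_R1 by auto
  have rel: "g \<in> Aphi_rel" if "g \<in> additive_gens \<union> scaling_gens \<union> line_gens" for g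
    using that unfolding Aphi_rel_eq fspan_def by (rule fs.span_base)
  have 1: "gen (t # w) - gen (0 # w) \<in> Aphi_rel"
    using line_gensI[of t 0 w] w B_R1[OF t_B] t_L by (intro rel) simp
  have "gen ([] @ scale 0 0 # w) - fscale 0 (gen ([] @ 0 # w)) \<in> Aphi_rel"
    using scaling_gensI[of "[]" 0 w 0] w by (intro rel) simp
  hence "gen (0 # w) \<in> Aphi_rel" by simp
  from fs.subspace_add[OF subspace_Aphi_rel 1 this] show ?case
    by (simp add: cons_basis t_B)
qed (auto intro: fs.subspace_0 fs.subspace_add fs.subspace_scale subspace_Aphi_rel)

text \<open>
  Equality in \<open>A\<close> is decided by the coordinates at the words that do not begin with \<open>t\<close>. This is how the
  product and the differential are seen to be well defined.
\<close>

lemma Aphi_rel_iff: "f \<in> F1 \<Longrightarrow> f \<in> Aphi_rel \<longleftrightarrow> killt (nf f) = 0"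
proof
  assume f: "f \<in> F1" and k: "killt (nf f) = 0"
  obtain Q where Q: "Q \<in> T" "nf f = killt (nf f) + cons t Q" by (rule killt_decomp[OF nf_closed])
  have "(f - nf f) + cons t Q \<in> Aphi_rel"
    by (rule fs.subspace_add[OF subspace_Aphi_rel])
       (use nf_multilin[OF f] multilin_le_Aphi_rel cons_t_Aphi_rel[OF Q(1)] in auto)
  thus "f \<in> Aphi_rel" using Q(2) k by simp
qed (use Aphi_rel_killt in blast)

lemma pr_eq_iff: "f \<in> F1 \<Longrightarrow> g \<in> F1 \<Longrightarrow> pr f = pr g \<longleftrightarrow> killt (nf f) = killt (nf g)"
  unfolding pr_def by (simp add: qclass_eq_iff[OF subspace_Aphi_rel] Aphi_rel_iff)

lemma pr_eq_iff_T: "P \<in> T \<Longrightarrow> Q \<in> T \<Longrightarrow> pr P = pr Q \<longleftrightarrow> killt P = killt Q"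
  by (simp add: pr_eq_iff T_F1 nf_T)

lemma pr_nf: "f \<in> F1 \<Longrightarrow> pr (nf f) = pr f"
  by (simp add: pr_eq_iff T_F1 nf_T nf_closed)

lemma mem_pr:
  assumes "f \<in> pr P" "P \<in> T"
  shows "f \<in> F1" "killt (nf f) = killt P"
proof -
  have "f - P \<in> Aphi_rel" using assms(1) by (simp add: pr_def mem_qclass_iff)
  from Aphi_rel_killt[OF this] show "killt (nf f) = killt P" "f \<in> F1"
    using free_on_closed(2)[of "f - P" "lists R1" P] by (simp_all add: nf_T assms(2) T_F1)
qed

lemma pr_self: "P \<in> pr P"
  by (simp add: pr_def qclass_self subspace_Aphi_rel)

subsection \<open>The structure maps\<close>

abbreviation (input) "A \<equiv> Aphi t"

sublocale QA: quotient_space F1 Aphi_rel A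
  by unfold_locales
     (auto simp: subspace_free_on subspace_Aphi_rel Aphi_def dest: Aphi_rel_killt)

sublocale AA: two_modules A A
  by (rule two_modulesI) (rule QA.kmodule)+

lemma A_sel: "one A = pr (gen [])" "monoid.mult A = (\<lambda>P Q. \<Union>f\<in>P. \<Union>g\<in>Q. pr (shuffle' t f g))"
  by (simp_all add: Aphi_def)

lemma pr_F1_closed: "f \<in> F1 \<Longrightarrow> pr f \<in> carrier A"
  unfolding pr_def by (rule QA.qclass_closed)

lemma pr_closed: "P \<in> T \<Longrightarrow> pr P \<in> carrier A"
  by (rule pr_F1_closed[OF T_F1])

lemma pr_word_closed: "w \<in> lists B \<Longrightarrow> pr (gen w) \<in> carrier A"
  by (rule pr_closed) simp

lemma A_cases:
  assumes "a \<in> carrier A"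
  obtains P where "P \<in> T" "a = pr P"
proof -
  obtain f where "f \<in> F1" "a = pr f" using assms by (auto simp: QA.sel(1) pr_def)
  thus ?thesis using that[of "nf f"] by (simp add: nf_closed pr_nf)
qed

lemma pr_ops: "pr f \<oplus>\<^bsub>A\<^esub> pr g = pr (f + g)" "c \<odot>\<^bsub>A\<^esub> pr f = pr (fscale c f)" "\<zero>\<^bsub>A\<^esub> = pr 0"
  by (simp_all add: pr_def QA.add_qclass QA.smult_qclass QA.sel(2))

lemma k_linear_pr: "k_linear (free_module (lists R1)) A pr"
  unfolding pr_def[abs_def] by (rule QA.k_linear_qclass) (rule refl)

lemma k_linear_pr_flinear:
  "\<lbrakk>flinear F; \<And>x. x \<in> S \<Longrightarrow> F (gen x) \<in> T\<rbrakk> \<Longrightarrow> k_linear (free_module S) A (\<lambda>f. pr (F f))"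
  by (rule k_linear_comp[OF k_linear_flinear k_linear_pr]) (auto intro: T_F1)

lemma k_linear_A_I:
  assumes "k_linear (free_module (lists B)) U H" "\<And>P. P \<in> T \<Longrightarrow> h (pr P) = H P"
  shows "k_linear A U h"
  using k_linearD[OF assms(1)] assms(2)
  by (intro k_linearI) (auto elim!: A_cases simp: pr_ops)

lemma A_eqI:
  assumes "k_linear A U h" "k_linear A U k" "kmodule U"
    and "\<And>w. w \<in> lists B \<Longrightarrow> h (pr (gen w)) = k (pr (gen w))" "a \<in> carrier A"
  shows "h a = k a"
proof -
  obtain P where P: "P \<in> T" "a = pr P" using assms(5) by (rule A_cases)
  have "k_linear (free_module (lists B)) A (\<lambda>f. pr f)"
    by (rule k_linear_pr_flinear) (auto intro: flinear_id)
  from k_linear_free_eqI[OF k_linear_comp[OF this assms(1)] k_linear_comp[OF this assms(2)] assms(3,4) P(1)]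
  show ?thesis by (simp add: P(2))
qed

lemma cons_sum: "finite I \<Longrightarrow> (\<And>i. i \<in> I \<Longrightarrow> x i \<in> R1) \<Longrightarrow> cons (\<Sum>i\<in>I. x i) P = (\<Sum>i\<in>I. cons (x i) P)"
proof (induction I rule: finite_induct)
  case (insert i I)
  have "(\<Sum>i\<in>I. x i) \<in> R1" using insert.prems unfolding R1_eq by (intro span_sum) auto
  thus ?case using insert by simp
qed simp

text \<open>
  The lists for which the recursive definitions of the product and the differential are meant.
\<close>

abbreviation hom_words :: "'r list set"
  where "hom_words \<equiv> {xs. \<forall>x\<in>set xs. x \<noteq> 0 \<and> (\<exists>n. x \<in> G n 1)}"

lemma hexp:
  assumes "xs \<in> lists R1"
  shows "hexp xs \<in> free_on hom_words" "nf (hexp xs) = nf (gen xs)"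
proof -
  show "hexp xs \<in> free_on hom_words"
    using assms
  proof (induction xs)
    case (Cons x xs)
    have "prepend (comp1 x n) (hexp xs) \<in> free_on hom_words" if "comp1 x n \<noteq> 0" for n
      by (rule flinear_closed[OF flinear_prepend[OF flinear_id], where S = hom_words])
         (use Cons that comp1_G[of x n] in auto)
    thus ?case by (auto intro!: free_on_closed(6))
  qed simp
  show "nf (hexp xs) = nf (gen xs)"
    using assms
  proof (induction xs)
    case (Cons x xs)
    have x: "x \<in> R1" using Cons by auto
    have "nf (hexp (x # xs)) = (\<Sum>n | comp1 x n \<noteq> 0. cons (comp1 x n) (nf (gen xs)))"
      using Cons by simp
    also have "\<dots> = cons (\<Sum>n | comp1 x n \<noteq> 0. comp1 x n) (nf (gen xs))"
      by (intro cons_sum[symmetric] comp1_sum(1)[OF x] G1_R1[OF comp1_G[OF x]])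
    also have "\<dots> = nf (gen (x # xs))" using comp1_sum(2)[OF x] by simp
    finally show ?case .
  qed simp
qed

lemma lin_ext_hexp:
  assumes "f \<in> F1"
  shows "lin_ext hexp f \<in> free_on hom_words" "nf (lin_ext hexp f) = nf f"
proof -
  show "lin_ext hexp f \<in> free_on hom_words" by (rule lin_ext_closed[OF hexp(1) assms])
  show "nf (lin_ext hexp f) = nf f"
    by (rule flinear_eqI[where f = "\<lambda>f. nf (lin_ext hexp f)" and g = nf, OF _ _ _ assms])
       (use flinear_nf[OF flinear_id] in \<open>simp_all add: hexp(2) flinear_nf[OF flinear_lin_ext_base] del: in_lists_conv_set\<close>)
qed

lemma prepend_F1: "x \<in> R1 \<Longrightarrow> f \<in> F1 \<Longrightarrow> prepend x f \<in> F1"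
  by (rule flinear_closed[OF flinear_prepend[OF flinear_id]]) auto

lemma shuffle_hom_F1: "\<lbrakk>t' = t; xs \<in> hom_words; ys \<in> hom_words\<rbrakk> \<Longrightarrow> shuffle_hom t' xs ys \<in> F1"
proof (induction t' xs ys rule: shuffle_hom.induct)
  case (3 t' x xs y ys)
  obtain i j where G: "x \<in> G i 1" "y \<in> G j 1" using 3 by auto
  note R = G1_R1[OF G(1)] G1_R1[OF G(2)] G1_R1[OF contraction_G[OF G]] B_R1[OF t_B]
  have IH: "shuffle_hom t' xs (y # ys) \<in> F1" "shuffle_hom t' (x # xs) ys \<in> F1" "shuffle_hom t' xs ys \<in> F1"
    using 3 by auto
  show ?case
    using IH 3(4) by (auto simp: R intro!: free_on_closed(2,3,5) prepend_F1 simp del: prepend_vec)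
qed (auto intro: G1_R1)

lemma diff_hom_F1: "xs \<in> hom_words \<Longrightarrow> diff_hom xs \<in> F1"
proof (induction xs rule: diff_hom.induct)
  case (3 x y zs)
  obtain i j where G: "x \<in> G i 1" "y \<in> G j 1" using 3 by auto
  have "set zs \<subseteq> R1" using 3(2) by (auto intro: G1_R1)
  thus ?case using 3 G1_R1[OF G(1)] G1_R1[OF G0_mult[OF d_G0[OF G(1)] G(2)]]
    by (auto intro!: free_on_closed(2,3) prepend_F1 simp del: prepend_vec)
qed auto

lemma nf_diff_hom: "xs \<in> hom_words \<Longrightarrow> nf (diff_hom xs) = mdf (nf (gen xs))"
proof (induction xs rule: diff_hom.induct)
  case (2 x)
  obtain i where G: "x \<in> G i 1" using 2 by auto
  show ?case using mdf_cons[OF G, of "gen []"] by simp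
next
  case (3 x y zs)
  obtain j where G: "x \<in> G (deg x) 1" "y \<in> G j 1" using 3 deg_eq by auto
  show ?case
    using 3 mdf_cons[OF G(1) nf_closed[of "gen (y # zs)"]] lmul_cons[OF d_G0[OF G(1)] G(2)] by simp
qed simp

lemma nf_shuffle':
  assumes "f \<in> F1" "g \<in> F1"
  shows "nf (shuffle' t f g) = msh (nf f) (nf g)" "shuffle' t f g \<in> F1"
proof -
  have "nf (lin_ext (\<lambda>xs. lin_ext (\<lambda>ys. shuffle_hom t xs ys) Q) P) = msh (nf P) (nf Q)" (is "?f P Q = ?g P Q")
    if "P \<in> free_on hom_words" "Q \<in> free_on hom_words" for P Q
    by (rule fbilinear_eqI[where f = ?f and g = ?g, OF _ _ _ _ _ that])
       (intro flinears | simp add: msh_homogeneous)+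
  thus "nf (shuffle' t f g) = msh (nf f) (nf g)"
    using lin_ext_hexp[OF assms(1)] lin_ext_hexp[OF assms(2)] by (simp add: shuffle'_def)
  show "shuffle' t f g \<in> F1"
    unfolding shuffle'_def
    by (intro lin_ext_closed[OF lin_ext_closed[OF shuffle_hom_F1[OF refl] lin_ext_hexp(1)[OF assms(2)]]
          lin_ext_hexp(1)[OF assms(1)]])
qed

lemma nf_diff':
  assumes "f \<in> F1"
  shows "nf (diff' f) = mdf (nf f)" "diff' f \<in> F1"
proof -
  have "nf (lin_ext diff_hom P) = mdf (nf P)" (is "?f P = ?g P") if "P \<in> free_on hom_words" for P
    by (rule flinear_eqI[where f = ?f and g = ?g, OF _ _ _ that])
       (intro flinears flinear_mdf | simp add: nf_diff_hom)+
  thus "nf (diff' f) = mdf (nf f)"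
    using lin_ext_hexp[OF assms] by (simp add: diff'_def)
  show "diff' f \<in> F1"
    unfolding diff'_def by (rule lin_ext_closed[OF diff_hom_F1 lin_ext_hexp(1)[OF assms]])
qed

lemma killt_msh: "\<lbrakk>P \<in> T; Q \<in> T\<rbrakk> \<Longrightarrow> killt (msh P Q) = killt (msh (killt P) (killt Q))"
proof -
  assume PQ: "P \<in> T" "Q \<in> T"
  obtain C where C: "C \<in> T" "P = killt P + cons t C" using PQ(1) by (rule killt_decomp)
  obtain E where E: "E \<in> T" "Q = killt Q + cons t E" using PQ(2) by (rule killt_decomp)
  have "killt (msh P Q) = killt (msh (killt P) Q)"
    by (subst C(2)) (simp add: msh_cons_t_left C(1) PQ(2))
  also have "\<dots> = killt (msh (killt P) (killt Q))"
    by (subst E(2)) (simp add: msh_cons_t_right E(1) PQ killt_T)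
  finally show ?thesis .
qed

lemma mult_pr:
  assumes "P \<in> T" "Q \<in> T"
  shows "pr P \<otimes>\<^bsub>A\<^esub> pr Q = pr (msh P Q)"
proof -
  have "pr (shuffle' t f g) = pr (msh P Q)" if "f \<in> pr P" "g \<in> pr Q" for f g
  proof -
    note f = mem_pr[OF that(1) assms(1)] and g = mem_pr[OF that(2) assms(2)]
    show ?thesis
      using nf_shuffle'[OF f(1) g(1)] f(2) g(2) killt_msh[OF nf_closed nf_closed, of f g] killt_msh[OF assms]
      by (simp add: pr_eq_iff T_F1 msh_T assms nf_T)
  qed
  hence "pr P \<otimes>\<^bsub>A\<^esub> pr Q = (\<Union>f\<in>pr P. \<Union>g\<in>pr Q. pr (msh P Q))"
    unfolding A_sel by (intro SUP_cong refl) auto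
  thus ?thesis using pr_self[of P] pr_self[of Q] by auto
qed

lemma mdf_cons_t: "Q \<in> T \<Longrightarrow> mdf (cons t Q) = cons t (mdf Q)"
  using mdf_cons[OF t_G, of Q] by (simp add: lmul_zero)

lemma killt_mdf: "P \<in> T \<Longrightarrow> killt (mdf P) = killt (mdf (killt P))"
proof -
  assume P: "P \<in> T"
  obtain C where C: "C \<in> T" "P = killt P + cons t C" using P by (rule killt_decomp)
  show ?thesis by (subst C(2)) (simp add: mdf_cons_t C(1))
qed

lemma diff_pr:
  assumes "P \<in> T"
  shows "Aphi_diff (pr P) = pr (mdf P)"
proof -
  have "pr (diff' f) = pr (mdf P)" if "f \<in> pr P" for f
  proof -
    note f = mem_pr[OF that assms]
    show ?thesis
      using nf_diff'[OF f(1)] f(2) killt_mdf[OF nf_closed, of f] killt_mdf[OF assms]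
      by (simp add: pr_eq_iff T_F1 mdf_T assms nf_T)
  qed
  hence "Aphi_diff (pr P) = (\<Union>f\<in>pr P. pr (mdf P))"
    unfolding Aphi_diff_def by (intro SUP_cong refl) auto
  thus ?thesis using pr_self[of P] by auto
qed

lemma counit_pr:
  assumes "P \<in> T"
  shows "Aphi_counit (pr P) = Poly_Mapping.lookup P []"
proof -
  have "Aphi_rel \<subseteq> free_on (- {[]})"
    unfolding Aphi_rel_eq fspan_def
    by (rule fs.span_minimal[OF _ subspace_free_on])
       (auto simp: additive_gens_def scaling_gens_def line_gens_def intro!: free_on_closed)
  hence "f - P \<in> free_on (- {[]})" if "f \<in> pr P" for f
    using that by (auto simp: pr_def mem_qclass_iff)
  hence "Poly_Mapping.lookup f [] = Poly_Mapping.lookup P []" if "f \<in> pr P" for f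
    using that by (fastforce simp: free_on_iff_lookup lookup_minus)
  hence "(\<lambda>f. Poly_Mapping.lookup f []) ` pr P = {Poly_Mapping.lookup P []}"
    using pr_self[of P] by blast
  thus ?thesis by (simp add: Aphi_counit_def)
qed

lemma gr_eq: "Aphi_gr n = pr ` Th n"
proof (intro equalityI subsetI)
  fix a assume "a \<in> Aphi_gr n"
  then obtain f where f: "f \<in> free_on {xs. \<exists>ns. list_all2 (\<lambda>x i. x \<in> G i 1) xs ns \<and> sum_list ns = n}"
      "a = pr f" by (auto simp: Aphi_gr_def)
  have F: "xs \<in> lists R1" if "list_all2 (\<lambda>x i. x \<in> G i 1) xs ns" for xs ns
    using that by (induction rule: list_all2_induct) (auto intro: G1_R1)
  have "nf f \<in> Th n"
    unfolding Th_def
    by (rule flinear_closed[OF flinear_nf[OF flinear_id] _ f(1)]) (auto simp: Th_def[symmetric] intro: nf_Th)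
  moreover have "f \<in> F1" by (rule free_on_mono[OF _ f(1)]) (use F in blast)
  ultimately show "a \<in> pr ` Th n" using pr_nf[of f] f(2) by (metis imageI)
next
  fix a assume "a \<in> pr ` Th n"
  then obtain P where P: "P \<in> Th n" "a = pr P" by blast
  have l: "list_all2 (\<lambda>x i. x \<in> G i 1) w (map deg w) \<and> sum_list (map deg w) = degs w" if "w \<in> lists B" for w
    using that B_deg by (auto simp: degs_def list.rel_map intro!: list.rel_refl_strong)
  have "P \<in> free_on {xs. \<exists>ns. list_all2 (\<lambda>x i. x \<in> G i 1) xs ns \<and> sum_list ns = n}"
    by (rule free_on_mono[OF _ P(1)[unfolded Th_def]]) (use l in blast)
  thus "a \<in> Aphi_gr n" using P(2) by (auto simp: Aphi_gr_def)
qed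

lemma pr_word_gr: "w \<in> lists B \<Longrightarrow> pr (gen w) \<in> Aphi_gr (degs w)"
  unfolding gr_eq by (intro imageI Th_gen)

subsection \<open>The tensor square\<close>

text \<open>
  The map from \<open>T(R\<^sub>1) \<otimes> T(R\<^sub>1)\<close> onto \<open>A \<otimes> A\<close>. Arbitrary words are admitted, because the
  coproduct of \<open>A\<close> is computed from arbitrary representatives.
\<close>

definition q2 :: "('r list \<times> 'r list \<Rightarrow>\<^sub>0 'k) \<Rightarrow>
    (('r list \<Rightarrow>\<^sub>0 'k) set \<times> ('r list \<Rightarrow>\<^sub>0 'k) set \<Rightarrow>\<^sub>0 'k) set"
  where "q2 Z = qclass (tensor_rel A A) (lin_ext (\<lambda>p. gen (pr (gen (fst p)), pr (gen (snd p)))) Z)"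

abbreviation F2 :: "('r list \<times> 'r list \<Rightarrow>\<^sub>0 'k) set"
  where "F2 \<equiv> free_on (lists R1 \<times> lists R1)"

lemma T2_F2: "Z \<in> T2 \<Longrightarrow> Z \<in> F2"
  by (rule free_on_mono[rotated]) (auto intro: B_R1)

lemma k_linear_q2: "k_linear (free_module (lists R1 \<times> lists R1)) (tensor A A) q2"
  unfolding q2_def[abs_def]
  by (rule k_linear_comp[OF k_linear_flinear AA.tens.k_linear_qclass[OF refl]])
     (auto intro!: flinear_lin_ext flinear_id pr_F1_closed)

lemma k_linear_q2_flinear:
  "\<lbrakk>flinear F; \<And>x. x \<in> S \<Longrightarrow> F (gen x) \<in> F2\<rbrakk> \<Longrightarrow> k_linear (free_module S) (tensor A A) (\<lambda>f. q2 (F f))"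
  by (rule k_linear_comp[OF k_linear_flinear k_linear_q2])

lemma q2_gen: "q2 (gen (u, v)) = pure_tensor A A (pr (gen u)) (pr (gen v))"
  by (simp add: q2_def pure_tensor_def)

lemma q2_closed: "Z \<in> F2 \<Longrightarrow> q2 Z \<in> carrier (tensor A A)"
  using k_linearD(1)[OF k_linear_q2] by simp

lemma q2_ops: "q2 (Z + W) = q2 Z \<oplus>\<^bsub>tensor A A\<^esub> q2 W" "q2 (fscale c Z) = c \<odot>\<^bsub>tensor A A\<^esub> q2 Z"
  by (simp_all add: q2_def AA.tens.add_qclass AA.tens.smult_qclass)

lemmas pureA = k_bilinearD(1,2)[OF AA.k_bilinear_pure_tensor]

lemma q2_ftensor:
  assumes "P \<in> F1" "Q \<in> F1"
  shows "q2 (ftensor P Q) = pure_tensor A A (pr P) (pr Q)"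
proof (rule k_linear_free_eqI[where S = "lists R1" and f = "\<lambda>P. q2 (ftensor P Q)"
      and g = "\<lambda>P. pure_tensor A A (pr P) (pr Q)", OF _ _ AA.tens.kmodule _ assms(1)])
  show "k_linear (free_module (lists R1)) (tensor A A) (\<lambda>P. q2 (ftensor P Q))"
    by (intro k_linear_q2_flinear flinear_ftensor_left flinear_id ftensor_closed assms(2)) simp
  show "k_linear (free_module (lists R1)) (tensor A A) (\<lambda>P. pure_tensor A A (pr P) (pr Q))"
    by (rule k_linear_comp[OF k_linear_pr pureA(1)]) (rule pr_F1_closed[OF assms(2)])
  fix u assume u: "u \<in> lists R1"
  hence uF: "gen u \<in> F1" by simp
  show "q2 (ftensor (gen u) Q) = pure_tensor A A (pr (gen u)) (pr Q)"
  proof (rule k_linear_free_eqI[where S = "lists R1" and f = "\<lambda>Q. q2 (ftensor (gen u) Q)"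
        and g = "\<lambda>Q. pure_tensor A A (pr (gen u)) (pr Q)", OF _ _ AA.tens.kmodule _ assms(2)])
    show "k_linear (free_module (lists R1)) (tensor A A) (\<lambda>Q. q2 (ftensor (gen u) Q))"
      by (intro k_linear_q2_flinear flinear_ftensor_right flinear_id ftensor_closed uF) simp
    show "k_linear (free_module (lists R1)) (tensor A A) (\<lambda>Q. pure_tensor A A (pr (gen u)) (pr Q))"
      by (rule k_linear_comp[OF k_linear_pr pureA(2)]) (rule pr_F1_closed[OF uF])
  qed (simp add: q2_gen)
qed

lemma q2_eqI:
  assumes "flinear F" "flinear E" "\<And>u v. u \<in> S \<Longrightarrow> v \<in> S' \<Longrightarrow> F (gen (u, v)) \<in> F2"
    "\<And>u v. u \<in> S \<Longrightarrow> v \<in> S' \<Longrightarrow> E (gen (u, v)) \<in> F2"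
    and "\<And>u v. u \<in> S \<Longrightarrow> v \<in> S' \<Longrightarrow> q2 (F (gen (u, v))) = q2 (E (gen (u, v)))" "Z \<in> free_on (S \<times> S')"
  shows "q2 (F Z) = q2 (E Z)"
  by (rule k_linear_free_eqI[OF k_linear_q2_flinear[OF assms(1)] k_linear_q2_flinear[OF assms(2)]
        AA.tens.kmodule _ assms(6)]) (use assms(3-5) in auto)

lemma q2_nf:
  assumes "Z \<in> F2"
  shows "q2 (map_left nf (map_right nf Z)) = q2 Z"
proof (rule q2_eqI[where F = "\<lambda>Z. map_left nf (map_right nf Z)" and E = "\<lambda>Z. Z", OF _ flinear_id _ _ _ assms])
  show "flinear (\<lambda>Z :: 'r list \<times> 'r list \<Rightarrow>\<^sub>0 'k. map_left nf (map_right nf Z))"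
    by (intro flinear_map_left flinear_map_right flinear_id)
next
  fix u v assume uv: "u \<in> lists R1" "v \<in> lists R1"
  have eq: "map_left nf (map_right nf (gen (u, v))) = ftensor (nf (gen u)) (nf (gen v))"
    by (simp add: map_right_gen map_left_ftensor flinear_nf[OF flinear_id])
  have F: "nf (gen u) \<in> F1" "nf (gen v) \<in> F1" by (intro T_F1 nf_closed)+
  show "map_left nf (map_right nf (gen (u, v))) \<in> F2" unfolding eq by (intro ftensor_closed F)
  show "q2 (map_left nf (map_right nf (gen (u, v)))) = q2 (gen (u, v))"
    unfolding eq q2_ftensor[OF F] q2_gen using uv by (simp add: pr_nf)
  show "gen (u, v) \<in> F2" using uv by simp
qed

lemma pr_killt: "P \<in> T \<Longrightarrow> pr (killt P) = pr P"
proof -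
  have "killt (killt (gen w)) = killt (gen w)" for w by (simp add: killt_gen)
  hence "killt (killt P) = killt P" for P
    by (rule flinear_eqI[where f = "\<lambda>P. killt (killt P)" and g = killt and S = UNIV, rotated 2])
       (simp_all add: flinear_killt[OF flinear_killt[OF flinear_id]] flinear_killt[OF flinear_id])
  thus "P \<in> T \<Longrightarrow> pr (killt P) = pr P" by (simp add: pr_eq_iff_T killt_T)
qed

lemma q2_killt:
  assumes "Z \<in> T2"
  shows "q2 (map_left killt Z) = q2 Z" "q2 (map_right killt Z) = q2 Z"
proof -
  have W: "gen w \<in> F1" "gen w \<in> T" "killt (gen w) \<in> F1" if "w \<in> lists B" for w
    using that killt_T[of "gen w"] T_F1 T_F1[of "gen w"] by auto
  show "q2 (map_left killt Z) = q2 Z"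
  proof (rule q2_eqI[where F = "map_left killt" and E = "\<lambda>Z. Z", OF _ flinear_id _ _ _ assms])
    fix u v assume uv: "u \<in> lists B" "v \<in> lists B"
    note W' = W[OF uv(1)] W[OF uv(2)]
    show "gen (u, v) \<in> F2" using uv B_R1 by auto
    show "map_left killt (gen (u, v)) \<in> F2"
      unfolding map_left_gen by (intro ftensor_closed W')
    show "q2 (map_left killt (gen (u, v))) = q2 (gen (u, v))"
      unfolding map_left_gen q2_ftensor[OF W'(3,4)] q2_gen pr_killt[OF W'(2)] ..
  qed (rule flinear_map_left[OF flinear_id])
  show "q2 (map_right killt Z) = q2 Z"
  proof (rule q2_eqI[where F = "map_right killt" and E = "\<lambda>Z. Z", OF _ flinear_id _ _ _ assms])
    fix u v assume uv: "u \<in> lists B" "v \<in> lists B"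
    note W' = W[OF uv(1)] W[OF uv(2)]
    show "gen (u, v) \<in> F2" using uv B_R1 by auto
    show "map_right killt (gen (u, v)) \<in> F2"
      unfolding map_right_gen by (intro ftensor_closed W')
    show "q2 (map_right killt (gen (u, v))) = q2 (gen (u, v))"
      unfolding map_right_gen q2_ftensor[OF W'(1,6)] q2_gen pr_killt[OF W'(5)] ..
  qed (rule flinear_map_right[OF flinear_id])
qed

text \<open>Cutting commutes with expanding the letters in the basis.\<close>

lemma dec_nf:
  assumes "xs \<in> lists R1"
  shows "map_left nf (map_right nf (dec (gen xs))) = dec (nf (gen xs))"
  using assms
proof (induction xs)
  case Nil
  show ?case by (simp add: map_right_gen map_left_gen)
next
  case (Cons x xs)
  hence x: "x \<in> R1" and IH: "map_left nf (map_right nf (dec (gen xs))) = dec (nf (gen xs))" by auto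
  note nl = flinear_nf[OF flinear_id]
  have "dec (gen (x # xs)) = gen ([], x # xs) + map_left (prepend x) (dec (gen xs))"
    by (simp del: sum.atMost_Suc add: dec_gen sum.atMost_Suc_shift map_left_gen)
  hence "map_left nf (map_right nf (dec (gen (x # xs)))) = ftensor (gen []) (cons x (nf (gen xs)))
      + map_left nf (map_right nf (map_left (prepend x) (dec (gen xs))))"
    by (simp add: map_right_gen map_left_ftensor[OF nl])
  also have "map_left nf (map_right nf (map_left (prepend x) (dec (gen xs))))
      = map_left (\<lambda>P. cons x (nf P)) (map_right nf (dec (gen xs)))"
    by (simp add: map_right_map_left[OF flinear_prepend[OF flinear_id] nl] map_left_map_left[OF nl])
  also have "\<dots> = map_left (cons x) (dec (nf (gen xs)))"
    unfolding IH[symmetric] by (rule map_left_map_left[OF flinear_cons[OF flinear_id], symmetric])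
  finally show ?case by (simp add: dec_cons_R1[OF x])
qed

lemma dec_F2:
  assumes "f \<in> F1"
  shows "dec f \<in> F2"
proof (rule flinear_closed[OF flinear_dec[OF flinear_id] _ assms])
  fix w assume "w \<in> lists R1"
  hence "take j w \<in> lists R1 \<and> drop j w \<in> lists R1" for j
    by (metis append_in_lists_conv append_take_drop_id)
  thus "dec (gen w) \<in> F2"
    unfolding dec_gen by (intro free_on_closed(6)) simp
qed

lemma dec_nf_all: "f \<in> F1 \<Longrightarrow> map_left nf (map_right nf (dec f)) = dec (nf f)"
  by (rule flinear_eqI[where f = "\<lambda>f. map_left nf (map_right nf (dec f))" and g = "\<lambda>f. dec (nf f)"])
     (intro flinears2 | rule dec_nf | assumption)+

text \<open>
  Each cut of a word that begins with \<open>t\<close> has a factor that begins with \<open>t\<close>: the right one for the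
  cut in front, and the left one for all others.
\<close>

lemma q2_dec_killt: "P \<in> T \<Longrightarrow> q2 (dec P) = q2 (dec (killt P))"
proof -
  assume P: "P \<in> T"
  obtain C where C: "C \<in> T" "P = killt P + cons t C" using P by (rule killt_decomp)
  interpret TA: Module.module "ring_of_type_algebra :: 'k ring" "tensor A A" by (rule AA.tens.kmodule)
  have q0: "q2 0 = \<zero>\<^bsub>tensor A A\<^esub>" by (simp add: q2_def AA.tens.sel(2))
  have N: "gen [] \<in> T" by simp
  have m: "map_left (cons t) (dec C) \<in> T2"
    by (rule flinear_closed[OF flinear_map_left[OF flinear_id] _ dec_T2[OF C(1)]])
       (auto simp: map_left_gen intro!: ftensor_closed cons_T)
  have "q2 (ftensor (gen []) (cons t C)) = q2 (map_right killt (ftensor (gen []) (cons t C)))"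
    by (rule q2_killt(2)[symmetric]) (intro ftensor_closed N cons_T C)
  hence z1: "q2 (ftensor (gen []) (cons t C)) = \<zero>\<^bsub>tensor A A\<^esub>"
    by (simp add: map_right_ftensor[OF flinear_killt[OF flinear_id]] q0)
  have "map_left killt (map_left (cons t) (dec C)) = 0"
    by (simp add: map_left_map_left[OF flinear_killt[OF flinear_id]]) (simp add: map_left_def lin_ext_def)
  hence z2: "q2 (map_left (cons t) (dec C)) = \<zero>\<^bsub>tensor A A\<^esub>"
    using q2_killt(1)[OF m] q0 by simp
  have "q2 (dec P) = q2 (dec (killt P)) \<oplus>\<^bsub>tensor A A\<^esub> q2 (dec (cons t C))"
    by (subst C(2)) (simp add: q2_ops)
  also have "q2 (dec (cons t C)) = \<zero>\<^bsub>tensor A A\<^esub>"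
    by (simp add: dec_cons[OF t_G] q2_ops z1 z2)
  finally show ?thesis using q2_closed[OF dec_F2[OF T_F1[OF killt_T[OF P]]]] by simp
qed

lemma comult_pr:
  assumes "P \<in> T"
  shows "Aphi_comult t (pr P) = q2 (dec P)"
proof -
  have eq: "lin_ext (\<lambda>xs. \<Sum>j\<le>length xs. gen (pr (gen (take j xs)), pr (gen (drop j xs)))) f
      = lin_ext (\<lambda>p. gen (pr (gen (fst p)), pr (gen (snd p)))) (dec f)" for f :: "'r list \<Rightarrow>\<^sub>0 'k"
    unfolding dec_def by (subst flinear_lin_ext_comp[OF flinear_lin_ext_base]) simp
  have "q2 (dec f) = q2 (dec P)" if "f \<in> pr P" for f
  proof -
    note f = mem_pr[OF that assms]
    have "q2 (dec f) = q2 (dec (nf f))"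
      using q2_nf[OF dec_F2[OF f(1)]] by (simp add: dec_nf_all[OF f(1)])
    thus ?thesis using q2_dec_killt[OF nf_closed, of f] q2_dec_killt[OF assms] f(2) by simp
  qed
  hence "Aphi_comult t (pr P) = (\<Union>f\<in>pr P. q2 (dec P))"
    unfolding Aphi_comult_def eq q2_def[symmetric] by (intro SUP_cong refl) auto
  thus ?thesis using pr_self[of P] by auto
qed

lemma tensor_lift_q2:
  assumes "kmodule U" "k_bilinear A A U \<beta>" "k_linear (free_module (lists B \<times> lists B)) U h"
    and "\<And>u v. u \<in> lists B \<Longrightarrow> v \<in> lists B \<Longrightarrow> \<beta> (pr (gen u)) (pr (gen v)) = h (gen (u, v))" "Z \<in> T2"
  shows "tensor_lift U \<beta> (q2 Z) = h Z"
proof (rule k_linear_free_eqI[OF _ assms(3,1) _ assms(5), where f = "\<lambda>Z. tensor_lift U \<beta> (q2 Z)"])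
  show "k_linear (free_module (lists B \<times> lists B)) U (\<lambda>Z. tensor_lift U \<beta> (q2 Z))"
    by (rule k_linear_comp[OF k_linear_q2_flinear AA.k_linear_tensor_lift[OF assms(1,2)]])
       (auto intro: flinear_id B_R1)
  fix p assume "p \<in> lists B \<times> lists B"
  then obtain u v where p: "p = (u, v)" "u \<in> lists B" "v \<in> lists B" by blast
  show "tensor_lift U \<beta> (q2 (gen p)) = h (gen p)"
    unfolding p(1) q2_gen
    by (subst AA.tensor_lift_pure[OF assms(1,2)]) (use p pr_word_closed assms(4) in auto)
qed

section \<open>The Hopf algebra\<close>

definition hpart :: "int \<Rightarrow> ('r list \<Rightarrow>\<^sub>0 'k) \<Rightarrow> ('r list \<Rightarrow>\<^sub>0 'k)"
  where "hpart n = lin_ext (\<lambda>w. if degs w = n then gen w else 0)"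

lemma flinear_hpart: "flinear g \<Longrightarrow> flinear (\<lambda>P. hpart n (g P))"
  unfolding hpart_def by (intro flinear_intros)

lemmas hpart_vec [simp] = flinear_simps[OF flinear_hpart[OF flinear_id]]

lemma hpart_gen: "hpart n (gen w) = (if degs w = n then gen w else 0)"
  by (simp add: hpart_def)

lemma hpart_Th: "P \<in> T \<Longrightarrow> hpart n P \<in> Th n"
  unfolding Th_def by (rule flinear_closed[OF flinear_hpart[OF flinear_id]]) (auto simp: hpart_gen)

lemma hpart_homogeneous: "P \<in> Th m \<Longrightarrow> hpart n P = (if n = m then P else 0)"
  unfolding Th_def
  by (cases "n = m"; rule flinear_eqI[where f = "hpart n" and g = "\<lambda>P. if n = m then P else 0"])
     (auto simp: hpart_gen flinear_hpart[OF flinear_id] flinear_id flinear_zero)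

lemma hpart_killt: "killt (hpart n P) = hpart n (killt P)" (is "?f P = ?g P")
proof (rule flinear_eqI[where f = ?f and g = ?g and S = UNIV])
  show "killt (hpart n (gen w)) = hpart n (killt (gen w))" for w
    by (simp add: hpart_gen killt_gen)
qed (simp_all add: flinear_hpart flinear_killt flinear_id)

lemma hpart_sum: "\<exists>K. finite K \<and> (\<forall>n. n \<notin> K \<longrightarrow> hpart n P = 0) \<and> P = (\<Sum>n\<in>K. hpart n P)"
proof (intro exI[of _ "degs ` Poly_Mapping.keys P"] conjI allI impI)
  let ?f = "\<lambda>w. fscale (Poly_Mapping.lookup P w) (gen w :: 'r list \<Rightarrow>\<^sub>0 'k)"
  have eq: "hpart n P = (\<Sum>w\<in>{w \<in> Poly_Mapping.keys P. degs w = n}. ?f w)" for n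
    unfolding hpart_def lin_ext_def by (subst sum.inter_filter) (auto intro!: sum.cong)
  show "hpart n P = 0" if "n \<notin> degs ` Poly_Mapping.keys P" for n
    unfolding eq using that by (intro sum.neutral) auto
  have "P = (\<Sum>w\<in>Poly_Mapping.keys P. ?f w)"
    using lin_ext_gen_id[of P] by (simp add: lin_ext_def)
  also have "\<dots> = (\<Sum>n\<in>degs ` Poly_Mapping.keys P. hpart n P)"
    unfolding eq by (rule sum.image_gen) simp
  finally show "P = (\<Sum>n\<in>degs ` Poly_Mapping.keys P. hpart n P)" .
qed simp

lemma finsum_pr: "(\<And>i. i \<in> I \<Longrightarrow> F i \<in> T) \<Longrightarrow> finite I \<Longrightarrow> (\<Oplus>\<^bsub>A\<^esub>i\<in>I. pr (F i)) = pr (\<Sum>i\<in>I. F i)"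
proof (induction I rule: infinite_finite_induct)
  case (insert i I)
  thus ?case
    by (subst AA.V.finsum_insert) (auto simp: pr_ops intro: pr_closed)
qed (simp_all add: pr_ops)

text \<open>
  The projection \<open>hpart\<close> to a degree commutes with the projection \<open>killt\<close>, so it descends to \<open>A\<close> and reads off
  the components of an element of \<open>A\<close>.
\<close>

lemma graded: "graded_space A Aphi_gr"
proof (intro graded_space.intro graded_space_axioms.intro QA.kmodule)
  fix n
  show "submodule (Aphi_gr n) (ring_of_type_algebra :: 'k ring) A"
  proof (rule AA.V.submoduleI)
    show "Aphi_gr n \<subseteq> carrier A" by (auto simp: gr_eq intro: pr_closed Th_T)
    show "\<zero>\<^bsub>A\<^esub> \<in> Aphi_gr n" by (auto simp: gr_eq pr_ops)
    show "a \<oplus>\<^bsub>A\<^esub> b \<in> Aphi_gr n" if "a \<in> Aphi_gr n" "b \<in> Aphi_gr n" for a b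
      using that by (auto simp: gr_eq pr_ops)
    show "c \<odot>\<^bsub>A\<^esub> a \<in> Aphi_gr n" if "a \<in> Aphi_gr n" for c a
      using that by (auto simp: gr_eq pr_ops)
    show "\<ominus>\<^bsub>A\<^esub> a \<in> Aphi_gr n" if "a \<in> Aphi_gr n" for a
    proof -
      obtain P where P: "P \<in> Th n" "a = pr P" using \<open>a \<in> Aphi_gr n\<close> by (auto simp: gr_eq)
      have "\<ominus>\<^bsub>A\<^esub> a = pr (- P)"
        by (rule AA.V.minus_equality) (auto simp: P(2) pr_ops intro: pr_closed Th_T[OF P(1)] free_on_closed)
      thus ?thesis using P(1) by (auto simp: gr_eq)
    qed
  qed
next
  fix v assume "v \<in> carrier A"
  then obtain P where P: "P \<in> T" "v = pr P" by (rule A_cases)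
  obtain K where K: "finite K" "\<And>n. n \<notin> K \<Longrightarrow> hpart n P = 0" "P = (\<Sum>n\<in>K. hpart n P)"
    using hpart_sum[of P] by blast
  have hT: "hpart n P \<in> T" for n by (rule Th_T[OF hpart_Th[OF P(1)]])
  show "\<exists>!c. decomposes A Aphi_gr v c"
  proof (rule ex1I)
    have sub: "{n. pr (hpart n P) \<noteq> \<zero>\<^bsub>A\<^esub>} \<subseteq> K" using K(2) by (auto simp: pr_ops)
    have "(\<Oplus>\<^bsub>A\<^esub>n\<in>{n. pr (hpart n P) \<noteq> \<zero>\<^bsub>A\<^esub>}. pr (hpart n P)) = (\<Oplus>\<^bsub>A\<^esub>n\<in>K. pr (hpart n P))"
      using sub K(1) by (intro AA.V.add.finprod_mono_neutral_cong_left) (auto intro: pr_closed hT)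
    also have "\<dots> = v" using finsum_pr[of K "\<lambda>n. hpart n P"] hT K(1,3) P(2) by simp
    finally show "decomposes A Aphi_gr v (\<lambda>n. pr (hpart n P))"
      unfolding decomposes_def
      using hpart_Th[OF P(1)] finite_subset[OF sub K(1)] by (auto simp: gr_eq)
  next
    fix c assume c: "decomposes A Aphi_gr v c"
    let ?K = "{n. c n \<noteq> \<zero>\<^bsub>A\<^esub>}"
    have "\<forall>n. \<exists>Z. Z \<in> Th n \<and> c n = pr Z \<and> (c n = \<zero>\<^bsub>A\<^esub> \<longrightarrow> Z = 0)"
    proof
      fix n
      have "c n \<in> Aphi_gr n" using c by (auto simp: decomposes_def)
      thus "\<exists>Z. Z \<in> Th n \<and> c n = pr Z \<and> (c n = \<zero>\<^bsub>A\<^esub> \<longrightarrow> Z = 0)"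
        by (cases "c n = \<zero>\<^bsub>A\<^esub>") (auto simp: gr_eq pr_ops)
    qed
    \<comment> \<open>Choosing the representative 0 of 0 keeps the sum of the representatives finite.\<close>
    then obtain Z where Z: "\<And>n. Z n \<in> Th n" "\<And>n. c n = pr (Z n)" "\<And>n. c n = \<zero>\<^bsub>A\<^esub> \<Longrightarrow> Z n = 0"
      by metis
    have fin: "finite ?K" using c by (auto simp: decomposes_def)
    have ZT: "(\<Sum>n\<in>?K. Z n) \<in> T" by (intro free_on_closed(6) Th_T[OF Z(1)])
    have "v = pr (\<Sum>n\<in>?K. Z n)"
      using c finsum_pr[of ?K Z] fin Th_T[OF Z(1)] by (simp add: decomposes_def Z(2)[symmetric])
    hence "killt P = killt (\<Sum>n\<in>?K. Z n)" using P ZT by (simp add: pr_eq_iff_T)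
    hence eq: "killt (hpart m P) = killt (hpart m (\<Sum>n\<in>?K. Z n))" for m
      by (simp only: hpart_killt)
    have "hpart m (\<Sum>n\<in>?K. Z n) = Z m" for m
      using fin Z(3)[of m] by (simp add: hpart_homogeneous[OF Z(1)])
    hence "pr (Z m) = pr (hpart m P)" for m
      using eq[of m] by (simp add: pr_eq_iff_T Th_T[OF Z(1)] hT)
    thus "c = (\<lambda>n. pr (hpart n P))" by (auto simp: Z(2))
  qed
qed

lemma A_mult_bilinear: "k_bilinear A A A (\<lambda>a b. a \<otimes>\<^bsub>A\<^esub> b)"
proof (rule k_bilinearI)
  fix b assume "b \<in> carrier A"
  then obtain Q where Q: "Q \<in> T" "b = pr Q" by (rule A_cases)
  show "k_linear A A (\<lambda>a. a \<otimes>\<^bsub>A\<^esub> b)"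
    by (rule k_linear_A_I[OF k_linear_pr_flinear[where F = "\<lambda>P. msh P Q"]])
       (simp_all add: flinear_msh_left flinear_id msh_T mult_pr Q)
next
  fix a assume "a \<in> carrier A"
  then obtain P where P: "P \<in> T" "a = pr P" by (rule A_cases)
  show "k_linear A A (\<lambda>b. a \<otimes>\<^bsub>A\<^esub> b)"
    by (rule k_linear_A_I[OF k_linear_pr_flinear[where F = "\<lambda>Q. msh P Q"]])
       (simp_all add: flinear_msh_right flinear_id msh_T mult_pr P)
qed

lemmas multA = k_bilinearD[OF A_mult_bilinear]

lemma Nil_T: "gen [] \<in> T"
  by simp

lemma ring_A: "Ring.ring A"
proof (rule ringI)
  show "abelian_group A" by (rule AA.V.abelian_group_axioms)
  show "Group.monoid A"
  proof (rule monoidI)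
    show "x \<otimes>\<^bsub>A\<^esub> y \<in> carrier A" if "x \<in> carrier A" "y \<in> carrier A" for x y
      by (rule multA(3)[OF that])
    show "\<one>\<^bsub>A\<^esub> \<in> carrier A" unfolding A_sel by (rule pr_closed[OF Nil_T])
    show "x \<otimes>\<^bsub>A\<^esub> y \<otimes>\<^bsub>A\<^esub> z = x \<otimes>\<^bsub>A\<^esub> (y \<otimes>\<^bsub>A\<^esub> z)"
      if xyz: "x \<in> carrier A" "y \<in> carrier A" "z \<in> carrier A" for x y z
    proof -
      obtain P Q Z where "P \<in> T" "x = pr P" "Q \<in> T" "y = pr Q" "Z \<in> T" "z = pr Z"
        using xyz by (meson A_cases)
      thus ?thesis by (simp add: mult_pr msh_T msh_assoc)
    qed
    show "\<one>\<^bsub>A\<^esub> \<otimes>\<^bsub>A\<^esub> x = x" "x \<otimes>\<^bsub>A\<^esub> \<one>\<^bsub>A\<^esub> = x" if "x \<in> carrier A" for x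
      using that by (auto elim!: A_cases simp: A_sel(1) mult_pr[OF Nil_T] mult_pr[OF _ Nil_T]
          msh_Nil_left msh_Nil_right)
  qed
  show "(x \<oplus>\<^bsub>A\<^esub> y) \<otimes>\<^bsub>A\<^esub> z = x \<otimes>\<^bsub>A\<^esub> z \<oplus>\<^bsub>A\<^esub> y \<otimes>\<^bsub>A\<^esub> z"
    if "x \<in> carrier A" "y \<in> carrier A" "z \<in> carrier A" for x y z
    by (rule k_linearD(2)[OF multA(1)[OF that(3)] that(1,2)])
  show "z \<otimes>\<^bsub>A\<^esub> (x \<oplus>\<^bsub>A\<^esub> y) = z \<otimes>\<^bsub>A\<^esub> x \<oplus>\<^bsub>A\<^esub> z \<otimes>\<^bsub>A\<^esub> y"
    if "x \<in> carrier A" "y \<in> carrier A" "z \<in> carrier A" for x y z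
    by (rule k_linearD(2)[OF multA(2)[OF that(3)] that(1,2)])
qed

abbreviation "\<Delta> \<equiv> Aphi_comult t"

lemma comult_linear: "k_linear A (tensor A A) \<Delta>"
  by (rule k_linear_A_I[OF k_linear_q2_flinear[where F = dec] comult_pr])
     (use flinear_dec[OF flinear_id] in \<open>auto intro!: dec_F2 T_F1 simp del: in_lists_conv_set\<close>)

lemma comult_word: "w \<in> lists B \<Longrightarrow> \<Delta> (pr (gen w)) = q2 (dec (gen w))"
  by (rule comult_pr) simp

lemma comult_degree:
  assumes "a \<in> Aphi_gr n"
  shows "\<Delta> a \<in> tensor_grading A Aphi_gr n"
proof -
  obtain P where P: "P \<in> Th n" "a = pr P" using assms by (auto simp: gr_eq)
  have "lin_ext (\<lambda>p. gen (pr (gen (fst p)), pr (gen (snd p)))) (dec P)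
      \<in> free_on (\<Union>i. Aphi_gr i \<times> Aphi_gr (n - i))"
  proof (rule lin_ext_closed[OF _ dec_T2h[OF P(1), unfolded T2h_def]])
    fix p assume "p \<in> {z \<in> lists B \<times> lists B. degs (fst z) + degs (snd z) = n}"
    hence p: "fst p \<in> lists B" "snd p \<in> lists B" "degs (snd p) = n - degs (fst p)"
      by (simp_all only: mem_Collect_eq mem_Times_iff) linarith
    hence "pr (gen (fst p)) \<in> Aphi_gr (degs (fst p))" "pr (gen (snd p)) \<in> Aphi_gr (n - degs (fst p))"
      using pr_word_gr[OF p(1)] pr_word_gr[OF p(2)] by simp_all
    thus "gen (pr (gen (fst p)), pr (gen (snd p))) \<in> free_on (\<Union>i. Aphi_gr i \<times> Aphi_gr (n - i))"
      by auto
  qed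
  thus ?thesis
    unfolding P(2) comult_pr[OF Th_T[OF P(1)]] q2_def tensor_grading_def by (rule imageI)
qed

subsection \<open>Coassociativity\<close>

text \<open>
  The map from \<open>T(R\<^sub>1) \<otimes> T(R\<^sub>1) \<otimes> T(R\<^sub>1)\<close> onto \<open>A \<otimes> (A \<otimes> A)\<close>, on basis words.
\<close>

definition q3 where "q3 = lcomb (tensor A (tensor A A)) (\<lambda>p. pure_tensor A (tensor A A) (pr (gen (fst p)))
    (pure_tensor A A (pr (gen (fst (snd p)))) (pr (gen (snd (snd p))))))"

text \<open>Both sides are the sum over all ways to cut the word into three pieces.\<close>

lemma dec_coassoc:
  "lin_ext (\<lambda>p. lin_ext (\<lambda>r. gen (fst r, snd r, snd p)) (dec (gen (fst p)))) (dec (gen w))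
   = lin_ext (\<lambda>p. lin_ext (\<lambda>r. gen (fst p, fst r, snd r)) (dec (gen (snd p)))) (dec (gen w))"
proof -
  let ?n = "length w"
  let ?F = "\<lambda>j i. gen (take j w, take i (drop j w), drop (j + i) w)"
  have "lin_ext (\<lambda>p. lin_ext (\<lambda>r. gen (fst r, snd r, snd p)) (dec (gen (fst p)))) (dec (gen w))
      = (\<Sum>m\<le>?n. \<Sum>j\<le>length (take m w). gen (take j (take m w), drop j (take m w), drop m w))"
    by (simp add: dec_gen)
  also have "\<dots> = (\<Sum>m\<le>?n. \<Sum>j\<le>m. ?F j (m - j))"
    by (intro sum.cong) (auto simp: min_def drop_take)
  also have "\<dots> = (\<Sum>(j, i)\<in>{(j, i). j + i \<le> ?n}. ?F j i)"
    by (rule sum.triangle_reindex_eq[symmetric])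
  also have "\<dots> = (\<Sum>j\<le>?n. \<Sum>i\<le>?n - j. ?F j i)"
    by (subst sum.Sigma) (auto intro!: sum.cong)
  also have "\<dots> = lin_ext (\<lambda>p. lin_ext (\<lambda>r. gen (fst p, fst r, snd r)) (dec (gen (snd p)))) (dec (gen w))"
    by (simp add: dec_gen add.commute)
  finally show ?thesis .
qed

text \<open>
  Both sides are images of threefold deconcatenations under \<open>q3\<close>: all maps involved are linear and so
  are determined by their values on pure tensors of words.
\<close>

lemma comult_coassoc:
  assumes "a \<in> carrier A"
  shows "tensor_assoc A A A (tensor_map (tensor A A) A \<Delta> (\<lambda>x. x) (\<Delta> a)) =
    tensor_map A (tensor A A) (\<lambda>x. x) \<Delta> (\<Delta> a)"
proof -
  let ?TA = "tensor A A" and ?T3 = "tensor A (tensor A A)" and ?S = "lists B \<times> lists B"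
  interpret L: two_modules ?TA A by (rule two_modulesI) (rule AA.tens.kmodule QA.kmodule)+
  interpret R: two_modules A ?TA by (rule two_modulesI) (rule AA.tens.kmodule QA.kmodule)+
  note mods = QA.kmodule AA.tens.kmodule
  have lin3: "k_linear (free_module (lists B \<times> lists B \<times> lists B)) ?T3 q3"
    unfolding q3_def
    by (rule k_linear_lcomb[OF R.tens.kmodule])
       (auto intro!: R.pure_tensor_closed AA.pure_tensor_closed pr_word_closed simp del: in_lists_conv_set)
  have q3_gen: "q3 (gen (u, v, w)) = pure_tensor A ?TA (pr (gen u)) (pure_tensor A A (pr (gen v)) (pr (gen w)))"
    if "u \<in> lists B" "v \<in> lists B" "w \<in> lists B" for u v w
    unfolding q3_def
    by (subst lcomb_gen[OF R.tens.kmodule])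
       (use that in \<open>auto intro!: R.pure_tensor_closed AA.pure_tensor_closed pr_word_closed simp del: in_lists_conv_set\<close>)
  have q2T: "k_linear (free_module ?S) ?TA q2"
    by (rule k_linear_q2_flinear[where F = "\<lambda>Z. Z"]) (auto intro: flinear_id B_R1)
  note assoc = tensor_assoc_pure[OF mods(1) mods(1) mods(1)]
  note map1 = tensor_map_pure[OF mods(2) mods(1) mods(1) mods(1) comult_linear k_linear_id]
  note map2 = tensor_map_pure[OF mods(1) mods(2) mods(1) mods(1) k_linear_id comult_linear]
  have left1: "tensor_assoc A A A (pure_tensor ?TA A (q2 W) (pr (gen v)))
      = q3 (lin_ext (\<lambda>r. gen (fst r, snd r, v)) W)" if W: "W \<in> T2" and v: "v \<in> lists B" for W v
  proof (rule k_linear_free_eqI[where f = "\<lambda>W. tensor_assoc A A A (pure_tensor ?TA A (q2 W) (pr (gen v)))"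
        and g = "\<lambda>W. q3 (lin_ext (\<lambda>r. gen (fst r, snd r, v)) W)", OF _ _ R.tens.kmodule _ W])
    show "k_linear (free_module ?S) ?T3 (\<lambda>W. tensor_assoc A A A (pure_tensor ?TA A (q2 W) (pr (gen v))))"
      by (rule k_linear_comp[OF k_linear_comp[OF q2T k_bilinearD(1)[OF L.k_bilinear_pure_tensor]] assoc(1)])
         (rule pr_word_closed[OF v])
    show "k_linear (free_module ?S) ?T3 (\<lambda>W. q3 (lin_ext (\<lambda>r. gen (fst r, snd r, v)) W))"
      by (rule k_linear_comp[OF k_linear_flinear[OF flinear_lin_ext_base] lin3]) (use v in auto)
    fix r assume "r \<in> ?S"
    thus "tensor_assoc A A A (pure_tensor ?TA A (q2 (gen r)) (pr (gen v)))
        = q3 (lin_ext (\<lambda>r. gen (fst r, snd r, v)) (gen r))"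
      using v by (cases r) (simp add: q2_gen assoc(2) pr_word_closed q3_gen del: in_lists_conv_set)
  qed
  have left: "tensor_assoc A A A (tensor_map ?TA A \<Delta> (\<lambda>x. x) (q2 Z))
      = q3 (lin_ext (\<lambda>p. lin_ext (\<lambda>r. gen (fst r, snd r, snd p)) (dec (gen (fst p)))) Z)" (is "?f Z = ?g Z") if Z: "Z \<in> T2" for Z
  proof (rule k_linear_free_eqI[where f = ?f and g = ?g,
        OF _ _ R.tens.kmodule _ Z])
    show "k_linear (free_module ?S) ?T3 (\<lambda>Z. tensor_assoc A A A (tensor_map ?TA A \<Delta> (\<lambda>x. x) (q2 Z)))"
      by (rule k_linear_comp[OF k_linear_comp[OF q2T map1(1)] assoc(1)])
    show "k_linear (free_module ?S) ?T3
        (\<lambda>Z. q3 (lin_ext (\<lambda>p. lin_ext (\<lambda>r. gen (fst r, snd r, snd p)) (dec (gen (fst p)))) Z))"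
      by (rule k_linear_comp[OF k_linear_flinear[OF flinear_lin_ext_base] lin3])
         (auto intro!: lin_ext_closed[OF _ dec_T2])
    fix p assume "p \<in> ?S"
    then obtain u v where p: "p = (u, v)" "u \<in> lists B" "v \<in> lists B" by blast
    have "dec (gen u) \<in> T2" using p(2) by (intro dec_T2) simp
    thus "tensor_assoc A A A (tensor_map ?TA A \<Delta> (\<lambda>x. x) (q2 (gen p)))
        = q3 (lin_ext (\<lambda>p. lin_ext (\<lambda>r. gen (fst r, snd r, snd p)) (dec (gen (fst p)))) (gen p))"
      using p by (simp add: q2_gen map1(2) pr_word_closed comult_word left1 del: in_lists_conv_set)
  qed
  have right1: "pure_tensor A ?TA (pr (gen u)) (q2 W)
      = q3 (lin_ext (\<lambda>r. gen (u, fst r, snd r)) W)" (is "?f W = ?g W") if W: "W \<in> T2" and u: "u \<in> lists B" for W u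
  proof (rule k_linear_free_eqI[where f = ?f and g = ?g, OF _ _ R.tens.kmodule _ W])
    show "k_linear (free_module ?S) ?T3 (\<lambda>W. pure_tensor A ?TA (pr (gen u)) (q2 W))"
      by (rule k_linear_comp[OF q2T k_bilinearD(2)[OF R.k_bilinear_pure_tensor]])
         (rule pr_word_closed[OF u])
    show "k_linear (free_module ?S) ?T3 (\<lambda>W. q3 (lin_ext (\<lambda>r. gen (u, fst r, snd r)) W))"
      by (rule k_linear_comp[OF k_linear_flinear[OF flinear_lin_ext_base] lin3]) (use u in auto)
    fix r assume "r \<in> ?S"
    thus "pure_tensor A ?TA (pr (gen u)) (q2 (gen r)) = q3 (lin_ext (\<lambda>r. gen (u, fst r, snd r)) (gen r))"
      using u by (cases r) (simp add: q2_gen q3_gen del: in_lists_conv_set)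
  qed
  have right: "tensor_map A ?TA (\<lambda>x. x) \<Delta> (q2 Z)
      = q3 (lin_ext (\<lambda>p. lin_ext (\<lambda>r. gen (fst p, fst r, snd r)) (dec (gen (snd p)))) Z)" if Z: "Z \<in> T2" for Z
  proof (rule k_linear_free_eqI[where f = "\<lambda>Z. tensor_map A ?TA (\<lambda>x. x) \<Delta> (q2 Z)"
        and g = "\<lambda>Z. q3 (lin_ext (\<lambda>p. lin_ext (\<lambda>r. gen (fst p, fst r, snd r)) (dec (gen (snd p)))) Z)",
        OF _ _ R.tens.kmodule _ Z])
    show "k_linear (free_module ?S) ?T3 (\<lambda>Z. tensor_map A ?TA (\<lambda>x. x) \<Delta> (q2 Z))"
      by (rule k_linear_comp[OF q2T map2(1)])
    show "k_linear (free_module ?S) ?T3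
        (\<lambda>Z. q3 (lin_ext (\<lambda>p. lin_ext (\<lambda>r. gen (fst p, fst r, snd r)) (dec (gen (snd p)))) Z))"
      by (rule k_linear_comp[OF k_linear_flinear[OF flinear_lin_ext_base] lin3])
         (auto intro!: lin_ext_closed[OF _ dec_T2])
    fix p assume "p \<in> ?S"
    then obtain u v where p: "p = (u, v)" "u \<in> lists B" "v \<in> lists B" by blast
    have "dec (gen v) \<in> T2" using p(3) by (intro dec_T2) simp
    thus "tensor_map A ?TA (\<lambda>x. x) \<Delta> (q2 (gen p))
        = q3 (lin_ext (\<lambda>p. lin_ext (\<lambda>r. gen (fst p, fst r, snd r)) (dec (gen (snd p)))) (gen p))"
      using p by (simp add: q2_gen map2(2) pr_word_closed comult_word right1 del: in_lists_conv_set)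
  qed
  show ?thesis
  proof (rule A_eqI[where h = "\<lambda>a. tensor_assoc A A A (tensor_map ?TA A \<Delta> (\<lambda>x. x) (\<Delta> a))"
        and k = "\<lambda>a. tensor_map A ?TA (\<lambda>x. x) \<Delta> (\<Delta> a)", OF _ _ R.tens.kmodule _ assms])
    show "k_linear A ?T3 (\<lambda>a. tensor_assoc A A A (tensor_map ?TA A \<Delta> (\<lambda>x. x) (\<Delta> a)))"
      by (rule k_linear_comp[OF k_linear_comp[OF comult_linear map1(1)] assoc(1)])
    show "k_linear A ?T3 (\<lambda>a. tensor_map A ?TA (\<lambda>x. x) \<Delta> (\<Delta> a))"
      by (rule k_linear_comp[OF comult_linear map2(1)])
    fix w assume w: "w \<in> lists B"
    hence "dec (gen w) \<in> T2" by (intro dec_T2) simp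
    thus "tensor_assoc A A A (tensor_map ?TA A \<Delta> (\<lambda>x. x) (\<Delta> (pr (gen w))))
        = tensor_map A ?TA (\<lambda>x. x) \<Delta> (\<Delta> (pr (gen w)))"
      by (simp add: comult_word[OF w] left right dec_coassoc)
  qed
qed

subsection \<open>Counit, multiplicativity and antipode\<close>

lemma counit_word: "w \<in> lists B \<Longrightarrow> Aphi_counit (pr (gen w)) = (if w = [] then 1 else 0)"
  by (subst counit_pr) (auto simp: lookup_single)

lemma counit_ops:
  "\<lbrakk>a \<in> carrier A; b \<in> carrier A\<rbrakk> \<Longrightarrow> Aphi_counit (a \<oplus>\<^bsub>A\<^esub> b) = Aphi_counit a + Aphi_counit b"
  "a \<in> carrier A \<Longrightarrow> Aphi_counit (c \<odot>\<^bsub>A\<^esub> a) = c * Aphi_counit a"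
  by (auto elim!: A_cases simp: pr_ops counit_pr lookup_add)

lemma counit_degree:
  assumes "a \<in> Aphi_gr n" "n \<noteq> 0"
  shows "Aphi_counit a = 0"
proof -
  obtain P where P: "P \<in> Th n" "a = pr P" using assms by (auto simp: gr_eq)
  thus ?thesis using assms(2) Th_T[OF P(1)] by (auto simp: counit_pr Th_def free_on_iff_lookup)
qed

lemma counit_mult:
  assumes "a \<in> carrier A" "b \<in> carrier A"
  shows "Aphi_counit (a \<otimes>\<^bsub>A\<^esub> b) = Aphi_counit a * Aphi_counit b"
proof -
  obtain P Q where PQ: "P \<in> T" "a = pr P" "Q \<in> T" "b = pr Q" using assms by (meson A_cases)
  \<comment> \<open>The embedding of scalars as multiples of the empty word makes the bilinear principle applicable.\<close>
  let ?g = "\<lambda>c :: 'k. fscale c (gen [] :: 'r list \<Rightarrow>\<^sub>0 'k)"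
  let ?l = "\<lambda>P. Poly_Mapping.lookup P ([] :: 'r list)"
  have "?g (?l (msh P Q)) = ?g (?l P * ?l Q)"
  proof (rule fbilinear_eqI[where f = "\<lambda>P Q. ?g (?l (msh P Q))" and g = "\<lambda>P Q. ?g (?l P * ?l Q)",
        OF _ _ _ _ _ PQ(1,3)])
    fix u v assume uv: "u \<in> lists B" "v \<in> lists B"
    show "?g (?l (msh (gen u) (gen v))) = ?g (?l (gen u) * ?l (gen v))"
    proof (cases "u = [] \<or> v = []")
      case True
      thus ?thesis using uv
        by (elim disjE) (simp_all add: msh_Nil_left msh_Nil_right del: in_lists_conv_set)
    next
      case False
      then obtain x u' y v' where "u = x # u'" "v = y # v'" by (meson list.exhaust)
      thus ?thesis using uv
        by (simp add: msh_word lookup_add lookup_minus lookup_cons_Nil lookup_single del: in_lists_conv_set)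
    qed
  qed (rule flinearI; simp add: lookup_add fs.scale_left_distrib algebra_simps)+
  hence "?l (?g (?l (msh P Q))) = ?l (?g (?l P * ?l Q))" by (rule arg_cong)
  hence "?l (msh P Q) = ?l P * ?l Q" by simp
  thus ?thesis using PQ by (simp add: mult_pr counit_pr msh_T)
qed

lemma counit_left_right:
  assumes "a \<in> carrier A"
  shows "tensor_lift A (\<lambda>b c. Aphi_counit b \<odot>\<^bsub>A\<^esub> c) (\<Delta> a) = a"
    and "tensor_lift A (\<lambda>b c. Aphi_counit c \<odot>\<^bsub>A\<^esub> b) (\<Delta> a) = a"
proof -
  have sl: "k_linear A A (\<lambda>b. Aphi_counit b \<odot>\<^bsub>A\<^esub> c)" if "c \<in> carrier A" for c
    using that by (intro k_linearI)
      (simp_all add: counit_ops AA.V.smult_l_distr[simplified] AA.V.smult_assoc1[simplified])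
  have sr: "k_linear A A (\<lambda>c. Aphi_counit b \<odot>\<^bsub>A\<^esub> c)" for b
    by (rule k_linear_smult[OF QA.kmodule k_linear_id])
  have b1: "k_bilinear A A A (\<lambda>b c. Aphi_counit b \<odot>\<^bsub>A\<^esub> c)"
    by (intro k_bilinearI sl sr)
  have b2: "k_bilinear A A A (\<lambda>b c. Aphi_counit c \<odot>\<^bsub>A\<^esub> b)"
    by (intro k_bilinearI sl sr)
  have lin: "k_linear (free_module (lists B \<times> lists B)) A (\<lambda>Z. pr (lin_ext F Z))"
    if "\<And>u v. u \<in> lists B \<Longrightarrow> v \<in> lists B \<Longrightarrow> F (u, v) \<in> T" for F
    by (rule k_linear_pr_flinear[OF flinear_lin_ext_base]) (use that in auto)
  let ?F1 = "\<lambda>p. if fst p = [] then gen (snd p) else (0 :: 'r list \<Rightarrow>\<^sub>0 'k)"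
  let ?F2 = "\<lambda>p. if snd p = [] then gen (fst p) else (0 :: 'r list \<Rightarrow>\<^sub>0 'k)"
  have e1: "tensor_lift A (\<lambda>b c. Aphi_counit b \<odot>\<^bsub>A\<^esub> c) (q2 Z) = pr (lin_ext ?F1 Z)" if "Z \<in> T2" for Z
    by (rule tensor_lift_q2[OF QA.kmodule b1 lin _ that]) (auto simp: counit_word pr_ops simp del: in_lists_conv_set)
  have e2: "tensor_lift A (\<lambda>b c. Aphi_counit c \<odot>\<^bsub>A\<^esub> b) (q2 Z) = pr (lin_ext ?F2 Z)" if "Z \<in> T2" for Z
    by (rule tensor_lift_q2[OF QA.kmodule b2 lin _ that]) (auto simp: counit_word pr_ops simp del: in_lists_conv_set)
  have d1: "lin_ext ?F1 (dec (gen w)) = gen w" for w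
  proof -
    have "lin_ext ?F1 (dec (gen w)) = (\<Sum>j\<le>length w. if j = 0 then gen w else 0)"
      unfolding dec_gen lin_ext_simps lin_ext_gen by (intro sum.cong) auto
    thus ?thesis by simp
  qed
  have d2: "lin_ext ?F2 (dec (gen w)) = gen w" for w
  proof -
    have "lin_ext ?F2 (dec (gen w)) = (\<Sum>j\<le>length w. if j = length w then gen w else 0)"
      unfolding dec_gen lin_ext_simps lin_ext_gen by (intro sum.cong) auto
    thus ?thesis by simp
  qed
  have T: "dec (gen w) \<in> T2" if "w \<in> lists B" for w using that by (intro dec_T2) simp
  show "tensor_lift A (\<lambda>b c. Aphi_counit b \<odot>\<^bsub>A\<^esub> c) (\<Delta> a) = a"
    by (rule A_eqI[OF k_linear_comp[OF comult_linear AA.k_linear_tensor_lift[OF QA.kmodule b1]] k_linear_id QA.kmodule _ assms])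
       (simp add: comult_word e1[OF T] d1 del: in_lists_conv_set)
  show "tensor_lift A (\<lambda>b c. Aphi_counit c \<odot>\<^bsub>A\<^esub> b) (\<Delta> a) = a"
    by (rule A_eqI[OF k_linear_comp[OF comult_linear AA.k_linear_tensor_lift[OF QA.kmodule b2]] k_linear_id QA.kmodule _ assms])
       (simp add: comult_word e2[OF T] d2 del: in_lists_conv_set)
qed

lemma tensor_mult_q2:
  assumes "Z \<in> T2" "W \<in> T2"
  shows "tensor_mult A Aphi_gr (q2 Z) (q2 W) = q2 (tmul Z W)" (is "?f Z = ?g Z")
proof -
  interpret gs: graded_space A Aphi_gr by (rule graded)
  let ?S = "lists B \<times> lists B"
  note tm = gs.tensor_mult_linear[OF A_mult_bilinear]
  have q2T: "k_linear (free_module ?S) (tensor A A) q2"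
    by (rule k_linear_q2_flinear[where F = "\<lambda>Z. Z"]) (auto intro: flinear_id B_R1)
  have g: "gen p \<in> T2" if "p \<in> ?S" for p using that by simp
  show ?thesis
  proof (rule k_linear_free_eqI[where f = ?f and g = ?g, OF _ _ AA.tens.kmodule _ assms(1)])
    show "k_linear (free_module ?S) (tensor A A) (\<lambda>Z. tensor_mult A Aphi_gr (q2 Z) (q2 W))"
      by (rule k_linear_comp[OF q2T tm(1)[OF q2_closed[OF T2_F2[OF assms(2)]]]])
    show "k_linear (free_module ?S) (tensor A A) (\<lambda>Z. q2 (tmul Z W))"
      by (intro k_linear_q2_flinear flinear_tmul_left flinear_id T2_F2 tmul_T2 g assms(2))
    fix p assume p: "p \<in> ?S"
    show "tensor_mult A Aphi_gr (q2 (gen p)) (q2 W) = q2 (tmul (gen p) W)" (is "?f W = ?g W")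
    proof (rule k_linear_free_eqI[where f = ?f and g = ?g, OF _ _ AA.tens.kmodule _ assms(2)])
      show "k_linear (free_module ?S) (tensor A A) (\<lambda>W. tensor_mult A Aphi_gr (q2 (gen p)) (q2 W))"
        by (rule k_linear_comp[OF q2T tm(2)[OF q2_closed[OF T2_F2[OF g[OF p]]]]])
      show "k_linear (free_module ?S) (tensor A A) (\<lambda>W. q2 (tmul (gen p) W))"
        by (intro k_linear_q2_flinear flinear_tmul_right flinear_id T2_F2 tmul_T2 g p)
      fix r assume r: "r \<in> ?S"
      obtain u1 u2 v1 v2 where pr: "p = (u1, u2)" "r = (v1, v2)" by (cases p, cases r) blast
      have mem: "u1 \<in> lists B" "u2 \<in> lists B" "v1 \<in> lists B" "v2 \<in> lists B" using p r pr by auto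
      have gT: "gen u1 \<in> T" "gen u2 \<in> T" "gen v1 \<in> T" "gen v2 \<in> T" using mem by auto
      have "tensor_mult A Aphi_gr (q2 (gen p)) (q2 (gen r)) = sg (degs u2 * degs v1) \<odot>\<^bsub>tensor A A\<^esub>
          pure_tensor A A (pr (gen u1) \<otimes>\<^bsub>A\<^esub> pr (gen v1)) (pr (gen u2) \<otimes>\<^bsub>A\<^esub> pr (gen v2))"
        unfolding pr q2_gen
        by (rule gs.tensor_mult_pure[OF A_mult_bilinear pr_word_closed[OF mem(1)] pr_word_gr[OF mem(2)]
              pr_word_gr[OF mem(3)] pr_word_closed[OF mem(4)]])
      also have "\<dots> = q2 (tmul (gen p) (gen r))"
        by (simp add: pr tmul_gen q2_ops q2_ftensor mult_pr gT T_F1 msh_T del: gen_free_on)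
      finally show "tensor_mult A Aphi_gr (q2 (gen p)) (q2 (gen r)) = q2 (tmul (gen p) (gen r))" .
    qed
  qed
qed

text \<open>
  Killing the words that begin with \<open>t\<close> in the right factor changes nothing in \<open>A \<otimes> A\<close>, so the identity
  on words applies.
\<close>

lemma comult_mult:
  assumes "a \<in> carrier A" "b \<in> carrier A"
  shows "\<Delta> (a \<otimes>\<^bsub>A\<^esub> b) = tensor_mult A Aphi_gr (\<Delta> a) (\<Delta> b)"
proof -
  obtain P Q where PQ: "P \<in> T" "a = pr P" "Q \<in> T" "b = pr Q" using assms by (meson A_cases)
  have "q2 (dec (msh P Q)) = q2 (map_right killt (dec (msh P Q)))"
    using PQ by (simp add: q2_killt dec_T2 msh_T)
  also have "\<dots> = q2 (tmul (dec P) (dec Q))"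
    using PQ by (simp add: dec_msh q2_killt dec_T2 tmul_T2)
  finally show ?thesis
    using PQ by (simp add: mult_pr comult_pr msh_T tensor_mult_q2 dec_T2)
qed

lemma comult_ring_hom: "\<Delta> \<in> ring_hom A (tensor_algebra A Aphi_gr)"
proof (rule ring_hom_memI)
  fix x y assume xy: "x \<in> carrier A" "y \<in> carrier A"
  show "\<Delta> x \<in> carrier (tensor_algebra A Aphi_gr)"
    using k_linearD(1)[OF comult_linear xy(1)] by (simp add: tensor_algebra_def)
  show "\<Delta> (x \<otimes>\<^bsub>A\<^esub> y) = \<Delta> x \<otimes>\<^bsub>tensor_algebra A Aphi_gr\<^esub> \<Delta> y"
    using comult_mult[OF xy] by (simp add: tensor_algebra_def)
  show "\<Delta> (x \<oplus>\<^bsub>A\<^esub> y) = \<Delta> x \<oplus>\<^bsub>tensor_algebra A Aphi_gr\<^esub> \<Delta> y"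
    using k_linearD(2)[OF comult_linear xy] by (simp add: tensor_algebra_def)
next
  show "\<Delta> \<one>\<^bsub>A\<^esub> = \<one>\<^bsub>tensor_algebra A Aphi_gr\<^esub>"
    by (simp add: tensor_algebra_def A_sel(1) comult_word q2_gen)
qed

text \<open>
  The antipode is computed on a representative; the choice does not matter by the next lemma.
\<close>

definition antipode_A :: "('r list \<Rightarrow>\<^sub>0 'k) set \<Rightarrow> ('r list \<Rightarrow>\<^sub>0 'k) set"
  where "antipode_A a = pr (antip (SOME P. P \<in> T \<and> pr P = a))"

lemma antipode_pr:
  assumes "P \<in> T"
  shows "antipode_A (pr P) = pr (antip P)"
proof -
  have t: "\<exists>Q'\<in>T. antip (cons t Q) = cons t Q'" if "Q \<in> T" for Q
    using that
  proof (induction rule: free_on_induct)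
    case (add f g)
    then obtain Q Q' where "Q \<in> T" "Q' \<in> T" "antip (cons t f) = cons t Q" "antip (cons t g) = cons t Q'" by blast
    thus ?case by (intro bexI[of _ "Q + Q'"]) auto
  next
    case (scale c f)
    then obtain Q where "Q \<in> T" "antip (cons t f) = cons t Q" by blast
    thus ?case by (intro bexI[of _ "fscale c Q"]) auto
  next
    case (gen w)
    thus ?case using antipode_word_t[of w] by (simp add: cons_basis t_B del: in_lists_conv_set)
  qed (auto intro: bexI[of _ 0])
  have k: "pr (antip Q) = pr (antip (killt Q))" if Q: "Q \<in> T" for Q
  proof -
    obtain C where C: "C \<in> T" "Q = killt Q + cons t C" using Q by (rule killt_decomp)
    obtain C' where C': "C' \<in> T" "antip (cons t C) = cons t C'" using t[OF C(1)] by blast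
    have "killt (antip Q) = killt (antip (killt Q))"
      by (subst C(2)) (simp add: C'(2))
    thus ?thesis using Q by (simp add: pr_eq_iff_T antip_T killt_T)
  qed
  define Q where "Q = (SOME Q. Q \<in> T \<and> pr Q = pr P)"
  have "Q \<in> T \<and> pr Q = pr P" unfolding Q_def by (rule someI[of _ P]) (use assms in simp)
  hence "Q \<in> T" "killt Q = killt P" using assms by (auto simp: pr_eq_iff_T)
  thus ?thesis unfolding antipode_A_def Q_def[symmetric] using k[of Q] k[OF assms] by simp
qed

lemma antipode_linear: "k_linear A A antipode_A"
  by (rule k_linear_A_I[OF k_linear_pr_flinear[where F = antip] antipode_pr])
     (use flinear_antip[OF flinear_id] antipode_word_T in \<open>auto simp del: in_lists_conv_set\<close>)

lemma is_antipode: "is_antipode A Aphi_gr \<Delta> Aphi_counit antipode_A"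
  unfolding is_antipode_def
proof (intro conjI allI ballI)
  show "k_linear A A antipode_A" by (rule antipode_linear)
  show "antipode_A ` Aphi_gr n \<subseteq> Aphi_gr n" for n
    by (auto simp: gr_eq antipode_pr Th_T intro!: imageI antip_Th)
  fix a assume a: "a \<in> carrier A"
  have b1: "k_bilinear A A A (\<lambda>b c. antipode_A b \<otimes>\<^bsub>A\<^esub> c)"
    by (rule k_bilinearI)
       (erule k_linear_comp[OF antipode_linear multA(1)], erule multA(2)[OF k_linearD(1)[OF antipode_linear]])
  have b2: "k_bilinear A A A (\<lambda>b c. b \<otimes>\<^bsub>A\<^esub> antipode_A c)"
    by (rule k_bilinearI)
       (erule multA(1)[OF k_linearD(1)[OF antipode_linear]], erule k_linear_comp[OF antipode_linear multA(2)])
  have lin: "k_linear (free_module (lists B \<times> lists B)) A (\<lambda>Z. pr (lin_ext F Z))"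
    if "\<And>u v. u \<in> lists B \<Longrightarrow> v \<in> lists B \<Longrightarrow> F (u, v) \<in> T" for F
    by (rule k_linear_pr_flinear[OF flinear_lin_ext_base]) (use that in auto)
  let ?F1 = "\<lambda>p. msh (antipode_word (fst p)) (gen (snd p))"
  let ?F2 = "\<lambda>p. msh (gen (fst p)) (antipode_word (snd p))"
  have cl: "gen u \<in> T" "antipode_word u \<in> T" if "u \<in> lists B" for u
    using that antipode_word_T by auto
  have e1: "tensor_lift A (\<lambda>b c. antipode_A b \<otimes>\<^bsub>A\<^esub> c) (q2 Z) = pr (lin_ext ?F1 Z)" if "Z \<in> T2" for Z
    by (rule tensor_lift_q2[OF QA.kmodule b1 lin _ that])
       (simp_all add: antipode_pr mult_pr cl msh_T del: in_lists_conv_set)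
  have e2: "tensor_lift A (\<lambda>b c. b \<otimes>\<^bsub>A\<^esub> antipode_A c) (q2 Z) = pr (lin_ext ?F2 Z)" if "Z \<in> T2" for Z
    by (rule tensor_lift_q2[OF QA.kmodule b2 lin _ that])
       (simp_all add: antipode_pr mult_pr cl msh_T del: in_lists_conv_set)
  have d1: "lin_ext ?F1 (dec (gen w)) = (if w = [] then gen [] else 0)" if "w \<in> lists B" for w
    using antipode_word_left[OF that] by (simp add: dec_gen)
  have d2: "lin_ext ?F2 (dec (gen w)) = (if w = [] then gen [] else 0)" if "w \<in> lists B" for w
    using antipode_word_right[OF that] by (simp add: dec_gen)
  have T: "dec (gen w) \<in> T2" if "w \<in> lists B" for w using that by (intro dec_T2) simp
  have one: "\<one>\<^bsub>A\<^esub> \<in> carrier A" unfolding A_sel by (rule pr_closed[OF Nil_T])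
  have u: "k_linear A A (\<lambda>a. Aphi_counit a \<odot>\<^bsub>A\<^esub> \<one>\<^bsub>A\<^esub>)"
    using one by (intro k_linearI)
      (simp_all add: counit_ops AA.V.smult_l_distr[simplified] AA.V.smult_assoc1[simplified])
  have c: "Aphi_counit (pr (gen w)) \<odot>\<^bsub>A\<^esub> \<one>\<^bsub>A\<^esub> = pr (if w = [] then gen [] else 0)" if "w \<in> lists B" for w
    using that by (simp add: counit_word A_sel(1) pr_ops del: in_lists_conv_set)
  show "tensor_lift A (\<lambda>b c. antipode_A b \<otimes>\<^bsub>A\<^esub> c) (\<Delta> a) = Aphi_counit a \<odot>\<^bsub>A\<^esub> \<one>\<^bsub>A\<^esub>"
    by (rule A_eqI[OF k_linear_comp[OF comult_linear AA.k_linear_tensor_lift[OF QA.kmodule b1]] u QA.kmodule _ a])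
       (simp only: comult_word e1[OF T] d1 c)
  show "tensor_lift A (\<lambda>b c. b \<otimes>\<^bsub>A\<^esub> antipode_A c) (\<Delta> a) = Aphi_counit a \<odot>\<^bsub>A\<^esub> \<one>\<^bsub>A\<^esub>"
    by (rule A_eqI[OF k_linear_comp[OF comult_linear AA.k_linear_tensor_lift[OF QA.kmodule b2]] u QA.kmodule _ a])
       (simp only: comult_word e2[OF T] d2 c)
qed

lemma graded_hopf: "graded_hopf_algebra A Aphi_gr \<Delta> Aphi_counit"
proof (intro graded_hopf_algebra.intro graded_hopf_algebra_axioms.intro graded ring_A)
  show "(c \<odot>\<^bsub>A\<^esub> a) \<otimes>\<^bsub>A\<^esub> b = c \<odot>\<^bsub>A\<^esub> (a \<otimes>\<^bsub>A\<^esub> b)" if "a \<in> carrier A" "b \<in> carrier A" for a b c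
    by (rule k_linearD(3)[OF multA(1)[OF that(2)] that(1)])
  show "a \<otimes>\<^bsub>A\<^esub> (c \<odot>\<^bsub>A\<^esub> b) = c \<odot>\<^bsub>A\<^esub> (a \<otimes>\<^bsub>A\<^esub> b)" if "a \<in> carrier A" "b \<in> carrier A" for a b c
    by (rule k_linearD(3)[OF multA(2)[OF that(1)] that(2)])
  show "\<one>\<^bsub>A\<^esub> \<in> Aphi_gr 0" using pr_word_gr[of "[]"] by (simp add: A_sel(1))
  show "a \<otimes>\<^bsub>A\<^esub> b \<in> Aphi_gr (i + j)" if "a \<in> Aphi_gr i" "b \<in> Aphi_gr j" for a b i j
    using that by (auto simp: gr_eq mult_pr Th_T intro!: imageI msh_Th)
  show "Aphi_counit \<one>\<^bsub>A\<^esub> = 1" by (simp add: A_sel(1) counit_word)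
qed (fact comult_linear comult_degree counit_ops counit_degree comult_coassoc counit_left_right
     comult_ring_hom counit_mult exI[of "is_antipode A Aphi_gr \<Delta> Aphi_counit", OF is_antipode])+

subsection \<open>The differential\<close>

lemma diff_linear: "k_linear A A Aphi_diff"
  by (rule k_linear_A_I[OF k_linear_pr_flinear[where F = mdf] diff_pr])
     (use flinear_mdf[OF flinear_id] mdf_T in \<open>auto simp del: in_lists_conv_set\<close>)

lemma differential: "is_differential A Aphi_gr Aphi_diff"
  unfolding is_differential_def
proof (intro conjI allI ballI diff_linear)
  show "Aphi_diff ` Aphi_gr n \<subseteq> Aphi_gr (n + 1)" for n
    by (auto simp: gr_eq diff_pr Th_T intro!: imageI mdf_Th)
  show "Aphi_diff (Aphi_diff a) = \<zero>\<^bsub>A\<^esub>" if "a \<in> carrier A" for a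
    using that by (auto elim!: A_cases simp: diff_pr mdf_T mdf_mdf pr_ops)
qed

lemma coderivation: "is_coderivation A Aphi_gr \<Delta> Aphi_counit Aphi_diff"
  unfolding is_coderivation_def
proof (intro ballI conjI)
  interpret gs: graded_space A Aphi_gr by (rule graded)
  fix a assume "a \<in> carrier A"
  then obtain P where P: "P \<in> T" "a = pr P" by (rule A_cases)
  show "Aphi_counit (Aphi_diff a) = 0"
    using P by (simp add: diff_pr counit_pr mdf_T lookup_mdf_Nil)
  let ?S = "lists B \<times> lists B"
  have q2T: "k_linear (free_module ?S) (tensor A A) q2"
    by (rule k_linear_q2_flinear[where F = "\<lambda>Z. Z"]) (auto intro: flinear_id B_R1)
  have gT: "map_left mdf (gen p) + signed_mdf2 (gen p) \<in> T2" if "p \<in> ?S" for p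
  proof -
    obtain u v where p: "p = (u, v)" "gen u \<in> T" "gen v \<in> T" using \<open>p \<in> ?S\<close> by auto
    thus ?thesis
      by (auto simp: map_left_gen signed_mdf2_def intro!: free_on_closed ftensor_closed mdf_T)
  qed
  have "tensor_diff A Aphi_gr Aphi_diff (q2 Z) = q2 (map_left mdf Z + signed_mdf2 Z)" (is "?f Z = ?g Z") if Z: "Z \<in> T2" for Z
  proof (rule k_linear_free_eqI[where f = ?f and g = ?g, OF _ _ AA.tens.kmodule _ Z])
    show "k_linear (free_module ?S) (tensor A A) (\<lambda>Z. tensor_diff A Aphi_gr Aphi_diff (q2 Z))"
      by (rule k_linear_comp[OF q2T gs.tensor_diff_linear[OF diff_linear]])
    show "k_linear (free_module ?S) (tensor A A) (\<lambda>Z. q2 (map_left mdf Z + signed_mdf2 Z))"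
      by (intro k_linear_q2_flinear flinear_plus flinear_map_left flinear_signed_mdf2 flinear_id T2_F2 gT)
    fix p assume "p \<in> ?S"
    then obtain u v where p: "p = (u, v)" "u \<in> lists B" "v \<in> lists B" by blast
    have g: "gen u \<in> T" "gen v \<in> T" using p by auto
    show "tensor_diff A Aphi_gr Aphi_diff (q2 (gen p)) = q2 (map_left mdf (gen p) + signed_mdf2 (gen p))"
      unfolding p(1) q2_gen gs.tensor_diff_pure[OF diff_linear pr_word_gr[OF p(2)] pr_word_closed[OF p(3)]]
      by (simp add: map_left_gen signed_mdf2_def q2_ops q2_ftensor g T_F1 mdf_T diff_pr del: gen_free_on)
  qed
  thus "\<Delta> (Aphi_diff a) = tensor_diff A Aphi_gr Aphi_diff (\<Delta> a)"
    using P by (simp add: diff_pr comult_pr mdf_T dec_T2 dec_mdf)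
qed

lemma hopf_dg:
  assumes comm: "graded_commutative"
  shows "hopf_dg_algebra A Aphi_gr \<Delta> Aphi_counit Aphi_diff"
proof (intro hopf_dg_algebra.intro hopf_dg_algebra_axioms.intro graded_hopf differential coderivation)
  show "is_derivation A Aphi_gr Aphi_diff"
    unfolding is_derivation_def
  proof (intro allI ballI)
    fix n a b assume "a \<in> Aphi_gr n" "b \<in> carrier A"
    then obtain P Q where PQ: "P \<in> Th n" "a = pr P" "Q \<in> T" "b = pr Q"
      by (auto simp: gr_eq elim!: A_cases)
    have P: "P \<in> T" by (rule Th_T[OF PQ(1)])
    show "Aphi_diff (a \<otimes>\<^bsub>A\<^esub> b) = Aphi_diff a \<otimes>\<^bsub>A\<^esub> b \<oplus>\<^bsub>A\<^esub> sg n \<odot>\<^bsub>A\<^esub> (a \<otimes>\<^bsub>A\<^esub> Aphi_diff b)"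
      using P PQ by (simp add: mult_pr diff_pr msh_T mdf_T mdf_msh[OF comm PQ(1,3)] pr_ops)
  qed
  have "Aphi_diff (antipode_A a) = antipode_A (Aphi_diff a)" if "a \<in> carrier A" for a
    using that by (auto elim!: A_cases simp: antipode_pr diff_pr antip_T mdf_T mdf_antip[OF comm])
  thus "\<exists>S. is_antipode A Aphi_gr \<Delta> Aphi_counit S \<and> (\<forall>a\<in>carrier A. Aphi_diff (S a) = S (Aphi_diff a))"
    using is_antipode by blast
qed

end

theorem theorem5p11:
  fixes scale :: "'k::field \<Rightarrow> 'r::ring_1 \<Rightarrow> 'r"
    and G :: "int \<Rightarrow> int \<Rightarrow> 'r set"
    and d :: "'r \<Rightarrow> 'r"
    and L :: "'r set"
    and t :: 'r
  assumes R: "tate_phi_dg_algebra scale G d L"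
    and t: "t \<in> L" "t \<noteq> 0"
  defines "A \<equiv> tate_phi_dg_algebra.Aphi scale G L t"
    and "gr \<equiv> tate_phi_dg_algebra.Aphi_gr scale G L"
    and "\<Delta> \<equiv> tate_phi_dg_algebra.Aphi_comult scale G L t"
    and "\<epsilon> \<equiv> tate_phi_dg_algebra.Aphi_counit"
    and "D \<equiv> tate_phi_dg_algebra.Aphi_diff scale G d L"
  shows "is_differential A gr D \<and>
    graded_hopf_algebra A gr \<Delta> \<epsilon> \<and>
    is_coderivation A gr \<Delta> \<epsilon> D \<and>
    (tate_phi_dg_algebra.graded_commutative scale G \<longrightarrow> hopf_dg_algebra A gr \<Delta> \<epsilon> D)"
proof -
  obtain B where "tate_basis scale G d L t B"
    using tate_phi_dg_algebra.tate_basis_exists[OF R t] .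
  then interpret tate_basis scale G d L t B .
  show ?thesis
    unfolding A_def gr_def \<Delta>_def \<epsilon>_def D_def
    using differential graded_hopf coderivation hopf_dg by blast
qed

end
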